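(* There are absolute constants $c,C>0$ such that for all positive integers $k_1\le k_2$, with $n=k_1+k_2$, the following holds for an $n$-qubit system divided into a set $A$ of $k_1$ qubits and a set $B$ of $k_2$ qubits: $$c\,4^{k_1}\;\le\;\max_{U\in\mathrm{U}(2^n)}\mathcal{C}_b(U)\;\le\; C\,4^{k_1}.$$ That is, the bipartite binding complexity of synthesizing an arbitrary given $n$-qubit unitary is $\Theta(4^{k_1})$: $O(4^{k_1})$ straddling gates suffice for every unitary, and $\Omega(4^{k_1})$ straddling gates are required for some unitary.
   Context: A straddling gate is a two-qubit gate (any element of $\mathrm{SU}(4)$) acting on one qubit of $A$ and one qubit of $B$. Unitaries acting only on the qubits of $A$, or only on the qubits of $B$, are free and are not counted. For $U\in\mathrm{U}(2^n)$, the binding complexity $\mathcal{C}_b(U)$ is the minimum number of straddling gates in a circuit, composed of straddling gates and free local unitaries and using no ancilla qubits, that implements $U$ exactly. *)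

theory Defs
  imports
    "Jordan_Normal_Form.Schur_Decomposition"
    "HOL-Library.Extended_Real"
begin

definition unitary_group :: "nat \<Rightarrow> complex mat set" where
  "unitary_group d =
     {U \<in> carrier_mat d d. U * mat_adjoint U = 1\<^sub>m d \<and> mat_adjoint U * U = 1\<^sub>m d}"

definition special_unitary_group :: "nat \<Rightarrow> complex mat set" where
  "special_unitary_group d = {U \<in> unitary_group d. det U = 1}"

text \<open>
  The qubits of an \<open>n\<close>-qubit system are \<open>0, \<dots>, n - 1\<close>. The computational basis vectors are
  numbered by the naturals below \<open>2 ^ n\<close>: in basis vector \<open>i\<close>, qubit \<open>q\<close> has the value \<open>bit i q\<close>.

  \<open>subregister qs i\<close> is the basis index that remains of \<open>i\<close> when only the qubits listed in \<open>qs\<close> are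
  kept, the entry at position \<open>l\<close> of \<open>qs\<close> becoming qubit \<open>l\<close>.
\<close>

definition subregister :: "nat list \<Rightarrow> nat \<Rightarrow> nat" where
  "subregister qs i = horner_sum of_bool 2 (map (bit i) qs)"

text \<open>
  The operator on \<open>n\<close> qubits that acts as \<open>G\<close> on the qubits listed in \<open>qs\<close> and as the identity on
  all others, that is, \<open>G\<close> tensored with the identity, up to the ordering of the tensor factors.
\<close>

definition apply_on :: "nat \<Rightarrow> nat list \<Rightarrow> complex mat \<Rightarrow> complex mat" where
  "apply_on n qs G = mat (2 ^ n) (2 ^ n) (\<lambda>(i, j).
     if \<forall>q<n. q \<notin> set qs \<longrightarrow> (bit i q \<longleftrightarrow> bit j q)
     then G $$ (subregister qs i, subregister qs j) else 0)"

datatype gate =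
    Local_A "complex mat"
  | Local_B "complex mat"
  | Straddling nat nat "complex mat"

fun valid_gate :: "nat set \<Rightarrow> nat set \<Rightarrow> gate \<Rightarrow> bool" where
  "valid_gate A B (Local_A V) \<longleftrightarrow> V \<in> unitary_group (2 ^ card A)"
| "valid_gate A B (Local_B V) \<longleftrightarrow> V \<in> unitary_group (2 ^ card B)"
| "valid_gate A B (Straddling p q G) \<longleftrightarrow> p \<in> A \<and> q \<in> B \<and> G \<in> special_unitary_group 4"

fun gate_operator :: "nat \<Rightarrow> nat set \<Rightarrow> nat set \<Rightarrow> gate \<Rightarrow> complex mat" where
  "gate_operator n A B (Local_A V) = apply_on n (sorted_list_of_set A) V"
| "gate_operator n A B (Local_B V) = apply_on n (sorted_list_of_set B) V"
| "gate_operator n A B (Straddling p q G) = apply_on n [p, q] G"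

text \<open>The gate at the head of the list is the last one to act.\<close>

fun circuit_operator :: "nat \<Rightarrow> nat set \<Rightarrow> nat set \<Rightarrow> gate list \<Rightarrow> complex mat" where
  "circuit_operator n A B [] = 1\<^sub>m (2 ^ n)"
| "circuit_operator n A B (g # gs) = gate_operator n A B g * circuit_operator n A B gs"

definition implements :: "nat \<Rightarrow> nat set \<Rightarrow> nat set \<Rightarrow> gate list \<Rightarrow> complex mat \<Rightarrow> bool" where
  "implements n A B gs U \<longleftrightarrow>
     (\<forall>g \<in> set gs. valid_gate A B g) \<and> circuit_operator n A B gs = U"

fun is_straddling :: "gate \<Rightarrow> bool" where
  "is_straddling (Straddling p q G) \<longleftrightarrow> True"
| "is_straddling _ \<longleftrightarrow> False"

definition straddling_count :: "gate list \<Rightarrow> nat" where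
  "straddling_count gs = length (filter is_straddling gs)"

text \<open>
  Minimum and maximum are taken in the extended naturals. A unitary that no circuit implements
  exactly would have complexity \<open>\<infinity>\<close>; a nonempty set of extended naturals attains its infimum, and
  it attains its supremum whenever that supremum is finite.
\<close>

definition binding_complexity :: "nat \<Rightarrow> nat set \<Rightarrow> nat set \<Rightarrow> complex mat \<Rightarrow> enat" where
  "binding_complexity n A B U = (INF gs \<in> {gs. implements n A B gs U}. enat (straddling_count gs))"

definition max_binding_complexity :: "nat \<Rightarrow> nat set \<Rightarrow> nat set \<Rightarrow> enat" where
  "max_binding_complexity n A B = (SUP U \<in> unitary_group (2 ^ n). binding_complexity n A B U)"

end

theory Submission
  imports Defs
begin

text \<open>
  Write \<open>K = 2 ^ k1\<close> for the number of levels of \<open>A\<close> and \<open>N = 2 ^ k2\<close>, and see an operator as a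
  \<open>K \<times> K\<close> matrix of \<open>N \<times> N\<close> blocks.

  Upper bound. Iterating the cosine-sine decomposition on \<open>A\<close> writes every unitary as a product of
  \<open>O(K\<^sup>2)\<close> unitaries that act on \<open>B\<close> and on a single level of \<open>A\<close>; the rotations that occur are
  block diagonal up to conjugation by a unitary of \<open>A\<close>. A unitary on a single level is diagonal up to
  conjugation by a unitary of \<open>B\<close>, and a diagonal unitary is a scalar times two diagonals whose
  entries come in conjugate pairs. Each of these is a commutator of controlled bit flips
  that takes six straddling gates, independently of \<open>K\<close> and \<open>N\<close>.

  Lower bound. The circuits with \<open>s\<close> straddling gates form a set of box dimension at most
  \<open>O((s + 1) * (K\<^sup>2 + N\<^sup>2))\<close>, because neighbouring local unitaries can be merged. The Cayley transform of
  real skew-symmetric matrices shows that the unitary group has box dimension at least of order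
  \<open>K\<^sup>2 * N\<^sup>2\<close>, so that \<open>s\<close> is at least of order \<open>K\<^sup>2\<close>. A diagonal unitary that is not a tensor product
  takes care of \<open>s = 0\<close>.
\<close>

section \<open>Unitary matrices\<close>

text \<open>The obstacle in the synthesis is to address a single level of \<open>A\<close>: a
  straddling gate sees one qubit of each side, so the flip it controls acts on half of all levels.
  In a commutator, each level on which one of the two operators is the identity drops out. The
  second operator is confined to two levels by a controlled operation and its inverse, one of them
  with its control set moved by a free permutation of the levels: they cancel wherever the control
  sets agree. Conjugate pairs enter because a flip turns a diagonal of this kind into its inverse.
  The flips carry a factor \<open>\<i>\<close> or \<open>- \<i>\<close> because the plain controlled
  flip has determinant -1.

  In the lower bound the local unitaries of \<open>B\<close> have far more parameters than a
  straddling gate, so the gates cannot be counted by their own parameters. Charging each gate with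
  the dimension of a neighbouring local layer is affordable: for K \<le> N it is of order N^2, which
  cancels against K^2 N^2. Box dimension replaces manifold dimension since it needs only finite
  covers and Lipschitz maps.\<close>

lemma dim_mat_adjoint [simp]:
  "dim_row (mat_adjoint A) = dim_col A" "dim_col (mat_adjoint A) = dim_row A"
  unfolding mat_adjoint_def by auto

lemma mat_adjoint_carrier [simp, intro]:
  "A \<in> carrier_mat m n \<Longrightarrow> mat_adjoint A \<in> carrier_mat n m"
  by auto

lemma mat_adjoint_index [simp]:
  "i < dim_col A \<Longrightarrow> j < dim_row A \<Longrightarrow> mat_adjoint A $$ (i, j) = cnj (A $$ (j, i))"
  by (simp add: mat_adjoint_def mat_of_rows_def)

lemma mult_carrier_mat_square [simp]:
  "A \<in> carrier_mat d d \<Longrightarrow> B \<in> carrier_mat d d \<Longrightarrow> A * B \<in> carrier_mat d d"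
  by auto

lemma mult_one_mat_square [simp]:
  fixes A :: "complex mat"
  shows "A \<in> carrier_mat d d \<Longrightarrow> A * 1\<^sub>m d = A"
    and "A \<in> carrier_mat d d \<Longrightarrow> 1\<^sub>m d * A = A"
  by auto

lemma mult_mat_index:
  "A \<in> carrier_mat n m \<Longrightarrow> B \<in> carrier_mat m k \<Longrightarrow> i < n \<Longrightarrow> j < k \<Longrightarrow>
    (A * B) $$ (i, j) = (\<Sum>l<m. A $$ (i, l) * B $$ (l, j))"
  by (auto simp: scalar_prod_def lessThan_atLeast0)

lemma mat_adjoint_mult_index:
  "A \<in> carrier_mat m n \<Longrightarrow> B \<in> carrier_mat m k \<Longrightarrow> i < n \<Longrightarrow> j < k \<Longrightarrow>
    (mat_adjoint A * B) $$ (i, j) = (\<Sum>l<m. cnj (A $$ (l, i)) * B $$ (l, j))"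
  by (subst mult_mat_index[of _ n m _ k]) auto

lemma mat_adjoint_adjoint [simp]: "mat_adjoint (mat_adjoint A) = (A :: complex mat)"
  by (rule eq_matI) auto

lemma mat_adjoint_mult:
  fixes A :: "complex mat"
  assumes "A \<in> carrier_mat m n" "B \<in> carrier_mat n k"
  shows "mat_adjoint (A * B) = mat_adjoint B * mat_adjoint A"
  by (rule eq_matI) (use assms in \<open>auto simp: scalar_prod_def mult.commute\<close>)

lemma mat_adjoint_one [simp]: "mat_adjoint (1\<^sub>m n) = (1\<^sub>m n :: complex mat)"
  by (rule eq_matI) auto

text \<open>A one-sided inverse of a square matrix is two-sided, so one of the two defining
  equations is enough.\<close>

lemma unitary_groupI:
  "U \<in> carrier_mat d d \<Longrightarrow> mat_adjoint U * U = 1\<^sub>m d \<Longrightarrow> U \<in> unitary_group d"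
  unfolding unitary_group_def
  using mat_mult_left_right_inverse[of "mat_adjoint U" d U] by auto

lemma unitary_carrier [simp]: "U \<in> unitary_group d \<Longrightarrow> U \<in> carrier_mat d d"
  unfolding unitary_group_def by auto

lemma unitary_mult_adjoint [simp]:
  "U \<in> unitary_group d \<Longrightarrow> U * mat_adjoint U = 1\<^sub>m d"
  "U \<in> unitary_group d \<Longrightarrow> mat_adjoint U * U = 1\<^sub>m d"
  unfolding unitary_group_def by auto

lemma unitary_adjoint [simp]: "U \<in> unitary_group d \<Longrightarrow> mat_adjoint U \<in> unitary_group d"
  unfolding unitary_group_def by auto

lemma unitary_one [simp]: "1\<^sub>m d \<in> unitary_group d"
  unfolding unitary_group_def by auto

text \<open>In products associated to the right, an inverse pair followed by a further factor is not
  a subterm of its own; this form cancels it.\<close>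

lemma mult_cancel_inverse_mid:
  fixes A :: "complex mat"
  assumes "A \<in> carrier_mat d d" "B \<in> carrier_mat d d" "C \<in> carrier_mat d d"
    and "A * B = 1\<^sub>m d"
  shows "A * (B * C) = C"
proof -
  have "A * (B * C) = A * B * C"
    using assms by (intro assoc_mult_mat[symmetric]) auto
  then show ?thesis using assms by simp
qed

lemma unitary_mult [simp]:
  assumes "U \<in> unitary_group d" "V \<in> unitary_group d"
  shows "U * V \<in> unitary_group d"
proof (rule unitary_groupI)
  have [simp]: "U \<in> carrier_mat d d" "V \<in> carrier_mat d d" using assms by auto
  show "U * V \<in> carrier_mat d d" by simp
  have "mat_adjoint (U * V) * (U * V) = mat_adjoint V * (mat_adjoint U * (U * V))"
    by (simp add: mat_adjoint_mult[of _ d d _ d] assoc_mult_mat[of _ d d _ d _ d])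
  also have "mat_adjoint U * (U * V) = V"
    by (rule mult_cancel_inverse_mid) (use assms in auto)
  finally show "mat_adjoint (U * V) * (U * V) = 1\<^sub>m d" using assms by simp
qed

lemma unitary_col_norm:
  assumes "U \<in> unitary_group d" "j < d"
  shows "(\<Sum>l<d. (cmod (U $$ (l, j)))\<^sup>2) = 1"
proof -
  have "complex_of_real (\<Sum>l<d. (cmod (U $$ (l, j)))\<^sup>2) = (mat_adjoint U * U) $$ (j, j)"
    using assms by (subst mat_adjoint_mult_index[of _ d d _ d])
      (auto simp: complex_norm_square mult.commute simp del: of_real_power)
  then show ?thesis
    using assms by (simp del: of_real_sum)
qed

lemma unitary_entry_le_1:
  assumes "U \<in> unitary_group d" "i < d" "j < d"
  shows "cmod (U $$ (i, j)) \<le> 1"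
proof -
  have "(cmod (U $$ (i, j)))\<^sup>2 \<le> (\<Sum>l<d. (cmod (U $$ (l, j)))\<^sup>2)"
    using assms by (intro member_le_sum) auto
  then show ?thesis
    using unitary_col_norm[OF assms(1,3)] by (simp add: power_le_one_iff abs_square_le_1)
qed

lemma mat_diag_adjoint: "mat_adjoint (mat_diag n f) = mat_diag n (\<lambda>i. cnj (f i))"
  by (rule eq_matI) (auto simp: mat_diag_def)

lemma mat_diag_unitary: "(\<And>i. i < n \<Longrightarrow> cmod (f i) = 1) \<Longrightarrow> mat_diag n f \<in> unitary_group n"
  by (intro unitary_groupI)
    (auto simp: mat_diag_adjoint complex_norm_square[symmetric] mult.commute[of "cnj _"],
     auto simp: mat_diag_def intro!: eq_matI)

section \<open>Direct sums of two blocks\<close>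

definition mat_dsum :: "complex mat \<Rightarrow> complex mat \<Rightarrow> complex mat" where
  "mat_dsum A B = four_block_mat A (0\<^sub>m (dim_row A) (dim_col B)) (0\<^sub>m (dim_row B) (dim_col A)) B"

lemma mat_dsum_carrier [simp]:
  "A \<in> carrier_mat p q \<Longrightarrow> B \<in> carrier_mat r s \<Longrightarrow> mat_dsum A B \<in> carrier_mat (p + r) (q + s)"
  unfolding mat_dsum_def by auto

lemma mat_dsum_index:
  "A \<in> carrier_mat p p \<Longrightarrow> B \<in> carrier_mat r r \<Longrightarrow> i < p + r \<Longrightarrow> j < p + r \<Longrightarrow>
    mat_dsum A B $$ (i, j) =
      (if i < p \<and> j < p then A $$ (i, j)
       else if p \<le> i \<and> p \<le> j then B $$ (i - p, j - p) else 0)"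
  unfolding mat_dsum_def by (auto simp: carrier_matD)

lemma mat_dsum_mult:
  assumes "A \<in> carrier_mat p p" "A' \<in> carrier_mat p p"
    "B \<in> carrier_mat r r" "B' \<in> carrier_mat r r"
  shows "mat_dsum A B * mat_dsum A' B' = mat_dsum (A * A') (B * B')"
  unfolding mat_dsum_def using assms
  by (subst mult_four_block_mat[of _ p p _ r _ r _ _ p _ r]) auto

lemma mat_dsum_adjoint:
  assumes "A \<in> carrier_mat p p" "B \<in> carrier_mat r r"
  shows "mat_adjoint (mat_dsum A B) = mat_dsum (mat_adjoint A) (mat_adjoint B)"
proof (rule eq_matI)
  show "dim_row (mat_adjoint (mat_dsum A B)) = dim_row (mat_dsum (mat_adjoint A) (mat_adjoint B))"
       "dim_col (mat_adjoint (mat_dsum A B)) = dim_col (mat_dsum (mat_adjoint A) (mat_adjoint B))"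
    using assms unfolding mat_dsum_def by auto
  fix i j
  assume "i < dim_row (mat_dsum (mat_adjoint A) (mat_adjoint B))"
    "j < dim_col (mat_dsum (mat_adjoint A) (mat_adjoint B))"
  then have "i < p + r" "j < p + r"
    using assms unfolding mat_dsum_def by auto
  moreover have "mat_dsum A B \<in> carrier_mat (p + r) (p + r)"
    using assms by simp
  ultimately show "mat_adjoint (mat_dsum A B) $$ (i, j) =
      mat_dsum (mat_adjoint A) (mat_adjoint B) $$ (i, j)"
    using assms carrier_matD[of "mat_dsum A B" "p + r" "p + r"]
    by (subst mat_adjoint_index) (auto simp: mat_dsum_index[of _ p _ r])
qed

lemma mat_dsum_one: "mat_dsum (1\<^sub>m p) (1\<^sub>m r) = 1\<^sub>m (p + r)"
proof (rule eq_matI)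
  show "dim_row (mat_dsum (1\<^sub>m p) (1\<^sub>m r)) = dim_row (1\<^sub>m (p + r))"
    "dim_col (mat_dsum (1\<^sub>m p) (1\<^sub>m r)) = dim_col (1\<^sub>m (p + r))"
    by (auto simp: mat_dsum_def)
qed (auto simp: mat_dsum_index[of _ p _ r])

lemma mat_dsum_unitary [simp]:
  assumes "A \<in> unitary_group p" "B \<in> unitary_group r"
  shows "mat_dsum A B \<in> unitary_group (p + r)"
  using assms by (intro unitary_groupI)
    (auto simp: mat_dsum_adjoint[of _ p _ r] mat_dsum_mult[of _ p _ _ r] mat_dsum_one)

lemma mat_dsum_eqI:
  assumes "M \<in> carrier_mat (p + r) (p + r)" "A \<in> carrier_mat p p" "B \<in> carrier_mat r r"
    "\<And>i j. i < p \<Longrightarrow> j < p \<Longrightarrow> M $$ (i, j) = A $$ (i, j)"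
    "\<And>i j. i < p \<Longrightarrow> j < r \<Longrightarrow> M $$ (i, p + j) = 0"
    "\<And>i j. i < r \<Longrightarrow> j < p \<Longrightarrow> M $$ (p + i, j) = 0"
    "\<And>i j. i < r \<Longrightarrow> j < r \<Longrightarrow> M $$ (p + i, p + j) = B $$ (i, j)"
  shows "M = mat_dsum A B"
proof (rule eq_matI)
  have D: "mat_dsum A B \<in> carrier_mat (p + r) (p + r)" using assms by simp
  then show "dim_row M = dim_row (mat_dsum A B)" "dim_col M = dim_col (mat_dsum A B)"
    using assms(1) by auto
  fix i j assume "i < dim_row (mat_dsum A B)" "j < dim_col (mat_dsum A B)"
  then have ij: "i < p + r" "j < p + r" using D by auto
  show "M $$ (i, j) = mat_dsum A B $$ (i, j)"
    using assms(4)[of i j] assms(5)[of i "j - p"] assms(6)[of "i - p" j]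
      assms(7)[of "i - p" "j - p"] ij assms(2,3)
    by (auto simp: mat_dsum_index[of _ p _ r])
qed

section \<open>Spectral theorem for normal matrices and polar form\<close>

lemma unitary_completion:
  fixes v :: "complex vec"
  assumes v: "v \<in> carrier_vec n" and v0: "v \<noteq> 0\<^sub>v n"
  obtains W r where "W \<in> unitary_group n" "0 < (r :: real)"
    "\<And>i. i < n \<Longrightarrow> W $$ (i, 0) = v $ i / of_real r"
proof -
  interpret cof_vec_space n "TYPE(complex)" .
  define b where "b = basis_completion v"
  \<comment> \<open>Gram-Schmidt keeps the first vector, so \<open>v\<close> remains the first
    column up to its norm.\<close>
  define ws where "ws = gram_schmidt n b"
  from v v0 have n: "n \<noteq> 0" by auto
  from basis_completion[OF v v0, folded b_def]
  have dist_b: "distinct b"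
    and indep: "\<not> lin_dep (set b)" and b: "set b \<subseteq> carrier_vec n" and hdb: "hd b = v"
    and len_b: "length b = n" by auto
  from hdb len_b n obtain vs where bv: "b = v # vs" by (cases b, auto)
  from gram_schmidt_result[OF b dist_b indep refl, folded ws_def]
  have ws: "set ws \<subseteq> carrier_vec n" "corthogonal ws" "length ws = n"
    by (auto simp: len_b)
  from gram_schmidt_hd[OF v, of vs, folded bv] have hdws: "hd ws = v" unfolding ws_def .
  \<comment> \<open>\<open>gram_schmidt\<close> orthogonalises without normalising, hence the
    explicit norms. The norm of \<open>v\<close> is the \<open>r\<close> of the statement.\<close>
  define r where "r j = sqrt (\<Sum>l<n. (cmod (ws ! j $ l))\<^sup>2)" for j
  have wsc: "ws ! j \<in> carrier_vec n" if "j < n" for j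
    using ws that by auto
  have ip: "ws ! i \<bullet>c ws ! j = (\<Sum>l<n. ws ! i $ l * cnj (ws ! j $ l))" if "i < n" "j < n" for i j
    using wsc[OF that(1)] wsc[OF that(2)]
    by (auto simp: scalar_prod_def lessThan_atLeast0 conjugate_complex_def)
  have orth: "(ws ! i \<bullet>c ws ! j = 0) = (i \<noteq> j)" if "i < n" "j < n" for i j
    using corthogonalD[OF ws(2)] that ws(3) by auto
  have r2: "complex_of_real ((r j)\<^sup>2) = ws ! j \<bullet>c ws ! j" if "j < n" for j
    using that by (simp add: r_def ip sum_nonneg complex_norm_square del: of_real_power)
  have rpos: "r j > 0" if "j < n" for j
  proof -
    have "r j \<noteq> 0" using orth[OF that that] r2[OF that] by auto
    moreover have "r j \<ge> 0" by (simp add: r_def sum_nonneg)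
    ultimately show ?thesis by simp
  qed
  define W where "W = mat n n (\<lambda>(i, j). ws ! j $ i / of_real (r j))"
  have W: "W \<in> carrier_mat n n" by (simp add: W_def)
  have "mat_adjoint W * W = 1\<^sub>m n"
  proof (rule eq_matI)
    fix i j assume "i < dim_row (1\<^sub>m n :: complex mat)" "j < dim_col (1\<^sub>m n :: complex mat)"
    then have ij: "i < n" "j < n" by auto
    have "(mat_adjoint W * W) $$ (i, j) =
        (\<Sum>l<n. cnj (ws ! i $ l / of_real (r i)) * (ws ! j $ l / of_real (r j)))"
      using ij by (subst mat_adjoint_mult_index[OF W W]) (auto simp: W_def)
    also have "\<dots> = (ws ! j \<bullet>c ws ! i) / of_real (r i * r j)"
      using ij by (simp add: ip sum_divide_distrib mult.commute)
    also have "\<dots> = (if i = j then 1 else 0)"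
      using orth[OF ij(2,1)] r2[OF ij(1)] rpos[OF ij(1)]
      by (auto simp: power2_eq_square[symmetric] simp flip: of_real_power of_real_mult)
    finally show "(mat_adjoint W * W) $$ (i, j) = 1\<^sub>m n $$ (i, j)" using ij by simp
  qed (use W in auto)
  then have "W \<in> unitary_group n" by (rule unitary_groupI[OF W])
  moreover have "W $$ (i, 0) = v $ i / of_real (r 0)" if "i < n" for i
  proof -
    have "ws ! 0 = v" using hdws ws(3) n by (metis hd_conv_nth list.size(3))
    then show ?thesis using that n by (simp add: W_def)
  qed
  ultimately show ?thesis using that rpos n by blast
qed

lemma unitary_conj_cancel:
  assumes "W \<in> unitary_group n" "A \<in> carrier_mat n n"
  shows "W * (mat_adjoint W * A * W) * mat_adjoint W = A"
proof -
  have [simp]: "W \<in> carrier_mat n n" "A \<in> carrier_mat n n" using assms by auto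
  have "W * (mat_adjoint W * A * W) * mat_adjoint W
      = W * (mat_adjoint W * (A * (W * mat_adjoint W)))"
    by (simp add: assoc_mult_mat[of _ n n _ n _ n])
  also have "\<dots> = A"
    using assms mult_cancel_inverse_mid[of W n "mat_adjoint W" A]
    by (simp add: right_mult_one_mat[OF assms(2)])
  finally show ?thesis .
qed

lemma normal_conj:
  assumes W: "W \<in> unitary_group n" and A: "A \<in> carrier_mat n n"
    and nrm: "mat_adjoint A * A = A * mat_adjoint A"
  defines "B \<equiv> mat_adjoint W * A * W"
  shows "mat_adjoint B * B = B * mat_adjoint B"
proof -
  have [simp]: "W \<in> carrier_mat n n" "A \<in> carrier_mat n n" using assms by auto
  have Badj: "mat_adjoint B = mat_adjoint W * (mat_adjoint A * W)"
    by (simp add: B_def mat_adjoint_mult[of _ n n _ n] assoc_mult_mat[of _ n n _ n _ n])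
  have c: "W * (mat_adjoint W * X) = X" if "X \<in> carrier_mat n n" for X
    using W that by (intro mult_cancel_inverse_mid) auto
  have 1: "mat_adjoint B * B = mat_adjoint W * (mat_adjoint A * A * W)"
    unfolding Badj unfolding B_def by (simp add: assoc_mult_mat[of _ n n _ n _ n] c)
  have 2: "B * mat_adjoint B = mat_adjoint W * (A * mat_adjoint A * W)"
    unfolding Badj unfolding B_def by (simp add: assoc_mult_mat[of _ n n _ n _ n] c)
  show ?thesis unfolding 1 2 nrm ..
qed

text \<open>Deflation: in an orthonormal basis that begins with an eigenvector, the first column is
  zero below the diagonal. Normality gives the first row and the first column the same norm, so the
  rest of the first row vanishes as well, and the complementary block is again normal.\<close>

theorem normal_mat_diagonalizable:
  assumes "A \<in> carrier_mat n n" "mat_adjoint A * A = A * mat_adjoint A"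
  obtains W d where "W \<in> unitary_group n" "A = W * mat_diag n d * mat_adjoint W"
proof -
  have "\<exists>W d. W \<in> unitary_group n \<and> A = W * mat_diag n d * mat_adjoint W"
    using assms
  proof (induction n arbitrary: A)
    case 0
    then have "A = 1\<^sub>m 0 * mat_diag 0 (\<lambda>_. 0) * mat_adjoint (1\<^sub>m 0)"
      by (intro eq_matI) (auto simp: mat_diag_def)
    then show ?case using unitary_one by blast
  next
    case (Suc n)
    note A = Suc.prems(1)
    obtain as where as: "char_poly A = (\<Prod>a\<leftarrow>as. [:- a, 1:])" "length as = Suc n"
      using char_poly_factorized[OF A] by blast
    then obtain e as' where "as = e # as'" by (cases as) auto
    then have "eigenvalue A e"
      using as by (simp add: eigenvalue_root_char_poly[OF A])
    then obtain v where v: "v \<in> carrier_vec (Suc n)" "v \<noteq> 0\<^sub>v (Suc n)" "A *\<^sub>v v = e \<cdot>\<^sub>v v"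
      using A unfolding eigenvalue_def eigenvector_def by auto
    obtain W r where W: "W \<in> unitary_group (Suc n)" "0 < (r :: real)"
      and Wr: "\<And>i. i < Suc n \<Longrightarrow> W $$ (i, 0) = v $ i / of_real r"
      using unitary_completion[OF v(1,2)] by blast
    have Wc [simp]: "W \<in> carrier_mat (Suc n) (Suc n)" using W by auto
    define B where "B = mat_adjoint W * A * W"
    have B [simp]: "B \<in> carrier_mat (Suc n) (Suc n)" using A by (simp add: B_def)
    have AW0: "(A * W) $$ (i, 0) = e * W $$ (i, 0)" if i: "i < Suc n" for i
    proof -
      have "(A * W) $$ (i, 0) = (\<Sum>l<Suc n. A $$ (i, l) * W $$ (l, 0))"
        by (intro mult_mat_index[OF A Wc]) (use i in auto)
      also have "\<dots> = (A *\<^sub>v v) $ i / of_real r"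
      proof -
        have "(A *\<^sub>v v) $ i = (\<Sum>l<Suc n. A $$ (i, l) * v $ l)"
          using A v(1) i by (auto simp: scalar_prod_def lessThan_atLeast0 simp del: sum.op_ivl_Suc)
        then show ?thesis
          by (simp add: Wr sum_divide_distrib del: sum.lessThan_Suc)
      qed
      also have "\<dots> = e * W $$ (i, 0)"
        using v i by (simp add: Wr)
      finally show ?thesis .
    qed
    have B0: "B $$ (i, 0) = (if i = 0 then e else 0)" if i: "i < Suc n" for i
    proof -
      have "B $$ (i, 0) = (mat_adjoint W * (A * W)) $$ (i, 0)"
        using A by (simp add: B_def assoc_mult_mat[of _ "Suc n" "Suc n" _ "Suc n" _ "Suc n"])
      also have "\<dots> = (\<Sum>l<Suc n. cnj (W $$ (l, i)) * (A * W) $$ (l, 0))"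
        by (intro mat_adjoint_mult_index[OF Wc mult_carrier_mat[OF A Wc]]) (use i in auto)
      also have "\<dots> = e * (\<Sum>l<Suc n. cnj (W $$ (l, i)) * W $$ (l, 0))"
        unfolding sum_distrib_left by (intro sum.cong) (auto simp: AW0)
      also have "(\<Sum>l<Suc n. cnj (W $$ (l, i)) * W $$ (l, 0)) = (mat_adjoint W * W) $$ (i, 0)"
        by (intro mat_adjoint_mult_index[OF Wc Wc, symmetric]) (use i in auto)
      finally show ?thesis using W i by simp
    qed
    have Bn: "mat_adjoint B * B = B * mat_adjoint B"
      unfolding B_def by (rule normal_conj[OF W(1) A Suc.prems(2)])
    have "(mat_adjoint B * B) $$ (0, 0) = (\<Sum>l<Suc n. cnj (B $$ (l, 0)) * B $$ (l, 0))"
      by (rule mat_adjoint_mult_index[OF B B]) auto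
    also have "\<dots> = cnj e * e"
      by (simp add: B0 sum.lessThan_Suc_shift del: sum.lessThan_Suc)
    also have "\<dots> = of_real ((cmod e)\<^sup>2)" by (simp add: complex_norm_square mult.commute del: of_real_power)
    finally have "(mat_adjoint B * B) $$ (0, 0) = of_real ((cmod e)\<^sup>2)" .
    moreover have "(B * mat_adjoint B) $$ (0, 0) = (\<Sum>l<Suc n. B $$ (0, l) * mat_adjoint B $$ (l, 0))"
      by (rule mult_mat_index[OF B mat_adjoint_carrier[OF B]]) auto
    then have "(B * mat_adjoint B) $$ (0, 0) = of_real (\<Sum>l<Suc n. (cmod (B $$ (0, l)))\<^sup>2)"
      using carrier_matD[OF B] by (simp add: complex_norm_square del: of_real_power)
    ultimately have "(cmod e)\<^sup>2 = (\<Sum>l<Suc n. (cmod (B $$ (0, l)))\<^sup>2)"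
      using Bn of_real_eq_iff by metis
    then have "(\<Sum>l<n. (cmod (B $$ (0, Suc l)))\<^sup>2) = 0"
      by (simp add: B0 sum.lessThan_Suc_shift del: sum.lessThan_Suc)
    then have B0r: "B $$ (0, Suc l) = 0" if "l < n" for l
      using that by (subst (asm) sum_nonneg_eq_0_iff) auto
    define Z where "Z = mat n n (\<lambda>(i, j). B $$ (Suc i, Suc j))"
    have Z [simp]: "Z \<in> carrier_mat n n" by (simp add: Z_def)
    have BZ: "B = mat_dsum (mat 1 1 (\<lambda>_. e)) Z"
      by (rule mat_dsum_eqI[of _ 1 n]) (auto simp: Z_def B0 B0r)
    have "mat_adjoint Z * Z = Z * mat_adjoint Z"
    proof -
      have "mat_dsum (mat_adjoint (mat 1 1 (\<lambda>_. e)) * mat 1 1 (\<lambda>_. e)) (mat_adjoint Z * Z) =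
          mat_dsum (mat 1 1 (\<lambda>_. e) * mat_adjoint (mat 1 1 (\<lambda>_. e))) (Z * mat_adjoint Z)" (is "?L = ?R")
        using Bn unfolding BZ
        by (simp add: mat_dsum_adjoint[of _ 1 _ n] mat_dsum_mult[of _ 1 _ _ n])
      then have eq: "?L $$ (1 + i, 1 + j) = ?R $$ (1 + i, 1 + j)" for i j by simp
      have "(mat_adjoint Z * Z) $$ (i, j) = (Z * mat_adjoint Z) $$ (i, j)" if "i < n" "j < n" for i j
        using eq[of i j] that
        by (subst (asm) (1 2) mat_dsum_index[of _ 1 _ n]) (auto)
      then show ?thesis
        using carrier_matD[OF Z] by (intro eq_matI) (auto simp del: index_mult_mat(1))
    qed
    from Suc.IH[OF Z this] obtain W' d where W': "W' \<in> unitary_group n"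
      and Zd: "Z = W' * mat_diag n d * mat_adjoint W'" by blast
    have W'c [simp]: "W' \<in> carrier_mat n n" using W' by auto
    define V where "V = W * mat_dsum (1\<^sub>m 1) W'"
    have DW': "mat_dsum (1\<^sub>m 1) W' \<in> unitary_group (Suc n)"
      using mat_dsum_unitary[of "1\<^sub>m 1" 1 W' n] W' by simp
    then have V: "V \<in> unitary_group (Suc n)" using W by (simp add: V_def)
    define E where "E = mat_dsum (1\<^sub>m 1) W'"
    have [simp]: "E \<in> carrier_mat (Suc n) (Suc n)" using DW' unfolding E_def by simp
    have dd: "mat_dsum (mat 1 1 (\<lambda>_. e)) (mat_diag n d) = mat_diag (Suc n) (case_nat e d)"
      by (rule mat_dsum_eqI[of _ 1 n, symmetric]) (auto simp: mat_diag_def)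
    have "B = mat_dsum (1\<^sub>m 1 * mat 1 1 (\<lambda>_. e) * mat_adjoint (1\<^sub>m 1)) (W' * mat_diag n d * mat_adjoint W')"
      unfolding BZ Zd by simp
    also have "\<dots> = mat_dsum (1\<^sub>m 1) W' * mat_diag (Suc n) (case_nat e d) * mat_adjoint (mat_dsum (1\<^sub>m 1) W')"
      by (simp add: dd[symmetric] mat_dsum_adjoint[of _ 1 _ n] mat_dsum_mult[of _ 1 _ _ n])
    finally have Bd: "B = \<dots>" .
    have "A = W * B * mat_adjoint W"
      unfolding B_def using unitary_conj_cancel[OF W(1) A] by simp
    also have "\<dots> = V * mat_diag (Suc n) (case_nat e d) * mat_adjoint V"
      unfolding Bd V_def E_def[symmetric]
    by (simp add: assoc_mult_mat[of _ "Suc n" "Suc n" _ "Suc n" _ "Suc n"]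
          mat_adjoint_mult[of _ "Suc n" "Suc n" _ "Suc n"])
    finally show ?case using V by blast
  qed
  then show ?thesis using that by blast
qed

lemma unitary_diagonalizable:
  assumes V: "V \<in> unitary_group m"
  obtains W d where "W \<in> unitary_group m" "V = W * mat_diag m d * mat_adjoint W"
    "\<And>i. i < m \<Longrightarrow> cmod (d i) = 1"
proof -
  have [simp]: "V \<in> carrier_mat m m" using V by simp
  obtain W d where W: "W \<in> unitary_group m" and Vd: "V = W * mat_diag m d * mat_adjoint W"
    using normal_mat_diagonalizable[of V m] V by auto
  have [simp]: "W \<in> carrier_mat m m" using W by simp
  have "mat_adjoint W * V * W = mat_diag m d"
    using unitary_conj_cancel[of "mat_adjoint W" m "mat_diag m d"] W unfolding Vd by simp
  then have D: "mat_diag m d \<in> unitary_group m"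
    using V W by (metis unitary_adjoint unitary_mult)
  have "cmod (d i) = 1" if "i < m" for i
  proof -
    have "(mat_adjoint (mat_diag m d) * mat_diag m d) $$ (i, i) = 1" using D that by simp
    then have "cnj (d i) * d i = 1" using that by (simp add: mat_diag_adjoint) (simp add: mat_diag_def)
    then have "complex_of_real ((cmod (d i))\<^sup>2) = of_real 1"
      by (simp only: complex_norm_square mult.commute of_real_1)
    then have "(cmod (d i))\<^sup>2 = 1" by (simp only: of_real_eq_iff)
    then show ?thesis by (simp add: power2_eq_1_iff) (smt (verit) norm_ge_zero)
  qed
  with that W Vd show ?thesis by blast
qed

text \<open>Orthogonal columns are, up to their norms, the columns of a unitary; only a zero column
  has no direction to normalise. The induction supplies such a direction when it meets one, which
  replaces a separate completion of a partial orthonormal system.\<close>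

lemma orthogonal_columns_polar:
  fixes X :: "complex mat"
  assumes "X \<in> carrier_mat n n"
    and "\<And>i j. i < n \<Longrightarrow> j < n \<Longrightarrow> i \<noteq> j \<Longrightarrow> (mat_adjoint X * X) $$ (i, j) = 0"
  shows "\<exists>W c. W \<in> unitary_group n \<and> (\<forall>i. 0 \<le> c i) \<and>
    X = W * mat_diag n (\<lambda>i. complex_of_real (c i))"
  using assms
proof (induction n arbitrary: X)
  case 0
  then have "X = 1\<^sub>m 0 * mat_diag 0 (\<lambda>_. of_real 0)"
    by (intro eq_matI) (auto simp: mat_diag_def)
  then show ?case using unitary_one by fastforce
next
  case (Suc n)
  note X [simp] = Suc.prems(1)
  have orth: "(\<Sum>l<Suc n. cnj (X $$ (l, i)) * X $$ (l, j)) = 0"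
    if "i < Suc n" "j < Suc n" "i \<noteq> j" for i j
    using Suc.prems(2)[OF that] that
    by (subst (asm) mat_adjoint_mult_index[OF X X]) auto
  have "\<exists>v c0. v \<in> carrier_vec (Suc n) \<and> v \<noteq> 0\<^sub>v (Suc n) \<and> 0 \<le> (c0 :: real) \<and>
      (\<forall>j<n. (\<Sum>l<Suc n. cnj (v $ l) * X $$ (l, Suc j)) = 0) \<and>
      (\<forall>l<Suc n. X $$ (l, 0) = of_real c0 * v $ l)"
  proof (cases "\<forall>l<Suc n. X $$ (l, 0) = 0")
    case True
    \<comment> \<open>A zero column makes \<open>X\<close> singular, so some nonzero vector is
      orthogonal to all columns. It serves as \<open>v\<close>, with the coefficient
      \<open>c0 = 0\<close>.\<close>
    have "X *\<^sub>v unit_vec (Suc n) 0 = 0\<^sub>v (Suc n)"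
    proof (rule eq_vecI)
      fix i assume "i < dim_vec (0\<^sub>v (Suc n) :: complex vec)"
      then have i: "i < Suc n" by simp
      have "(X *\<^sub>v unit_vec (Suc n) 0) $ i = row X i \<bullet> unit_vec (Suc n) 0"
        using i carrier_matD[OF X] by simp
      also have "\<dots> = row X i $ 0"
        using carrier_matD[OF X] by (intro scalar_prod_right_unit) auto
      also have "\<dots> = 0" using i True carrier_matD[OF X] by simp
      finally show "(X *\<^sub>v unit_vec (Suc n) 0) $ i = 0\<^sub>v (Suc n) $ i" using i by simp
    qed (use carrier_matD[OF X] in auto)
    moreover have "(unit_vec (Suc n) 0 :: complex vec) \<noteq> 0\<^sub>v (Suc n)"
      by (metis index_unit_vec(1) index_zero_vec(1) zero_less_Suc zero_neq_one)
    ultimately have "det X = 0"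
      using det_0_iff_vec_prod_zero[OF X] unit_vec_carrier by blast
    then have "det (transpose_mat X) = 0" by (simp add: det_transpose[OF X])
    then obtain w where w: "w \<in> carrier_vec (Suc n)" "w \<noteq> 0\<^sub>v (Suc n)"
      "transpose_mat X *\<^sub>v w = 0\<^sub>v (Suc n)"
      using det_0_iff_vec_prod_zero[of "transpose_mat X" "Suc n"] X by auto
    have "(\<Sum>l<Suc n. cnj (conjugate w $ l) * X $$ (l, j)) = 0" if "j < Suc n" for j
    proof -
      have "(\<Sum>l<Suc n. cnj (conjugate w $ l) * X $$ (l, j)) = (transpose_mat X *\<^sub>v w) $ j"
        using that w(1) carrier_matD[OF X]
        by (simp add: scalar_prod_def lessThan_atLeast0 mult.commute
            del: sum.op_ivl_Suc)
      then show ?thesis using w that by simp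
    qed
    moreover have "conjugate w \<in> carrier_vec (Suc n)" "conjugate w \<noteq> 0\<^sub>v (Suc n)"
      using w by auto
    ultimately show ?thesis
      using True by (intro exI[of _ "conjugate w"] exI[of _ "0 :: real"]) auto
  next
    case False
    then have "col X 0 \<noteq> 0\<^sub>v (Suc n)"
      using carrier_matD[OF X] by (metis index_col index_zero_vec(1) zero_less_Suc)
    moreover have "col X 0 \<in> carrier_vec (Suc n)"
      using carrier_matD[OF X] by (intro carrier_vecI) simp
    ultimately show ?thesis
      using orth[of 0 "Suc _"] carrier_matD[OF X]
      by (intro exI[of _ "col X 0"] exI[of _ "1 :: real"]) (auto simp del: sum.lessThan_Suc)
  qed
  then obtain v c0 where v: "v \<in> carrier_vec (Suc n)" "v \<noteq> 0\<^sub>v (Suc n)" "0 \<le> (c0 :: real)"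
    and vX: "\<And>j. j < n \<Longrightarrow> (\<Sum>l<Suc n. cnj (v $ l) * X $$ (l, Suc j)) = 0"
    and X0: "\<And>l. l < Suc n \<Longrightarrow> X $$ (l, 0) = of_real c0 * v $ l" by blast
  obtain W r where W: "W \<in> unitary_group (Suc n)" "0 < (r :: real)"
    and Wr: "\<And>i. i < Suc n \<Longrightarrow> W $$ (i, 0) = v $ i / of_real r"
    using unitary_completion[OF v(1,2)] by blast
  have Wc [simp]: "W \<in> carrier_mat (Suc n) (Suc n)" using W by simp
  define Y where "Y = mat_adjoint W * X"
  have Y [simp]: "Y \<in> carrier_mat (Suc n) (Suc n)" by (simp add: Y_def)
  have WY: "X = W * Y"
    unfolding Y_def using W by (subst mult_cancel_inverse_mid) auto
  have Yi: "Y $$ (i, j) = (\<Sum>l<Suc n. cnj (W $$ (l, i)) * X $$ (l, j))"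
    if "i < Suc n" "j < Suc n" for i j
    unfolding Y_def using that by (intro mat_adjoint_mult_index[OF Wc X])
  have Y0: "Y $$ (0, Suc j) = 0" if "j < n" for j
  proof -
    have "Y $$ (0, Suc j) = (\<Sum>l<Suc n. cnj (v $ l) * X $$ (l, Suc j)) / of_real r"
      using that by (simp add: Yi Wr sum_divide_distrib del: sum.lessThan_Suc)
    then show ?thesis using vX[OF that] by simp
  qed
  have Yc: "Y $$ (i, 0) = (if i = 0 then of_real (c0 * r) else 0)" if i: "i < Suc n" for i
  proof -
    have "Y $$ (i, 0) = (\<Sum>l<Suc n. cnj (W $$ (l, i)) * W $$ (l, 0)) * of_real (c0 * r)"
      using i W(2) unfolding Yi[OF i zero_less_Suc] sum_distrib_right
      by (intro sum.cong) (auto simp: X0 Wr)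
    also have "(\<Sum>l<Suc n. cnj (W $$ (l, i)) * W $$ (l, 0)) = (mat_adjoint W * W) $$ (i, 0)"
      by (intro mat_adjoint_mult_index[OF Wc Wc, symmetric]) (use i in auto)
    finally show ?thesis using W i by simp
  qed
  define Z where "Z = mat n n (\<lambda>(i, j). Y $$ (Suc i, Suc j))"
  have Z [simp]: "Z \<in> carrier_mat n n" by (simp add: Z_def)
  have YZ: "Y = mat_dsum (mat 1 1 (\<lambda>_. of_real (c0 * r))) Z"
    by (rule mat_dsum_eqI[of _ 1 n]) (auto simp: Z_def Y0 Yc)
  have YY: "mat_adjoint Y * Y = mat_adjoint X * X"
    using W by (simp add: Y_def mat_adjoint_mult[of _ "Suc n" "Suc n" _ "Suc n"]
        assoc_mult_mat[of _ "Suc n" "Suc n" _ "Suc n" _ "Suc n"]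
        mult_cancel_inverse_mid[of W "Suc n"])
  have "(mat_adjoint Z * Z) $$ (i, j) = 0" if "i < n" "j < n" "i \<noteq> j" for i j
  proof -
    have "(mat_adjoint Y * Y) $$ (1 + i, 1 + j) = (mat_adjoint Z * Z) $$ (i, j)"
      unfolding YZ using that
      by (simp add: mat_dsum_adjoint[of _ 1 _ n] mat_dsum_mult[of _ 1 _ _ n] mat_dsum_index[of _ 1 _ n])
    then show ?thesis unfolding YY using Suc.prems(2)[of "1 + i" "1 + j"] that by simp
  qed
  from Suc.IH[OF Z this] obtain W' c where W': "W' \<in> unitary_group n" "\<forall>i. 0 \<le> (c i :: real)"
    "Z = W' * mat_diag n (\<lambda>i. complex_of_real (c i))" by blast
  have [simp]: "W' \<in> carrier_mat n n" using W' by simp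
  have DW': "mat_dsum (1\<^sub>m 1) W' \<in> unitary_group (Suc n)"
    using mat_dsum_unitary[of "1\<^sub>m 1" 1 W' n] W' by simp
  define E where "E = mat_dsum (1\<^sub>m 1) W'"
  have [simp]: "E \<in> carrier_mat (Suc n) (Suc n)" using DW' unfolding E_def by simp
  have dd: "mat_dsum (mat 1 1 (\<lambda>_. of_real (c0 * r))) (mat_diag n (\<lambda>i. complex_of_real (c i)))
      = mat_diag (Suc n) (\<lambda>i. complex_of_real (case_nat (c0 * r) c i))"
    by (rule mat_dsum_eqI[of _ 1 n, symmetric]) (auto simp: mat_diag_def)
  have "Y = mat_dsum (1\<^sub>m 1 * mat 1 1 (\<lambda>_. of_real (c0 * r))) (W' * mat_diag n (\<lambda>i. complex_of_real (c i)))"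
    unfolding YZ W'(3) by simp
  also have "\<dots> = mat_dsum (1\<^sub>m 1) W' * mat_diag (Suc n) (\<lambda>i. complex_of_real (case_nat (c0 * r) c i))"
    by (simp add: dd[symmetric] mat_dsum_mult[of _ 1 _ _ n])
  finally have "X = (W * mat_dsum (1\<^sub>m 1) W') * mat_diag (Suc n) (\<lambda>i. complex_of_real (case_nat (c0 * r) c i))"
    unfolding WY E_def[symmetric]
    by (simp add: assoc_mult_mat[of _ "Suc n" "Suc n" _ "Suc n" _ "Suc n"])
  moreover have "\<forall>i. 0 \<le> case_nat (c0 * r) c i"
    using W'(2) v(3) W(2) by (auto split: nat.split)
  ultimately show ?case
    using unitary_mult[OF W(1) DW'] by blast
qed

section \<open>The cosine-sine decomposition\<close>

definition mat_rotation :: "nat \<Rightarrow> (nat \<Rightarrow> real) \<Rightarrow> (nat \<Rightarrow> real) \<Rightarrow> complex mat" where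
  "mat_rotation m c s = four_block_mat
     (mat_diag m (\<lambda>i. complex_of_real (c i))) (mat_diag m (\<lambda>i. - complex_of_real (s i)))
     (mat_diag m (\<lambda>i. complex_of_real (s i))) (mat_diag m (\<lambda>i. complex_of_real (c i)))"

lemma mat_rotation_carrier [simp]: "mat_rotation m c s \<in> carrier_mat (m + m) (m + m)"
  unfolding mat_rotation_def by simp

lemma adjoint_four_block_mat:
  fixes A :: "complex mat"
  assumes "A \<in> carrier_mat p p" "B \<in> carrier_mat p r" "C \<in> carrier_mat r p" "D \<in> carrier_mat r r"
  shows "mat_adjoint (four_block_mat A B C D) =
    four_block_mat (mat_adjoint A) (mat_adjoint C) (mat_adjoint B) (mat_adjoint D)"
  by (rule eq_matI) (use assms in auto)

lemma mat_rotation_adjoint: "mat_adjoint (mat_rotation m c s) = mat_rotation m c (\<lambda>i. - s i)"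
  unfolding mat_rotation_def by (subst adjoint_four_block_mat[of _ m _ m]) (auto simp: mat_diag_adjoint)

lemma mat_diag_add:
  "mat_diag n f + mat_diag n g = mat_diag n (\<lambda>i. f i + g i :: complex)"
  by (rule eq_matI) (auto simp: mat_diag_def)

lemma mat_diag_cong: "(\<And>i. i < n \<Longrightarrow> f i = g i) \<Longrightarrow> mat_diag n f = mat_diag n g"
  by (rule eq_matI) (auto simp: mat_diag_def)

lemma mat_diag_zero: "mat_diag n (\<lambda>_. 0) = 0\<^sub>m n n"
  by (rule eq_matI) (auto simp: mat_diag_def)

lemma mat_rotation_unitary:
  assumes "\<And>i. i < m \<Longrightarrow> (c i)\<^sup>2 + (s i)\<^sup>2 = 1"
  shows "mat_rotation m c s \<in> unitary_group (m + m)"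
proof (rule unitary_groupI)
  have "(of_real (c i))\<^sup>2 + (of_real (s i))\<^sup>2 = (1 :: complex)" if "i < m" for i
    using assms[OF that] by (metis of_real_1 of_real_add of_real_power)
  then have "mat_diag m (\<lambda>i. (of_real (c i))\<^sup>2 + (of_real (s i))\<^sup>2 :: complex) = 1\<^sub>m m"
    "mat_diag m (\<lambda>i. (of_real (s i))\<^sup>2 + (of_real (c i))\<^sup>2 :: complex) = 1\<^sub>m m"
    by (auto simp: mat_diag_def add.commute intro!: eq_matI)
  then show "mat_adjoint (mat_rotation m c s) * mat_rotation m c s = 1\<^sub>m (m + m)"
    unfolding mat_rotation_adjoint unfolding mat_rotation_def
    by (subst mult_four_block_mat[of _ m m _ m _ m _ _ m _ m])
      (auto simp: mat_diag_add power2_eq_square mult.commute mat_diag_zero)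
qed simp

text \<open>The first block column of \<open>U\<close> consists of \<open>A\<close> over
  \<open>C\<close>, and the Gram matrices of \<open>A\<close> and \<open>C\<close> add up to 1. An
  eigenbasis \<open>Q\<close> of one is therefore an eigenbasis of the other, both
  \<open>A * Q\<close> and \<open>C * Q\<close> have orthogonal columns, and their polar forms
  supply cosines and sines. This fixes \<open>W1\<close>, \<open>W2\<close> and the rotation from
  the first block column alone; the unitary that remains acts on the second block only and becomes
  \<open>V\<close>, while \<open>R\<close> is the adjoint of \<open>Q\<close>.\<close>

theorem cosine_sine_decomposition:
  assumes U: "U \<in> unitary_group (m + m)"
  obtains W1 W2 R V c s where
    "W1 \<in> unitary_group m" "W2 \<in> unitary_group m" "R \<in> unitary_group m" "V \<in> unitary_group m"
    "\<And>i. i < m \<Longrightarrow> (c i)\<^sup>2 + (s i)\<^sup>2 = (1 :: real)"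
    "U = mat_dsum W1 W2 * (mat_rotation m c s * mat_dsum R V)"
proof -
  have Uc [simp]: "U \<in> carrier_mat (m + m) (m + m)" using U by simp
  define A where "A = mat m m (\<lambda>(i, j). U $$ (i, j))"
  define C where "C = mat m m (\<lambda>(i, j). U $$ (m + i, j))"
  have [simp]: "A \<in> carrier_mat m m" "C \<in> carrier_mat m m" by (auto simp: A_def C_def)
  have split: "(\<Sum>l<m + m. f l) = (\<Sum>l<m. f l) + (\<Sum>l<m. f (m + l))" for f :: "nat \<Rightarrow> complex"
    using sum.atLeastLessThan_concat[of 0 m "m + m" f] sum.shift_bounds_nat_ivl[of f 0 m m]
    by (simp add: lessThan_atLeast0 add.commute)
  have AC: "mat_adjoint A * A + mat_adjoint C * C = 1\<^sub>m m"
  proof (rule eq_matI)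
    fix i j assume "i < dim_row (1\<^sub>m m :: complex mat)" "j < dim_col (1\<^sub>m m :: complex mat)"
    then have ij: "i < m" "j < m" by auto
    have "(mat_adjoint U * U) $$ (i, j) = (\<Sum>l<m + m. cnj (U $$ (l, i)) * U $$ (l, j))"
      using ij by (intro mat_adjoint_mult_index[OF Uc Uc]) auto
    also have "\<dots> = (mat_adjoint A * A) $$ (i, j) + (mat_adjoint C * C) $$ (i, j)"
      using ij by (subst (1 2) mat_adjoint_mult_index[of _ m m _ m]) (auto simp: split A_def C_def)
    finally show "(mat_adjoint A * A + mat_adjoint C * C) $$ (i, j) = 1\<^sub>m m $$ (i, j)"
      using ij U by (simp add: A_def C_def del: index_mult_mat(1))
  qed (auto simp: C_def)
  define H where "H = mat_adjoint A * A"
  have [simp]: "H \<in> carrier_mat m m" by (simp add: H_def)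
  have "mat_adjoint H = H" by (simp add: H_def mat_adjoint_mult[of _ m m _ m])
  then obtain Q d where Q: "Q \<in> unitary_group m" and H: "H = Q * mat_diag m d * mat_adjoint Q"
    using normal_mat_diagonalizable[of H m] by auto
  have [simp]: "Q \<in> carrier_mat m m" using Q by simp
  have QHQ: "mat_adjoint Q * H * Q = mat_diag m d"
    using Q unfolding H
    by (simp add: assoc_mult_mat[of _ m m _ m _ m] mult_cancel_inverse_mid[of "mat_adjoint Q" m]
        right_mult_one_mat[of _ m m])
  have A2: "mat_adjoint (A * Q) * (A * Q) = mat_diag m d"
    unfolding QHQ[symmetric] H_def
    by (simp add: mat_adjoint_mult[of _ m m _ m] assoc_mult_mat[of _ m m _ m _ m])
  have "mat_adjoint (A * Q) * (A * Q) + mat_adjoint (C * Q) * (C * Q)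
      = mat_adjoint Q * (mat_adjoint A * A + mat_adjoint C * C) * Q"
    by (simp add: mat_adjoint_mult[of _ m m _ m] assoc_mult_mat[of _ m m _ m _ m]
        add_mult_distrib_mat[of _ m m _ _ m] mult_add_distrib_mat[of _ m m _ m])
  also have "\<dots> = 1\<^sub>m m" using Q by (simp add: AC right_mult_one_mat[of _ m m])
  finally have sum1: "mat_diag m d + mat_adjoint (C * Q) * (C * Q) = 1\<^sub>m m" unfolding A2 .
  have C2: "(mat_adjoint (C * Q) * (C * Q)) $$ (i, j) = (if i = j then 1 - d i else 0)"
    if "i < m" "j < m" for i j
  proof -
    have K: "mat_adjoint (C * Q) * (C * Q) \<in> carrier_mat m m" by simp
    show ?thesis
      using arg_cong[OF sum1, of "\<lambda>M. M $$ (i, j)"] that carrier_matD[OF K]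
      by (auto simp: mat_diag_def algebra_simps simp del: index_mult_mat split: if_splits)
  qed
  obtain W1 c where W1: "W1 \<in> unitary_group m" and c: "A * Q = W1 * mat_diag m (\<lambda>i. complex_of_real (c i))"
    using orthogonal_columns_polar[of "A * Q" m] A2 by (auto simp: mat_diag_def)
  obtain W2 s where W2: "W2 \<in> unitary_group m" and s: "C * Q = W2 * mat_diag m (\<lambda>i. complex_of_real (s i))"
    using orthogonal_columns_polar[of "C * Q" m] C2 by auto
  have [simp]: "W1 \<in> carrier_mat m m" "W2 \<in> carrier_mat m m" using W1 W2 by auto
  have sq: "mat_adjoint (W * mat_diag m (\<lambda>i. complex_of_real (x i))) * (W * mat_diag m (\<lambda>i. complex_of_real (x i)))
      = mat_diag m (\<lambda>i. complex_of_real ((x i)\<^sup>2))" if "W \<in> unitary_group m" for W x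
    using that by (simp add: mat_adjoint_mult[of _ m m _ m] assoc_mult_mat[of _ m m _ m _ m]
        mult_cancel_inverse_mid[of "mat_adjoint W" m] mat_diag_adjoint power2_eq_square)
  have cs: "(c i)\<^sup>2 + (s i)\<^sup>2 = 1" if "i < m" for i
  proof -
    have "d i = of_real ((c i)\<^sup>2)"
      using arg_cong[OF A2[unfolded c sq[OF W1]], of "\<lambda>M. M $$ (i, i)"] that
      by (simp add: mat_diag_def)
    moreover have "1 - d i = of_real ((s i)\<^sup>2)"
      using C2[OF that that, unfolded s sq[OF W2]] that by (simp add: mat_diag_def)
    ultimately have "complex_of_real ((c i)\<^sup>2 + (s i)\<^sup>2) = of_real 1"
      by (simp add: algebra_simps)
    then show ?thesis using of_real_eq_iff by blast
  qed
  define G where "G = mat_dsum W1 W2 * mat_rotation m c s"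
  have G: "G \<in> unitary_group (m + m)"
    using W1 W2 mat_rotation_unitary[of m c s] cs by (simp add: G_def)
  have [simp]: "G \<in> carrier_mat (m + m) (m + m)" using G by simp
  have Q1: "mat_dsum Q (1\<^sub>m m) \<in> unitary_group (m + m)" using Q by simp
  have [simp]: "mat_dsum Q (1\<^sub>m m) \<in> carrier_mat (m + m) (m + m)" using Q1 by simp
  define M where "M = mat_adjoint G * (U * mat_dsum Q (1\<^sub>m m))"
  have M: "M \<in> unitary_group (m + m)" unfolding M_def using G U Q1 by simp
  have [simp]: "M \<in> carrier_mat (m + m) (m + m)" using M by simp
  text \<open>As \<open>G\<close> is unitary, it follows that \<open>M\<close> has the first block column \<open>(1, 0)\<close>, so \<open>M = 1 \<oplus> V\<close>.\<close>
  have col: "(U * mat_dsum Q (1\<^sub>m m)) $$ (i, j) = G $$ (i, j)" if "i < m + m" "j < m" for i j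
  proof -
    have "(U * mat_dsum Q (1\<^sub>m m)) $$ (i, j) = (\<Sum>l<m + m. U $$ (i, l) * mat_dsum Q (1\<^sub>m m) $$ (l, j))"
      using that by (intro mult_mat_index[of _ "m + m" "m + m" _ "m + m"]) auto
    also have "\<dots> = (\<Sum>l<m. U $$ (i, l) * Q $$ (l, j))"
      using that by (simp add: split mat_dsum_index[of _ m _ m])
    also have "\<dots> = (if i < m then (A * Q) $$ (i, j) else (C * Q) $$ (i - m, j))"
      using that by (auto simp: mult_mat_index[of _ m m _ m] A_def C_def)
    also have "\<dots> = (if i < m then W1 $$ (i, j) * c j else W2 $$ (i - m, j) * s j)"
      using that unfolding c s by (auto simp: mat_diag_mult_right[of _ m])
    also have "\<dots> = G $$ (i, j)"
    proof -
      have "G = four_block_mat (W1 * mat_diag m (\<lambda>i. complex_of_real (c i)))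
           (W1 * mat_diag m (\<lambda>i. - complex_of_real (s i)))
           (W2 * mat_diag m (\<lambda>i. complex_of_real (s i))) (W2 * mat_diag m (\<lambda>i. complex_of_real (c i)))"
      proof -
        have "dim_row W1 = m" "dim_col W1 = m" "dim_row W2 = m" "dim_col W2 = m"
          using W1 W2 unitary_carrier carrier_matD by blast+
        then show ?thesis
          unfolding G_def mat_dsum_def mat_rotation_def
          by (subst mult_four_block_mat[of _ m m _ m _ m _ _ m _ m])
            (simp_all add: left_mult_zero_mat[of _ m m] left_add_zero_mat[of _ m m]
              right_add_zero_mat[of _ m m])
      qed
      then show ?thesis using that by (auto simp: mat_diag_mult_right[of _ m])
    qed
    finally show ?thesis .
  qed
  have M0: "M $$ (i, j) = (if i = j then 1 else 0)" if "i < m + m" "j < m" for i j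
  proof -
    have "M $$ (i, j) = (\<Sum>l<m + m. cnj (G $$ (l, i)) * (U * mat_dsum Q (1\<^sub>m m)) $$ (l, j))"
      unfolding M_def using that by (intro mat_adjoint_mult_index[of _ _ "m + m" _ "m + m"]) auto
    also have "\<dots> = (\<Sum>l<m + m. cnj (G $$ (l, i)) * G $$ (l, j))"
      using that by (intro sum.cong) (auto simp: col)
    also have "\<dots> = (mat_adjoint G * G) $$ (i, j)"
      using that by (intro mat_adjoint_mult_index[of _ _ "m + m" _ "m + m", symmetric]) auto
    finally show ?thesis using that G by simp
  qed
  define V where "V = mat m m (\<lambda>(i, j). M $$ (m + i, m + j))"
  have [simp]: "V \<in> carrier_mat m m" by (simp add: V_def)
  have M1: "M $$ (i, m + j) = 0" if "i < m" "j < m" for i j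
  proof -
    have "(mat_adjoint M * M) $$ (i, m + j) = (\<Sum>l<m + m. cnj (M $$ (l, i)) * M $$ (l, m + j))"
      using that by (intro mat_adjoint_mult_index[of _ _ "m + m" _ "m + m"]) auto
    also have "\<dots> = (\<Sum>l<m + m. if l = i then M $$ (i, m + j) else 0)"
      using that by (intro sum.cong) (auto simp: M0)
    finally show ?thesis using that M by simp
  qed
  have MV: "M = mat_dsum (1\<^sub>m m) V"
    by (rule mat_dsum_eqI) (auto simp: M0 M1 V_def)
  have V: "V \<in> unitary_group m"
  proof (rule unitary_groupI)
    have "mat_dsum (1\<^sub>m m) (mat_adjoint V * V) = mat_dsum (1\<^sub>m m) (1\<^sub>m m)"
      using unitary_mult_adjoint(2)[OF M] unfolding MV
      by (simp add: mat_dsum_adjoint[of _ m _ m] mat_dsum_mult[of _ m _ _ m] mat_dsum_one)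
    then have eq: "mat_dsum (1\<^sub>m m) (mat_adjoint V * V) $$ (m + i, m + j) =
        mat_dsum (1\<^sub>m m) (1\<^sub>m m) $$ (m + i, m + j)" for i j by simp
    show "mat_adjoint V * V = 1\<^sub>m m"
    proof (rule eq_matI)
      fix i j assume "i < dim_row (1\<^sub>m m :: complex mat)" "j < dim_col (1\<^sub>m m :: complex mat)"
      then show "(mat_adjoint V * V) $$ (i, j) = 1\<^sub>m m $$ (i, j)"
        using eq[of i j] by (subst (asm) (1 2) mat_dsum_index[of _ m _ m]) auto
    qed (simp_all add: V_def)
  qed simp
  have "mat_dsum (1\<^sub>m m) V * mat_dsum (mat_adjoint Q) (1\<^sub>m m) = mat_dsum (mat_adjoint Q) V"
    by (simp add: mat_dsum_mult[of _ m _ _ m] left_mult_one_mat[of _ m m] right_mult_one_mat[of _ m m])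
  moreover have "U = G * (M * mat_adjoint (mat_dsum Q (1\<^sub>m m)))"
  proof -
    have "M * mat_adjoint (mat_dsum Q (1\<^sub>m m)) = mat_adjoint G * U"
      unfolding M_def using Q1
      by (simp add: assoc_mult_mat[of _ "m + m" "m + m" _ "m + m" _ "m + m"]
          right_mult_one_mat[of _ "m + m" "m + m"])
    then show ?thesis using G by (simp add: mult_cancel_inverse_mid[of G "m + m"])
  qed
  ultimately have "U = mat_dsum W1 W2 * (mat_rotation m c s * mat_dsum (mat_adjoint Q) V)"
    unfolding MV G_def using Q
    by (simp add: mat_dsum_adjoint[of _ m _ m] assoc_mult_mat[of _ "m + m" "m + m" _ "m + m" _ "m + m"])
  then show ?thesis using that W1 W2 Q V cs unitary_adjoint by blast
qed

section \<open>Block matrices\<close>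

text \<open>For a bijection \<open>e\<close> this is conjugation by a permutation matrix. It serves
  to pass between the numbering by qubits and the numbering by blocks.\<close>

definition mat_reindex :: "nat \<Rightarrow> (nat \<Rightarrow> nat) \<Rightarrow> complex mat \<Rightarrow> complex mat" where
  "mat_reindex d e M = mat d d (\<lambda>(i, j). M $$ (e i, e j))"

lemma mat_reindex_carrier [simp]: "mat_reindex d e M \<in> carrier_mat d d"
  by (simp add: mat_reindex_def)

lemma mat_reindex_mult:
  assumes e: "bij_betw e {..<d} {..<d}" and M: "M \<in> carrier_mat d d" "M' \<in> carrier_mat d d"
  shows "mat_reindex d e (M * M') = mat_reindex d e M * mat_reindex d e M'"
proof (rule eq_matI)
  fix i j
  assume "i < dim_row (mat_reindex d e M * mat_reindex d e M')"
    "j < dim_col (mat_reindex d e M * mat_reindex d e M')"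
  then have ij: "i < d" "j < d" by (auto simp: mat_reindex_def)
  have e': "e i < d" if "i < d" for i using bij_betwE[OF e] that by auto
  have "mat_reindex d e (M * M') $$ (i, j) = (M * M') $$ (e i, e j)"
    using ij by (simp add: mat_reindex_def)
  also have "\<dots> = (\<Sum>l<d. M $$ (e i, l) * M' $$ (l, e j))"
    using ij e' M by (intro mult_mat_index) auto
  also have "\<dots> = (\<Sum>l<d. M $$ (e i, e l) * M' $$ (e l, e j))"
    by (rule sum.reindex_bij_betw[OF e, symmetric])
  also have "\<dots> = (mat_reindex d e M * mat_reindex d e M') $$ (i, j)"
    using ij by (subst mult_mat_index[of _ d d _ d]) (auto simp: mat_reindex_def)
  finally show "mat_reindex d e (M * M') $$ (i, j) = (mat_reindex d e M * mat_reindex d e M') $$ (i, j)" .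
qed (auto simp: mat_reindex_def)

lemma mat_reindex_one:
  assumes e: "bij_betw e {..<d} {..<d}"
  shows "mat_reindex d e (1\<^sub>m d) = 1\<^sub>m d"
proof -
  have "e i < d" if "i < d" for i using bij_betwE[OF e] that by auto
  moreover have "e i = e j \<longleftrightarrow> i = j" if "i < d" "j < d" for i j
    using bij_betw_imp_inj_on[OF e] that by (auto simp: inj_on_def)
  ultimately show ?thesis by (intro eq_matI) (auto simp: mat_reindex_def)
qed

lemma mat_reindex_adjoint:
  assumes e: "bij_betw e {..<d} {..<d}" and M: "M \<in> carrier_mat d d"
  shows "mat_reindex d e (mat_adjoint M) = mat_adjoint (mat_reindex d e M)"
proof -
  have "e i < d" if "i < d" for i using bij_betwE[OF e] that by auto
  then show ?thesis using M by (intro eq_matI) (auto simp: mat_reindex_def)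
qed

lemma mat_reindex_unitary:
  assumes e: "bij_betw e {..<d} {..<d}" and M: "M \<in> unitary_group d"
  shows "mat_reindex d e M \<in> unitary_group d"
  using M by (intro unitary_groupI)
    (simp_all add: mat_reindex_adjoint[OF e, symmetric] mat_reindex_mult[OF e, symmetric] mat_reindex_one[OF e])

lemma mat_reindex_surj:
  assumes e: "bij_betw e {..<d} {..<d}" and U: "U \<in> unitary_group d"
  obtains M where "M \<in> unitary_group d" "mat_reindex d e M = U"
proof
  let ?e' = "inv_into {..<d} e"
  have e': "bij_betw ?e' {..<d} {..<d}" by (rule bij_betw_inv_into[OF e])
  show "mat_reindex d ?e' U \<in> unitary_group d" by (rule mat_reindex_unitary[OF e' U])
  have "e i < d" if "i < d" for i using bij_betwE[OF e] that by auto
  moreover have "?e' (e i) = i" if "i < d" for i using bij_betw_inv_into_left[OF e] that by auto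
  ultimately show "mat_reindex d e (mat_reindex d ?e' U) = U"
    using carrier_matD[OF unitary_carrier[OF U]] by (intro eq_matI) (auto simp: mat_reindex_def)
qed

text \<open>The entry at row \<open>x * N + y\<close> and column \<open>x' * N + y'\<close> is \<open>f x x' y y'\<close>.\<close>

definition mat_blocks ::
    "nat \<Rightarrow> nat \<Rightarrow> (nat \<Rightarrow> nat \<Rightarrow> nat \<Rightarrow> nat \<Rightarrow> complex) \<Rightarrow> complex mat" where
  "mat_blocks K N f = mat (K * N) (K * N) (\<lambda>(i, j). f (i div N) (j div N) (i mod N) (j mod N))"

lemma mat_blocks_carrier [simp]: "mat_blocks K N f \<in> carrier_mat (K * N) (K * N)"
  by (simp add: mat_blocks_def)

lemma div_less_mod_less:
  "i < K * N \<Longrightarrow> i div N < K" "i < K * N \<Longrightarrow> i mod N < (N :: nat)"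
  by (auto simp: less_mult_imp_div_less) (metis mod_less_divisor mult_0_right neq0_conv not_less_zero)

lemma mat_blocks_cong:
  "(\<And>x x' y y'. x < K \<Longrightarrow> x' < K \<Longrightarrow> y < N \<Longrightarrow> y' < N \<Longrightarrow> f x x' y y' = g x x' y y') \<Longrightarrow>
    mat_blocks K N f = mat_blocks K N g"
  unfolding mat_blocks_def by (intro cong_mat) (auto simp: div_less_mod_less)

lemma sum_div_mod:
  fixes f :: "nat \<Rightarrow> nat \<Rightarrow> 'a :: comm_monoid_add"
  shows "(\<Sum>l<K * N. f (l div N) (l mod N)) = (\<Sum>x<K. \<Sum>y<N. f x y)"
proof -
  have "(\<Sum>l<K * N. f (l div N) (l mod N)) = (\<Sum>x<K. \<Sum>l = x * N..<x * N + N. f (l div N) (l mod N))"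
    by (rule sum.nat_group[symmetric])
  also have "\<dots> = (\<Sum>x<K. \<Sum>y<N. f x y)"
  proof (rule sum.cong[OF refl])
    fix x
    have "(\<Sum>l = x * N..<x * N + N. f (l div N) (l mod N)) =
        (\<Sum>y = 0..<N. f ((y + x * N) div N) ((y + x * N) mod N))"
      using sum.shift_bounds_nat_ivl[of "\<lambda>l. f (l div N) (l mod N)" 0 "x * N" N]
      by (simp add: add.commute)
    also have "\<dots> = (\<Sum>y<N. f x y)"
      unfolding lessThan_atLeast0 by (intro sum.cong) auto
    finally show "(\<Sum>l = x * N..<x * N + N. f (l div N) (l mod N)) = (\<Sum>y<N. f x y)" .
  qed
  finally show ?thesis .
qed

lemma mat_blocks_mult:
  "mat_blocks K N f * mat_blocks K N g =
    mat_blocks K N (\<lambda>x x' y y'. \<Sum>z<K. \<Sum>w<N. f x z y w * g z x' w y')"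
proof (rule eq_matI)
  fix i j
  assume "i < dim_row (mat_blocks K N (\<lambda>x x' y y'. \<Sum>z<K. \<Sum>w<N. f x z y w * g z x' w y'))"
    "j < dim_col (mat_blocks K N (\<lambda>x x' y y'. \<Sum>z<K. \<Sum>w<N. f x z y w * g z x' w y'))"
  then have "i < K * N" "j < K * N" by (auto simp: mat_blocks_def)
  then show "(mat_blocks K N f * mat_blocks K N g) $$ (i, j) =
      mat_blocks K N (\<lambda>x x' y y'. \<Sum>z<K. \<Sum>w<N. f x z y w * g z x' w y') $$ (i, j)"
    by (subst mult_mat_index[OF mat_blocks_carrier mat_blocks_carrier])
      (auto simp: mat_blocks_def sum_div_mod[symmetric])
qed (auto simp: mat_blocks_def)

section \<open>Kronecker products and controlled operators\<close>

definition mat_kron :: "nat \<Rightarrow> nat \<Rightarrow> complex mat \<Rightarrow> complex mat \<Rightarrow> complex mat" where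
  "mat_kron K N V W = mat_blocks K N (\<lambda>x x' y y'. V $$ (x, x') * W $$ (y, y'))"

text \<open>The uniformly controlled operators: the level of \<open>A\<close> selects an operator on
  \<open>B\<close>. They multiply level by level, so identities between such circuits can be checked
  on one level at a time.\<close>

definition mat_blockdiag :: "nat \<Rightarrow> nat \<Rightarrow> (nat \<Rightarrow> complex mat) \<Rightarrow> complex mat" where
  "mat_blockdiag K N F = mat_blocks K N (\<lambda>x x' y y'. if x = x' then F x $$ (y, y') else 0)"

lemma mat_kron_carrier [simp]: "mat_kron K N V W \<in> carrier_mat (K * N) (K * N)"
  by (simp add: mat_kron_def)

lemma mat_blockdiag_carrier [simp]: "mat_blockdiag K N F \<in> carrier_mat (K * N) (K * N)"
  by (simp add: mat_blockdiag_def)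

lemma mat_kron_mult:
  assumes "V \<in> carrier_mat K K" "V' \<in> carrier_mat K K" "W \<in> carrier_mat N N" "W' \<in> carrier_mat N N"
  shows "mat_kron K N V W * mat_kron K N V' W' = mat_kron K N (V * V') (W * W')"
  unfolding mat_kron_def mat_blocks_mult using assms
  by (intro mat_blocks_cong)
    (simp add: mult_mat_index[of _ K K _ K] mult_mat_index[of _ N N _ N] sum_product ac_simps
      del: index_mult_mat)

lemma mat_blockdiag_mult:
  assumes "\<And>x. x < K \<Longrightarrow> F x \<in> carrier_mat N N" "\<And>x. x < K \<Longrightarrow> G x \<in> carrier_mat N N"
  shows "mat_blockdiag K N F * mat_blockdiag K N G = mat_blockdiag K N (\<lambda>x. F x * G x)"
  unfolding mat_blockdiag_def mat_blocks_mult
proof (intro mat_blocks_cong)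
  fix x x' y y' assume *: "x < K" "x' < K" "y < N" "y' < N"
  have "(\<Sum>z<K. \<Sum>w<N. (if x = z then F x $$ (y, w) else 0) * (if z = x' then G z $$ (w, y') else 0))
    = (\<Sum>z<K. if z = x then (if x = x' then \<Sum>w<N. F x $$ (y, w) * G x $$ (w, y') else 0) else 0)"
    by (intro sum.cong) auto
  also have "\<dots> = (if x = x' then (F x * G x) $$ (y, y') else 0)"
    unfolding mult_mat_index[OF assms(1)[OF *(1)] assms(2)[OF *(1)] *(3,4)] using * by simp
  finally show "(\<Sum>z<K. \<Sum>w<N. (if x = z then F x $$ (y, w) else 0) * (if z = x' then G z $$ (w, y') else 0))
    = (if x = x' then (F x * G x) $$ (y, y') else 0)" .
qed

lemma mat_blockdiag_cong:
  "(\<And>x. x < K \<Longrightarrow> F x = G x) \<Longrightarrow> mat_blockdiag K N F = mat_blockdiag K N G"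
  unfolding mat_blockdiag_def by (intro mat_blocks_cong) auto

lemma mat_blockdiag_one: "mat_blockdiag K N (\<lambda>_. 1\<^sub>m N) = 1\<^sub>m (K * N)"
proof (rule eq_matI)
  fix i j assume "i < dim_row (1\<^sub>m (K * N) :: complex mat)" "j < dim_col (1\<^sub>m (K * N) :: complex mat)"
  moreover have "i = j \<longleftrightarrow> i div N = j div N \<and> i mod N = j mod N"
    by (metis div_mult_mod_eq)
  ultimately show "mat_blockdiag K N (\<lambda>_. 1\<^sub>m N) $$ (i, j) = 1\<^sub>m (K * N) $$ (i, j)"
    by (auto simp: mat_blockdiag_def mat_blocks_def div_less_mod_less)
qed (auto simp: mat_blockdiag_def mat_blocks_def)

lemma mat_kron_one_left: "mat_kron K N (1\<^sub>m K) W = mat_blockdiag K N (\<lambda>_. W)"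
  unfolding mat_kron_def mat_blockdiag_def by (intro mat_blocks_cong) auto

lemma mat_kron_diag_one:
  "mat_kron K N (mat_diag K f) (1\<^sub>m N) = mat_blockdiag K N (\<lambda>x. mat_diag N (\<lambda>_. f x))"
  unfolding mat_kron_def mat_blockdiag_def by (intro mat_blocks_cong) (auto simp: mat_diag_def)

lemma mat_kron_one_one: "mat_kron K N (1\<^sub>m K) (1\<^sub>m N) = 1\<^sub>m (K * N)"
  by (simp add: mat_kron_one_left mat_blockdiag_one)

definition mat_perm :: "nat \<Rightarrow> (nat \<Rightarrow> nat) \<Rightarrow> complex mat" where
  "mat_perm d \<pi> = mat d d (\<lambda>(i, j). if i = \<pi> j then 1 else 0)"

lemma mat_perm_carrier [simp]: "mat_perm d \<pi> \<in> carrier_mat d d"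
  by (simp add: mat_perm_def)

lemma mat_perm_unitary:
  assumes "bij_betw \<pi> {..<d} {..<d}"
  shows "mat_perm d \<pi> \<in> unitary_group d"
proof (rule unitary_groupI)
  have lt: "\<pi> i < d" if "i < d" for i using bij_betwE[OF assms] that by auto
  have inj: "\<pi> i = \<pi> j \<longleftrightarrow> i = j" if "i < d" "j < d" for i j
    using bij_betw_imp_inj_on[OF assms] that by (auto simp: inj_on_def)
  show "mat_adjoint (mat_perm d \<pi>) * mat_perm d \<pi> = 1\<^sub>m d"
  proof (rule eq_matI)
    fix i j assume "i < dim_row (1\<^sub>m d :: complex mat)" "j < dim_col (1\<^sub>m d :: complex mat)"
    then have ij: "i < d" "j < d" by auto
    have "(mat_adjoint (mat_perm d \<pi>) * mat_perm d \<pi>) $$ (i, j)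
        = (\<Sum>l<d. cnj (mat_perm d \<pi> $$ (l, i)) * mat_perm d \<pi> $$ (l, j))"
      using ij by (intro mat_adjoint_mult_index) auto
    also have "\<dots> = (\<Sum>l<d. if l = \<pi> i then (if i = j then 1 else 0) else 0)"
      using ij by (intro sum.cong) (auto simp: mat_perm_def inj)
    finally show "(mat_adjoint (mat_perm d \<pi>) * mat_perm d \<pi>) $$ (i, j) = 1\<^sub>m d $$ (i, j)"
      using ij lt by simp
  qed (auto simp: mat_perm_def)
qed simp

lemma mat_kron_one_mult_blockdiag:
  assumes "V \<in> carrier_mat K K" "\<And>x. x < K \<Longrightarrow> F x \<in> carrier_mat N N"
  shows "mat_kron K N V (1\<^sub>m N) * mat_blockdiag K N F =
    mat_blocks K N (\<lambda>x x' y y'. V $$ (x, x') * F x' $$ (y, y'))"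
  unfolding mat_kron_def mat_blockdiag_def mat_blocks_mult
proof (intro mat_blocks_cong)
  fix x x' y y' assume *: "x < K" "x' < K" "y < N" "y' < N"
  have "(\<Sum>z<K. \<Sum>w<N. V $$ (x, z) * 1\<^sub>m N $$ (y, w) * (if z = x' then F z $$ (w, y') else 0))
    = (\<Sum>z<K. if z = x' then (\<Sum>w<N. if w = y then V $$ (x, x') * F x' $$ (y, y') else 0) else 0)"
    using * by (intro sum.cong refl) (auto simp: if_distrib[of "\<lambda>u. _ * u"] if_distrib[of "\<lambda>u. u * _"]
        simp del: sum.delta sum.delta' intro!: sum.cong sum.neutral)
  then show "(\<Sum>z<K. \<Sum>w<N. V $$ (x, z) * 1\<^sub>m N $$ (y, w) * (if z = x' then F z $$ (w, y') else 0))
    = V $$ (x, x') * F x' $$ (y, y')" using * by simp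
qed

lemma mat_blockdiag_mult_kron_one:
  assumes "V \<in> carrier_mat K K" "\<And>x. x < K \<Longrightarrow> F x \<in> carrier_mat N N"
  shows "mat_blockdiag K N F * mat_kron K N V (1\<^sub>m N) =
    mat_blocks K N (\<lambda>x x' y y'. V $$ (x, x') * F x $$ (y, y'))"
  unfolding mat_kron_def mat_blockdiag_def mat_blocks_mult
proof (intro mat_blocks_cong)
  fix x x' y y' assume *: "x < K" "x' < K" "y < N" "y' < N"
  have "(\<Sum>z<K. \<Sum>w<N. (if x = z then F x $$ (y, w) else 0) * (V $$ (z, x') * 1\<^sub>m N $$ (w, y')))
    = (\<Sum>z<K. if z = x then (\<Sum>w<N. if w = y' then V $$ (x, x') * F x $$ (y, y') else 0) else 0)"
    using * by (intro sum.cong refl) (auto simp: if_distrib[of "\<lambda>u. _ * u"] if_distrib[of "\<lambda>u. u * _"]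
        simp del: sum.delta sum.delta' intro!: sum.cong sum.neutral)
  then show "(\<Sum>z<K. \<Sum>w<N. (if x = z then F x $$ (y, w) else 0) * (V $$ (z, x') * 1\<^sub>m N $$ (w, y')))
    = V $$ (x, x') * F x $$ (y, y')" using * by simp
qed

text \<open>A permutation of the levels is a unitary of \<open>A\<close>, hence free: the set of
  levels on which an operator is controlled matters only up to permutation.\<close>

lemma mat_blockdiag_conj_perm:
  assumes \<pi>: "bij_betw \<pi> {..<K} {..<K}" and F: "\<And>x. x < K \<Longrightarrow> F x \<in> carrier_mat N N"
  shows "mat_kron K N (mat_perm K \<pi>) (1\<^sub>m N) * mat_blockdiag K N (\<lambda>x. F (\<pi> x)) *
      mat_kron K N (mat_adjoint (mat_perm K \<pi>)) (1\<^sub>m N) = mat_blockdiag K N F"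
proof -
  have P: "mat_perm K \<pi> \<in> unitary_group K" by (rule mat_perm_unitary[OF \<pi>])
  have lt: "\<pi> i < K" if "i < K" for i using bij_betwE[OF \<pi>] that by auto
  have "mat_kron K N (mat_perm K \<pi>) (1\<^sub>m N) * mat_blockdiag K N (\<lambda>x. F (\<pi> x)) =
      mat_blockdiag K N F * mat_kron K N (mat_perm K \<pi>) (1\<^sub>m N)"
    using F lt by (subst mat_kron_one_mult_blockdiag, simp, simp,
      subst mat_blockdiag_mult_kron_one) (auto intro!: mat_blocks_cong simp: mat_perm_def)
  then show ?thesis
    using P by (simp add: assoc_mult_mat[of _ "K * N" "K * N" _ "K * N" _ "K * N"]
      mat_kron_mult mat_kron_one_one right_mult_one_mat[of _ "K * N" "K * N"])
qed

lemma arg_cong4: "a = a' \<Longrightarrow> b = b' \<Longrightarrow> c = c' \<Longrightarrow> d = d' \<Longrightarrow> f a b c d = f a' b' c' d'"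
  by simp

section \<open>Operators supported on an interval of indices\<close>

definition mat_embed :: "nat \<Rightarrow> nat \<Rightarrow> nat \<Rightarrow> complex mat \<Rightarrow> complex mat" where
  "mat_embed d a m V = mat d d (\<lambda>(i, j).
     if a \<le> i \<and> i < a + m \<and> a \<le> j \<and> j < a + m then V $$ (i - a, j - a)
     else if i = j then 1 else 0)"

lemma mat_embed_carrier [simp]: "mat_embed d a m V \<in> carrier_mat d d"
  by (simp add: mat_embed_def)

lemma mat_embed_eq_dsum:
  assumes "V \<in> carrier_mat m m"
  shows "mat_embed (a + (m + r)) a m V = mat_dsum (1\<^sub>m a) (mat_dsum V (1\<^sub>m r))"
  using assms by (intro mat_dsum_eqI) (auto simp: mat_embed_def mat_dsum_index[of _ m _ r])

lemma mat_embed_mult: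
  assumes "V \<in> carrier_mat m m" "W \<in> carrier_mat m m" "a + m \<le> d"
  shows "mat_embed d a m (V * W) = mat_embed d a m V * mat_embed d a m W"
proof -
  obtain r where "d = a + (m + r)" using assms(3) by (metis add.assoc le_Suc_ex)
  then show ?thesis
    using assms by (simp add: mat_embed_eq_dsum mat_dsum_mult[of _ a _ _ "m + r"] mat_dsum_mult[of _ m _ _ r])
qed

lemma mat_embed_adjoint:
  assumes "V \<in> carrier_mat m m"
  shows "mat_embed d a m (mat_adjoint V) = mat_adjoint (mat_embed d a m V)"
  using assms by (intro eq_matI) (auto simp: mat_embed_def)

lemma mat_embed_unitary:
  assumes "V \<in> unitary_group m" "a + m \<le> d"
  shows "mat_embed d a m V \<in> unitary_group d"
proof (rule unitary_groupI)
  have "mat_embed d a m (1\<^sub>m m) = 1\<^sub>m d" by (rule eq_matI) (auto simp: mat_embed_def)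
  then show "mat_adjoint (mat_embed d a m V) * mat_embed d a m V = 1\<^sub>m d"
    using assms by (simp add: mat_embed_adjoint[symmetric] mat_embed_mult[symmetric])
qed simp

lemma mat_embed_dsum:
  assumes "V \<in> carrier_mat m m" "W \<in> carrier_mat m m" "a + (m + m) \<le> d"
  shows "mat_embed d a (m + m) (mat_dsum V W) = mat_embed d a m V * mat_embed d (a + m) m W"
proof -
  have 1: "mat_embed d a m V = mat_embed d a (m + m) (mat_dsum V (1\<^sub>m m))"
    using assms(1) by (intro eq_matI) (auto simp: mat_embed_def mat_dsum_index[of _ m _ m])
  have 2: "mat_embed d (a + m) m W = mat_embed d a (m + m) (mat_dsum (1\<^sub>m m) W)"
  proof (rule eq_matI)
    fix i j assume ij: "i < dim_row (mat_embed d a (m + m) (mat_dsum (1\<^sub>m m) W))"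
      "j < dim_col (mat_embed d a (m + m) (mat_dsum (1\<^sub>m m) W))"
    have "mat_dsum (1\<^sub>m m) W $$ (i - a, j - a) =
        (if i < a + m \<and> j < a + m then if i = j then 1 else 0
         else if a + m \<le> i \<and> a + m \<le> j then W $$ (i - (a + m), j - (a + m)) else 0)"
      if "a \<le> i" "a \<le> j" "i < a + (m + m)" "j < a + (m + m)"
    proof -
      have "i - a < m + m" "j - a < m + m" using that by auto
      then show ?thesis
        using that by (subst mat_dsum_index[OF one_carrier_mat assms(2)]) auto
    qed
    then show "mat_embed d (a + m) m W $$ (i, j) =
        mat_embed d a (m + m) (mat_dsum (1\<^sub>m m) W) $$ (i, j)"
      using ij by (auto simp: mat_embed_def)
  qed (auto simp: mat_embed_def)
  show ?thesis
    unfolding 1 2 using assms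
    by (simp add: mat_embed_mult[symmetric] mat_dsum_mult[of _ m _ _ m]
        left_mult_one_mat[of _ m m] right_mult_one_mat[of _ m m])
qed

text \<open>The common eigenbasis of all plane rotations, for the \<open>m\<close> planes spanned by \<open>i\<close> and \<open>m + i\<close>.\<close>

definition mat_balance :: "nat \<Rightarrow> complex mat" where
  "mat_balance m = mat (m + m) (m + m) (\<lambda>(i, j).
     if i = j then 1 / complex_of_real (sqrt 2) else if i = j + m \<or> j = i + m then \<i> / complex_of_real (sqrt 2) else 0)"

lemma mat_balance_carrier [simp]: "mat_balance m \<in> carrier_mat (m + m) (m + m)"
  by (simp add: mat_balance_def)

lemma mat_balance_four_block:
  "mat_balance m = four_block_mat
     (mat_diag m (\<lambda>_. 1 / complex_of_real (sqrt 2))) (mat_diag m (\<lambda>_. \<i> / complex_of_real (sqrt 2)))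
     (mat_diag m (\<lambda>_. \<i> / complex_of_real (sqrt 2))) (mat_diag m (\<lambda>_. 1 / complex_of_real (sqrt 2)))"
  by (rule eq_matI) (auto simp: mat_balance_def mat_diag_def)

lemma of_real_sqrt_2_square: "complex_of_real (sqrt 2) * complex_of_real (sqrt 2) = 2"
  by (simp flip: of_real_mult)

lemma mat_balance_adjoint:
  "mat_adjoint (mat_balance m) = four_block_mat
     (mat_diag m (\<lambda>_. 1 / complex_of_real (sqrt 2))) (mat_diag m (\<lambda>_. - \<i> / complex_of_real (sqrt 2)))
     (mat_diag m (\<lambda>_. - \<i> / complex_of_real (sqrt 2))) (mat_diag m (\<lambda>_. 1 / complex_of_real (sqrt 2)))"
  unfolding mat_balance_four_block
  by (subst adjoint_four_block_mat[of _ m _ m]) (auto simp: mat_diag_adjoint)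

lemma four_block_diag:
  "four_block_mat (mat_diag m f) (0\<^sub>m m m) (0\<^sub>m m m) (mat_diag m g)
    = mat_diag (m + m) (\<lambda>i. if i < m then f i else g (i - m))"
  by (rule eq_matI) (auto simp: mat_diag_def)

lemma mat_balance_unitary: "mat_balance m \<in> unitary_group (m + m)"
proof (rule unitary_groupI)
  show "mat_adjoint (mat_balance m) * mat_balance m = 1\<^sub>m (m + m)"
    unfolding mat_balance_adjoint unfolding mat_balance_four_block
    by (subst mult_four_block_mat[of _ m m _ m _ m _ _ m _ m])
      (simp_all add: mat_diag_add of_real_sqrt_2_square mat_diag_zero four_block_diag)
qed simp

text \<open>A plane rotation has the eigenvalues c - i s and c + i s, with eigenvectors that do not
  depend on the angle. All angles sit in the diagonal factor, and the conjugating matrix looks the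
  same in every plane.\<close>

lemma mat_rotation_diagonalize:
  "mat_rotation m c s = mat_balance m *
     mat_diag (m + m) (\<lambda>i. if i < m then Complex (c i) (- s i) else Complex (c (i - m)) (s (i - m))) *
     mat_adjoint (mat_balance m)"
proof -
  define r where "r = complex_of_real (sqrt 2)"
  have r: "r * r = 2" by (simp add: r_def of_real_sqrt_2_square)
  then have r0: "r \<noteq> 0" by auto
  let ?d = "mat_diag m" and ?z = "\<lambda>i. Complex (c i) (- s i)" and ?w = "\<lambda>i. Complex (c i) (s i)"
  have 1: "mat_balance m * mat_diag (m + m) (\<lambda>i. if i < m then ?z i else ?w (i - m)) =
      four_block_mat (?d (\<lambda>i. ?z i / r)) (?d (\<lambda>i. \<i> * ?w i / r)) (?d (\<lambda>i. \<i> * ?z i / r)) (?d (\<lambda>i. ?w i / r))"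
    unfolding four_block_diag[of m ?z ?w, symmetric] mat_balance_four_block r_def[symmetric]
    by (subst mult_four_block_mat[of _ m m _ m _ m _ _ m _ m])
      (simp_all add: left_add_zero_mat[of _ m m] right_add_zero_mat[of _ m m] right_mult_zero_mat[of _ m m])
  have "four_block_mat (?d (\<lambda>i. ?z i / r)) (?d (\<lambda>i. \<i> * ?w i / r)) (?d (\<lambda>i. \<i> * ?z i / r)) (?d (\<lambda>i. ?w i / r))
      * mat_adjoint (mat_balance m) = four_block_mat
      (?d (\<lambda>i. (?z i + ?w i) / (r * r))) (?d (\<lambda>i. \<i> * (?w i - ?z i) / (r * r)))
      (?d (\<lambda>i. \<i> * (?z i - ?w i) / (r * r))) (?d (\<lambda>i. (?z i + ?w i) / (r * r)))"
    unfolding mat_balance_adjoint r_def[symmetric]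
    by (subst mult_four_block_mat[of _ m m _ m _ m _ _ m _ m])
      (simp_all add: mat_diag_add algebra_simps diff_divide_distrib add_divide_distrib)
  also have "\<dots> = mat_rotation m c s"
    unfolding mat_rotation_def r
    by (intro arg_cong4[of _ _ _ _ _ _ _ _ four_block_mat] mat_diag_cong) (simp_all add: complex_eq_iff)
  finally show ?thesis unfolding 1 ..
qed

section \<open>Circuits across a bipartition\<close>

lemma bit_subregister: "bit (subregister qs i) l \<longleftrightarrow> l < length qs \<and> bit i (qs ! l)"
  unfolding subregister_def by (auto simp: bit_horner_sum_bit_iff)

lemma subregister_less: "subregister qs i < 2 ^ length qs"
  unfolding subregister_def using horner_sum_of_bool_2_less[of "map (bit i) qs"] by simp

lemma subregister_eq_iff:
  "subregister qs i = subregister qs j \<longleftrightarrow> (\<forall>q\<in>set qs. bit i q = bit j q)"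
proof
  assume eq: "subregister qs i = subregister qs j"
  show "\<forall>q\<in>set qs. bit i q = bit j q"
  proof
    fix q assume "q \<in> set qs"
    then obtain l where "l < length qs" "qs ! l = q" by (auto simp: in_set_conv_nth)
    then show "bit i q = bit j q"
      using arg_cong[OF eq, of "\<lambda>x. bit x l"] by (simp add: bit_subregister)
  qed
next
  assume "\<forall>q\<in>set qs. bit i q = bit j q"
  then have "map (bit i) qs = map (bit j) qs" by simp
  then show "subregister qs i = subregister qs j" by (simp only: subregister_def)
qed

lemma subregister_div_2_eq_iff:
  "subregister (q # qs) i div 2 = subregister (q # qs) j div 2 \<longleftrightarrow> (\<forall>q\<in>set qs. bit i q = bit j q)"
  using subregister_eq_iff[of qs i j] by (simp add: subregister_def)

lemma odd_subregister: "odd (subregister (q # qs) i) \<longleftrightarrow> bit i q"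
  by (simp add: subregister_def)

text \<open>The Pauli matrix X on bit 0 of the register, times the scalar \<open>u\<close>;
  \<open>y div 2\<close> holds all the other bits.\<close>

definition mat_flip :: "nat \<Rightarrow> complex \<Rightarrow> complex mat" where
  "mat_flip N u = mat N N (\<lambda>(y, y'). if y div 2 = y' div 2 \<and> y \<noteq> y' then u else 0)"

text \<open>The controlled-NOT gate with control bit 0 and target bit 1, its flipping block
  multiplied by \<open>u\<close>.\<close>

definition controlled_flip :: "complex \<Rightarrow> complex mat" where
  "controlled_flip u = mat 4 4 (\<lambda>(i, j).
     if i = j \<and> even i then 1 else if i \<noteq> j \<and> odd i \<and> odd j then u else 0)"

text \<open>Up to the exchange of rows 1 and 3 the matrix is diagonal with entries 1,
  \<open>u\<close>, 1, \<open>u\<close>, which gives the determinant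
  \<open>- (u * u)\<close>.\<close>

lemma controlled_flip_special_unitary:
  assumes "u * u = - 1"
  shows "controlled_flip u \<in> special_unitary_group 4"
proof -
  have less_4: "i < 4 \<longleftrightarrow> i = 0 \<or> i = 1 \<or> i = 2 \<or> i = 3" for i :: nat by auto
  have "controlled_flip u = swaprows 1 3 (mat_diag 4 (\<lambda>i. if odd i then u else 1))"
    by (rule eq_matI) (auto simp: controlled_flip_def mat_diag_def less_4)
  then have "det (controlled_flip u) = - det (mat_diag 4 (\<lambda>i. if odd i then u else 1))"
    using det_swaprows[of 1 4 3 "mat_diag 4 (\<lambda>i. if odd i then u else 1)"]
    by simp
  also have "det (mat_diag 4 (\<lambda>i. if odd i then u else 1)) = u * u"
    by (subst det_upper_triangular[of _ 4])
      (auto simp: mat_diag_def diag_mat_def upt_rec intro!: upper_triangularI)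
  finally have "det (controlled_flip u) = 1" using assms by simp
  have "cmod u * cmod u = 1"
    using arg_cong[OF assms, of cmod] by (simp add: norm_mult)
  then have "cmod u = 1" by (metis norm_ge_zero real_sqrt_abs2 abs_of_nonneg real_sqrt_one)
  then have uu: "cnj u * u = 1"
    using complex_norm_square[of u] by (simp add: mult.commute)
  have "mat_adjoint (controlled_flip u) * controlled_flip u = 1\<^sub>m 4"
  proof (rule eq_matI)
    fix i j assume "i < dim_row (1\<^sub>m 4 :: complex mat)" "j < dim_col (1\<^sub>m 4 :: complex mat)"
    then have ij: "i < 4" "j < 4" by auto
    have "(mat_adjoint (controlled_flip u) * controlled_flip u) $$ (i, j) =
        (\<Sum>l<4. cnj (controlled_flip u $$ (l, i)) * controlled_flip u $$ (l, j))"
      using ij by (intro mat_adjoint_mult_index) (auto simp: controlled_flip_def)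
    also have "\<dots> = 1\<^sub>m 4 $$ (i, j)"
    proof -
      have "(\<Sum>l<4. f l) = f 0 + f 1 + f 2 + f 3" for f :: "nat \<Rightarrow> complex"
        by (simp add: eval_nat_numeral)
      moreover have "controlled_flip u $$ (k, l) =
          (if k = l \<and> even k then 1 else if k \<noteq> l \<and> odd k \<and> odd l then u else 0)"
        if "k < 4" "l < 4" for k l using that by (simp add: controlled_flip_def)
      ultimately show ?thesis
        using ij by (elim less_4[THEN iffD1, elim_format] disjE) (simp_all add: uu)
    qed
    finally show "(mat_adjoint (controlled_flip u) * controlled_flip u) $$ (i, j) = 1\<^sub>m 4 $$ (i, j)" .
  qed (auto simp: controlled_flip_def)
  then have "controlled_flip u \<in> unitary_group 4"
    by (intro unitary_groupI) (simp_all add: controlled_flip_def)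
  with \<open>det (controlled_flip u) = 1\<close> show ?thesis by (simp add: special_unitary_group_def)
qed

section \<open>Block coordinates of the bipartition\<close>

locale bipartition =
  fixes n :: nat and A B :: "nat set"
  assumes un: "A \<union> B = {..<n}" and disj: "A \<inter> B = {}" and A0: "A \<noteq> {}" and B0: "B \<noteq> {}"
begin

abbreviation K :: nat where "K \<equiv> 2 ^ card A"
abbreviation N :: nat where "N \<equiv> 2 ^ card B"

abbreviation regA :: "nat \<Rightarrow> nat" where "regA \<equiv> subregister (sorted_list_of_set A)"
abbreviation regB :: "nat \<Rightarrow> nat" where "regB \<equiv> subregister (sorted_list_of_set B)"

text \<open>The qubits of \<open>A\<close> and \<open>B\<close> may interleave. This permutation of
  the basis moves the bits of \<open>A\<close> to the high positions, which turns the tensor product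
  over the bipartition into the block structure with index \<open>x * N + y\<close>.\<close>

definition joint_index :: "nat \<Rightarrow> nat" where "joint_index i = regA i * N + regB i"

abbreviation reindex :: "complex mat \<Rightarrow> complex mat" where
  "reindex \<equiv> mat_reindex (2 ^ n) joint_index"

lemma finite_AB: "finite A" "finite B"
  using un finite_subset[of A "{..<n}"] finite_subset[of B "{..<n}"] by auto

lemma card_AB: "card A + card B = n"
  using card_Un_disjoint[OF finite_AB disj] un by simp

lemma K_N: "K * N = 2 ^ n" by (simp add: power_add[symmetric] card_AB)

lemma K_ge_2: "2 \<le> K" and N_ge_2: "2 \<le> N"
proof -
  have "card A \<noteq> 0" "card B \<noteq> 0" using A0 B0 finite_AB by auto
  then show "2 \<le> K" "2 \<le> N"
    by (metis One_nat_def Suc_leI neq0_conv one_le_numeral power_increasing power_one_right)+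
qed

lemma even_N: "even N"
  using N_ge_2 by (cases "card B") auto

lemma regA_less: "regA i < K" and regB_less: "regB i < N"
  using subregister_less[of "sorted_list_of_set A" i] subregister_less[of "sorted_list_of_set B" i]
  by auto

lemma joint_index_div_mod [simp]:
  "joint_index i div N = regA i" "joint_index i mod N = regB i"
  using regB_less[of i] by (auto simp: joint_index_def)

lemma regA_eq_iff: "regA i = regA j \<longleftrightarrow> (\<forall>q\<in>A. bit i q = bit j q)"
  and regB_eq_iff: "regB i = regB j \<longleftrightarrow> (\<forall>q\<in>B. bit i q = bit j q)"
  using finite_AB by (simp_all add: subregister_eq_iff)

lemma joint_index_less: "joint_index i < 2 ^ n"
proof -
  have "joint_index i < regA i * N + N" using regB_less[of i] by (simp add: joint_index_def)
  also have "\<dots> = (regA i + 1) * N" by (simp add: algebra_simps)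
  also have "\<dots> \<le> K * N" using regA_less[of i] by (intro mult_right_mono) auto
  finally show ?thesis by (simp add: K_N)
qed

lemma joint_index_bij: "bij_betw joint_index {..<2 ^ n} {..<2 ^ n}"
proof -
  have "inj_on joint_index {..<2 ^ n}"
  proof (rule inj_onI)
    fix i j :: nat assume ij: "i \<in> {..<2 ^ n}" "j \<in> {..<2 ^ n}" "joint_index i = joint_index j"
    then have "regA i = regA j" "regB i = regB j" by (metis joint_index_div_mod)+
    then have "bit i q = bit j q" if "q < n" for q
      using that un unfolding regA_eq_iff regB_eq_iff by blast
    moreover have "take_bit n i = i" "take_bit n j = j"
      using ij by (auto simp: take_bit_nat_eq_self_iff)
    ultimately show "i = j"
      by (metis bit_eq_iff bit_take_bit_iff)
  qed
  moreover have "joint_index ` {..<2 ^ n} \<subseteq> {..<2 ^ n}" using joint_index_less by auto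
  ultimately show ?thesis
    by (metis bij_betw_def endo_inj_surj finite_lessThan)
qed

lemmas reindex_mult = mat_reindex_mult[OF joint_index_bij]

lemma apply_on_A: "apply_on n (sorted_list_of_set A) V = reindex (mat_kron K N V (1\<^sub>m N))"
proof (rule eq_matI)
  fix i j assume "i < dim_row (reindex (mat_kron K N V (1\<^sub>m N)))"
    "j < dim_col (reindex (mat_kron K N V (1\<^sub>m N)))"
  then have ij: "i < 2 ^ n" "j < 2 ^ n" by (auto simp: mat_reindex_def)
  have "(\<forall>q<n. q \<notin> set (sorted_list_of_set A) \<longrightarrow> bit i q = bit j q) \<longleftrightarrow> regB i = regB j"
    using un disj finite_AB unfolding regB_eq_iff by auto
  then show "apply_on n (sorted_list_of_set A) V $$ (i, j) = reindex (mat_kron K N V (1\<^sub>m N)) $$ (i, j)"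
    using ij joint_index_less regB_less
    by (simp add: apply_on_def mat_reindex_def mat_kron_def mat_blocks_def K_N)
qed (auto simp: apply_on_def mat_reindex_def)

lemma apply_on_B: "apply_on n (sorted_list_of_set B) W = reindex (mat_kron K N (1\<^sub>m K) W)"
proof (rule eq_matI)
  fix i j assume "i < dim_row (reindex (mat_kron K N (1\<^sub>m K) W))"
    "j < dim_col (reindex (mat_kron K N (1\<^sub>m K) W))"
  then have ij: "i < 2 ^ n" "j < 2 ^ n" by (auto simp: mat_reindex_def)
  have "(\<forall>q<n. q \<notin> set (sorted_list_of_set B) \<longrightarrow> bit i q = bit j q) \<longleftrightarrow> regA i = regA j"
    using un disj finite_AB unfolding regA_eq_iff by auto
  then show "apply_on n (sorted_list_of_set B) W $$ (i, j) = reindex (mat_kron K N (1\<^sub>m K) W) $$ (i, j)"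
    using ij joint_index_less regA_less
    by (simp add: apply_on_def mat_reindex_def mat_kron_def mat_blocks_def K_N)
qed (auto simp: apply_on_def mat_reindex_def)

text \<open>The least qubit of a side is bit 0 of its register, because the qubits are listed in
  increasing order. So the control is the parity of the level of \<open>A\<close> and the target is
  the lowest bit of \<open>B\<close>. The synthesis places all its straddling gates on this one pair
  of qubits.\<close>

lemma apply_on_controlled_flip:
  "apply_on n [Min A, Min B] (controlled_flip u) =
    reindex (mat_blockdiag K N (\<lambda>x. if odd x then mat_flip N u else 1\<^sub>m N))"
proof (rule eq_matI)
  fix i j assume "i < dim_row (reindex (mat_blockdiag K N (\<lambda>x. if odd x then mat_flip N u else 1\<^sub>m N)))"
    "j < dim_col (reindex (mat_blockdiag K N (\<lambda>x. if odd x then mat_flip N u else 1\<^sub>m N)))"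
  then have ij: "i < 2 ^ n" "j < 2 ^ n" by (auto simp: mat_reindex_def)
  let ?p = "Min A" and ?q = "Min B"
  have lA: "sorted_list_of_set A = ?p # sorted_list_of_set (A - {?p})"
    and lB: "sorted_list_of_set B = ?q # sorted_list_of_set (B - {?q})"
    using finite_AB A0 B0 by (auto intro: sorted_list_of_set_nonempty)
  have pA: "?p \<in> A" and qB: "?q \<in> B" using finite_AB A0 B0 by auto
  let ?EA = "\<forall>r\<in>A - {?p}. bit i r = bit j r" and ?EB = "\<forall>r\<in>B - {?q}. bit i r = bit j r"
  have rest: "(\<forall>r<n. r \<notin> set [?p, ?q] \<longrightarrow> bit i r = bit j r) \<longleftrightarrow> ?EA \<and> ?EB"
    using un disj pA qB by auto
  have eA: "regA i = regA j \<longleftrightarrow> ?EA \<and> bit i ?p = bit j ?p"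
    and eB: "regB i = regB j \<longleftrightarrow> ?EB \<and> bit i ?q = bit j ?q"
    using pA qB unfolding regA_eq_iff regB_eq_iff by auto
  have dB: "regB i div 2 = regB j div 2 \<longleftrightarrow> ?EB"
    unfolding lB subregister_div_2_eq_iff using finite_AB by simp
  have oA: "odd (regA i) \<longleftrightarrow> bit i ?p" unfolding lA odd_subregister ..
  have sub: "subregister [?p, ?q] k = of_bool (bit k ?p) + 2 * of_bool (bit k ?q)" for k
    by (simp add: subregister_def)
  show "apply_on n [?p, ?q] (controlled_flip u) $$ (i, j) =
      reindex (mat_blockdiag K N (\<lambda>x. if odd x then mat_flip N u else 1\<^sub>m N)) $$ (i, j)"
  proof -
    have "apply_on n [?p, ?q] (controlled_flip u) $$ (i, j) =
        (if ?EA \<and> ?EB then controlled_flip u $$ (subregister [?p, ?q] i, subregister [?p, ?q] j) else 0)"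
      using ij rest by (simp add: apply_on_def)
    also have "controlled_flip u $$ (subregister [?p, ?q] i, subregister [?p, ?q] j) =
        (if bit i ?p = bit j ?p then
           if bit i ?p then (if bit i ?q \<noteq> bit j ?q then u else 0)
           else if bit i ?q = bit j ?q then 1 else 0
         else 0)"
      unfolding sub
      by (cases "bit i ?p"; cases "bit j ?p"; cases "bit i ?q"; cases "bit j ?q") (simp_all add: controlled_flip_def)
    also have "(if ?EA \<and> ?EB then \<dots> else 0) =
        (if regA i = regA j then
           if odd (regA i) then (if regB i div 2 = regB j div 2 \<and> regB i \<noteq> regB j then u else 0)
           else if regB i = regB j then 1 else 0
         else 0)"
      unfolding eA eB dB oA by simp
    also have "\<dots> = reindex (mat_blockdiag K N (\<lambda>x. if odd x then mat_flip N u else 1\<^sub>m N)) $$ (i, j)"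
      using ij joint_index_less[of i] joint_index_less[of j] regB_less[of i] regB_less[of j]
      by (simp add: mat_reindex_def mat_blockdiag_def mat_blocks_def K_N mat_flip_def)
    finally show ?thesis .
  qed
qed (auto simp: apply_on_def mat_reindex_def)

section \<open>Operators realizable with a bounded number of straddling gates\<close>

lemma gate_operator_carrier [simp]: "gate_operator n A B g \<in> carrier_mat (2 ^ n) (2 ^ n)"
  by (cases g) (auto simp: apply_on_def)

lemma circuit_operator_carrier [simp]: "circuit_operator n A B gs \<in> carrier_mat (2 ^ n) (2 ^ n)"
  by (induction gs) auto

lemma circuit_operator_append:
  "circuit_operator n A B (gs @ hs) = circuit_operator n A B gs * circuit_operator n A B hs"
  by (induction gs) (auto simp: assoc_mult_mat[of _ "2 ^ n" "2 ^ n" _ "2 ^ n" _ "2 ^ n"]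
      left_mult_one_mat[of _ "2 ^ n" "2 ^ n"])

text \<open>\<open>M\<close> is given in block coordinates, and \<open>s\<close> is a bound and not
  a minimum, so that counts simply add under products.\<close>

definition realizable :: "nat \<Rightarrow> complex mat \<Rightarrow> bool" where
  "realizable s M \<longleftrightarrow> M \<in> carrier_mat (K * N) (K * N) \<and>
     (\<exists>gs. implements n A B gs (reindex M) \<and> straddling_count gs \<le> s)"

lemma realizableI_gate:
  assumes "M \<in> carrier_mat (K * N) (K * N)" "valid_gate A B g" "gate_operator n A B g = reindex M"
    "straddling_count [g] \<le> s"
  shows "realizable s M"
  unfolding realizable_def implements_def using assms
  by (intro conjI exI[of _ "[g]"]) (auto simp: right_mult_one_mat[of _ "2 ^ n" "2 ^ n"])

lemma realizable_mult:
  assumes "realizable s M" "realizable t M'"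
  shows "realizable (s + t) (M * M')"
proof -
  obtain gs hs where
    "implements n A B gs (reindex M)" "straddling_count gs \<le> s"
    "implements n A B hs (reindex M')" "straddling_count hs \<le> t"
    and c: "M \<in> carrier_mat (2 ^ n) (2 ^ n)" "M' \<in> carrier_mat (2 ^ n) (2 ^ n)"
    using assms unfolding realizable_def K_N by blast
  then have "implements n A B (gs @ hs) (reindex (M * M'))" "straddling_count (gs @ hs) \<le> s + t"
    by (auto simp: implements_def circuit_operator_append straddling_count_def reindex_mult[OF c])
  then show ?thesis
    using c unfolding realizable_def K_N by auto
qed

lemma realizable_A:
  assumes "V \<in> unitary_group K"
  shows "realizable 0 (mat_kron K N V (1\<^sub>m N))"
  using assms by (intro realizableI_gate[of _ "Local_A V"])
    (auto simp: straddling_count_def apply_on_A)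

lemma realizable_B:
  assumes "W \<in> unitary_group N"
  shows "realizable 0 (mat_kron K N (1\<^sub>m K) W)"
  using assms by (intro realizableI_gate[of _ "Local_B W"])
    (auto simp: straddling_count_def apply_on_B)

lemma realizable_one: "realizable 0 (1\<^sub>m (K * N))"
  using realizable_B[of "1\<^sub>m N"] by (simp add: mat_kron_one_one)

lemma realizable_controlled_flip:
  assumes "u * u = - 1"
  shows "realizable 1 (mat_blockdiag K N (\<lambda>x. if odd x then mat_flip N u else 1\<^sub>m N))"
  using assms finite_AB A0 B0 by (intro realizableI_gate[of _ "Straddling (Min A) (Min B) (controlled_flip u)"])
    (auto simp: straddling_count_def apply_on_controlled_flip controlled_flip_special_unitary simp del: One_nat_def)

lemma realizable_conj_A:
  assumes V: "V \<in> unitary_group K" and M: "realizable s M"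
  shows "realizable s (mat_kron K N V (1\<^sub>m N) * M * mat_kron K N (mat_adjoint V) (1\<^sub>m N))"
  using realizable_mult[OF realizable_mult[OF realizable_A[OF V] M] realizable_A[OF unitary_adjoint[OF V]]]
  by simp

lemma realizable_conj_perm:
  assumes \<pi>: "bij_betw \<pi> {..<K} {..<K}" and F: "\<And>x. x < K \<Longrightarrow> F x \<in> carrier_mat N N"
    and M: "realizable s (mat_blockdiag K N (\<lambda>x. F (\<pi> x)))"
  shows "realizable s (mat_blockdiag K N F)"
  using realizable_conj_A[OF mat_perm_unitary[OF \<pi>] M] mat_blockdiag_conj_perm[OF \<pi>, of F N] F by simp

lemma realizable_conj_B:
  assumes W: "W \<in> unitary_group N" and F: "\<And>x. x < K \<Longrightarrow> F x \<in> carrier_mat N N"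
    and M: "realizable s (mat_blockdiag K N F)"
  shows "realizable s (mat_blockdiag K N (\<lambda>x. W * F x * mat_adjoint W))"
  using realizable_mult[OF realizable_mult[OF realizable_B[OF W] M] realizable_B[OF unitary_adjoint[OF W]]] W F
  by (simp add: mat_kron_one_left mat_blockdiag_mult)

end

section \<open>Synthesis\<close>

lemma mat_flip_carrier [simp]: "mat_flip N u \<in> carrier_mat N N"
  by (simp add: mat_flip_def)

definition flip_index :: "nat \<Rightarrow> nat" where
  "flip_index y = (if even y then y + 1 else y - 1)"

lemma flip_index_less: "even N \<Longrightarrow> y < N \<Longrightarrow> flip_index y < N"
  unfolding flip_index_def by (cases "Suc y = N") auto

lemma flip_index_flip_index [simp]: "flip_index (flip_index y) = y"
  by (auto simp: flip_index_def)

lemma flip_index_iff: "y div 2 = y' div 2 \<and> y \<noteq> y' \<longleftrightarrow> y' = flip_index y"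
  unfolding flip_index_def by (cases "even y") (auto, presburger+)

lemma mat_flip_mult_diag:
  assumes "even N"
  shows "mat_flip N u * mat_diag N d = mat_diag N (\<lambda>y. d (flip_index y)) * mat_flip N u"
  by (rule eq_matI)
    (auto simp: mat_diag_mult_left[of _ N N] mat_diag_mult_right[of _ N N] mat_flip_def flip_index_iff)

lemma mat_flip_mult:
  assumes "even N"
  shows "mat_flip N u * mat_flip N v = mat_diag N (\<lambda>_. u * v)"
proof (rule eq_matI)
  fix i j assume "i < dim_row (mat_diag N (\<lambda>_. u * v))" "j < dim_col (mat_diag N (\<lambda>_. u * v))"
  then have ij: "i < N" "j < N" by (auto simp: mat_diag_def)
  have "(mat_flip N u * mat_flip N v) $$ (i, j) = (\<Sum>l<N. mat_flip N u $$ (i, l) * mat_flip N v $$ (l, j))"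
    using ij by (intro mult_mat_index) auto
  also have "\<dots> = (\<Sum>l<N. if l = flip_index i then (if i = j then u * v else 0) else 0)"
    using ij by (intro sum.cong) (auto simp: mat_flip_def flip_index_iff)
  finally show "(mat_flip N u * mat_flip N v) $$ (i, j) = mat_diag N (\<lambda>_. u * v) $$ (i, j)"
    using ij flip_index_less[OF assms ij(1)] by (simp add: mat_diag_def)
qed (auto simp: mat_flip_def mat_diag_def)

lemma mat_diag_carrier [simp]: "mat_diag N d \<in> carrier_mat N N"
  by (rule mat_diag_dim)

text \<open>A diagonal moves past a flip with its paired entries exchanged, so two twisted flips
  combine to a diagonal. The commutators below rest on this computation.\<close>

lemma twisted_flip_mult:
  assumes N: "even N"
  shows "mat_diag N d * mat_flip N u * (mat_diag N d' * mat_flip N v) =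
    mat_diag N (\<lambda>y. d y * d' (flip_index y) * (u * v))"
proof -
  have "mat_diag N d * mat_flip N u * (mat_diag N d' * mat_flip N v) =
      mat_diag N d * (mat_flip N u * mat_diag N d') * mat_flip N v"
    by (simp add: assoc_mult_mat[of _ N N _ N _ N])
  also have "\<dots> = mat_diag N d * mat_diag N (\<lambda>y. d' (flip_index y)) * (mat_flip N u * mat_flip N v)"
    unfolding mat_flip_mult_diag[OF N] by (simp add: assoc_mult_mat[of _ N N _ N _ N] del: mat_diag_diag)
  finally show ?thesis by (simp add: mat_flip_mult[OF N])
qed

lemma bij_betw_transpose: "a < d \<Longrightarrow> b < d \<Longrightarrow> bij_betw (Transposition.transpose a b) {..<d} {..<d :: nat}"
  by (rule bij_betw_byWitness[of _ "Transposition.transpose a b"]) (auto simp: Transposition.transpose_def)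

text \<open>\<open>swap01\<close> exchanges the levels 0 and 1, so the odd levels and their image differ in these two only.\<close>

definition swap01 :: "nat \<Rightarrow> nat" where
  "swap01 = Transposition.transpose 0 1"

context bipartition
begin

text \<open>The commutator of \<open>X\<close> controlled on the odd levels with the operator that is \<open>G\<close> on level 1 and
  \<open>G\<^sup>-\<^sup>1\<close> on level 0 acts on level 1 only.\<close>

lemma realizable_antisymmetric:
  assumes d: "\<And>y. y < N \<Longrightarrow> cmod (d y) = 1"
    and anti: "\<And>y. y < N \<Longrightarrow> d (flip_index y) = cnj (d y)"
  shows "realizable 6 (mat_blockdiag K N (\<lambda>x. if x = 1 then mat_diag N d else 1\<^sub>m N))"
proof -
  \<comment> \<open>The commutator will produce a fourth power, so a fourth root of each phase is
    taken.\<close>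
  define w where "w y = cis (Arg (d y) / 4)" for y
  \<comment> \<open>The root is chosen once per pair, at the even member, and conjugated for the
    partner. Principal roots of both entries would fail to be conjugate when both entries equal
    -1.\<close>
  define \<Delta> where "\<Delta> y = (if even y then cnj (w y) else w (y - 1))" for y
  have cmodw: "cmod (w y) = 1" for y by (simp add: w_def)
  have w4: "w y * w y * (w y * w y) = d y" if "y < N" for y
  proof -
    have "w y * w y * (w y * w y) = cis (Arg (d y))" by (simp add: w_def cis_mult)
    also have "\<dots> = d y" using d[OF that] cis_Arg[of "d y"] by (cases "d y = 0") (simp_all add: sgn_eq)
    finally show ?thesis .
  qed
  have cmod\<Delta>: "cmod (\<Delta> y) = 1" for y by (simp add: \<Delta>_def cmodw)
  have \<Delta>1: "\<Delta> y * cnj (\<Delta> y) = 1" for y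
    using cmod\<Delta>[of y] by (simp add: complex_norm_square[symmetric])
  have \<Delta>flip: "\<Delta> (flip_index y) = cnj (\<Delta> y)" for y by (auto simp: \<Delta>_def flip_index_def)
  have \<Delta>4: "\<Delta> (flip_index y) * \<Delta> (flip_index y) * (\<Delta> (flip_index y) * \<Delta> (flip_index y)) = d y" if "y < N" for y
  proof (cases "even y")
    case True
    then show ?thesis using w4[OF that] by (simp add: \<Delta>_def flip_index_def)
  next
    case False
    then have "y - 1 < N" "flip_index (y - 1) = y" using that by (auto simp: flip_index_def)
    then show ?thesis
      using False w4[of "y - 1"] anti[of "y - 1"] by (simp add: \<Delta>_def flip_index_def flip: complex_cnj_mult)
  qed
  \<comment> \<open>As \<open>\<Delta>\<close> is antisymmetric, conjugating a flip by it multiplies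
    the flip by the square of \<open>\<Delta>\<close>. \<open>G\<close> is therefore a flip up to
    conjugation by a unitary of \<open>B\<close>, and its controlled version still costs one
    straddling gate.\<close>
  define G where "G u = mat_diag N (\<lambda>y. \<Delta> y * \<Delta> y) * mat_flip N u" for u
  have G [simp]: "G u \<in> carrier_mat N N" for u by (simp add: G_def)
  have GG: "G u * G v = mat_diag N (\<lambda>_. u * v)" for u v
    unfolding G_def twisted_flip_mult[OF even_N] \<Delta>flip
    by (rule mat_diag_cong) (use \<Delta>1 in \<open>simp add: algebra_simps\<close>)
  have conj: "mat_diag N \<Delta> * mat_flip N u * mat_adjoint (mat_diag N \<Delta>) = G u" for u
    unfolding G_def mat_diag_adjoint
    by (simp add: assoc_mult_mat[of _ N N _ N _ N] mat_flip_mult_diag[OF even_N] \<Delta>flip)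
      (simp add: assoc_mult_mat[of _ N N _ N _ N, symmetric])
  let ?f = "mat_flip N"
  let ?M = "\<lambda>E F. mat_blockdiag K N (\<lambda>x. if E x then F else 1\<^sub>m N)"
  have \<Delta>u: "mat_diag N \<Delta> \<in> unitary_group N" by (rule mat_diag_unitary) (rule cmod\<Delta>)
  have f: "realizable 1 (?M odd (?f u))" if "u * u = - 1" for u
    by (rule realizable_controlled_flip[OF that])
  have g: "realizable 1 (?M odd (G u))" if "u * u = - 1" for u
  proof -
    have "mat_blockdiag K N (\<lambda>x. mat_diag N \<Delta> * (if odd x then ?f u else 1\<^sub>m N) * mat_adjoint (mat_diag N \<Delta>)) = ?M odd (G u)"
      by (rule mat_blockdiag_cong) (use \<Delta>u conj in auto)
    then show ?thesis using realizable_conj_B[OF \<Delta>u _ f[OF that]] by simp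
  qed
  have g': "realizable 1 (?M (\<lambda>x. odd (swap01 x)) (G u))" if "u * u = - 1" for u
  proof (rule realizable_conj_perm[of swap01])
    show "bij_betw swap01 {..<K} {..<K}"
      unfolding swap01_def using K_ge_2 by (intro bij_betw_transpose) auto
    show "realizable 1 (mat_blockdiag K N (\<lambda>x. if odd (swap01 (swap01 x)) then G u else 1\<^sub>m N))"
      using g[OF that] by (simp add: swap01_def)
  qed auto
  have u: "\<i> * \<i> = - 1" "(- \<i>) * (- \<i>) = - 1" by auto
  \<comment> \<open>One flip, a pair of controlled \<open>G\<close>, the inverse flip, the inverse
    pair. Within each pair all odd levels except 1 cancel. On level 0 the first pair leaves an
    inverse of \<open>G\<close>, which the second pair undoes because no flip acts there.\<close>
  let ?prod = "?M odd (?f \<i>) * (?M odd (G \<i>) * (?M (\<lambda>x. odd (swap01 x)) (G (- \<i>)) *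
    (?M odd (?f (- \<i>)) * (?M (\<lambda>x. odd (swap01 x)) (G \<i>) * ?M odd (G (- \<i>))))))"
  have "realizable (1 + (1 + (1 + (1 + (1 + 1))))) ?prod"
    by (intro realizable_mult f g g' u)
  moreover have "?prod = mat_blockdiag K N (\<lambda>x. if x = 1 then mat_diag N d else 1\<^sub>m N)"
  proof -
    have G1: "G \<i> * G (- \<i>) = 1\<^sub>m N" "G (- \<i>) * G \<i> = 1\<^sub>m N" "?f \<i> * ?f (- \<i>) = 1\<^sub>m N"
      by (simp_all add: GG mat_flip_mult[OF even_N])
    have c: "G \<i> * (G (- \<i>) * X) = X" if "X \<in> carrier_mat N N" for X
      by (rule mult_cancel_inverse_mid[OF _ _ that G1(1)]) auto
    have fG: "?f u * G v = mat_diag N (\<lambda>y. cnj (\<Delta> y * \<Delta> y) * (u * v))" for u v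
    proof -
      have "?f u = mat_diag N (\<lambda>_. 1) * ?f u" by (simp add: left_mult_one_mat[of _ N N])
      then show ?thesis
        unfolding G_def using twisted_flip_mult[OF even_N, of "\<lambda>_. 1" u "\<lambda>y. \<Delta> y * \<Delta> y" v]
        by (simp add: \<Delta>flip)
    qed
    \<comment> \<open>Each flip times \<open>G\<close> is the conjugate square of
      \<open>\<Delta>\<close> up to the sign -1. The two signs cancel, and the two squares multiply
      to the fourth power.\<close>
    have level1: "?f \<i> * (G \<i> * (?f (- \<i>) * G (- \<i>))) = mat_diag N d"
      (is "?L = _")
    proof -
      have "?L = ?f \<i> * G \<i> * (?f (- \<i>) * G (- \<i>))"
        by (simp add: assoc_mult_mat[of _ N N _ N _ N])
      also have "\<dots> = mat_diag N d"
        unfolding fG mat_diag_diag using \<Delta>4 by (intro mat_diag_cong) (simp add: \<Delta>flip)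
      finally show ?thesis .
    qed
    have "?prod = mat_blockdiag K N (\<lambda>x.
        (if odd x then ?f \<i> else 1\<^sub>m N) * ((if odd x then G \<i> else 1\<^sub>m N) *
        ((if odd (swap01 x) then G (- \<i>) else 1\<^sub>m N) * ((if odd x then ?f (- \<i>) else 1\<^sub>m N) *
        ((if odd (swap01 x) then G \<i> else 1\<^sub>m N) * (if odd x then G (- \<i>) else 1\<^sub>m N))))))"
      by (simp add: mat_blockdiag_mult)
    also have "\<dots> = mat_blockdiag K N (\<lambda>x. if x = 1 then mat_diag N d else 1\<^sub>m N)"
    proof (rule mat_blockdiag_cong)
      fix x :: nat
      consider "x = 0" | "x = 1" | "x \<noteq> 0" "x \<noteq> 1" by blast
      then show "(if odd x then ?f \<i> else 1\<^sub>m N) * ((if odd x then G \<i> else 1\<^sub>m N) *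
        ((if odd (swap01 x) then G (- \<i>) else 1\<^sub>m N) * ((if odd x then ?f (- \<i>) else 1\<^sub>m N) *
        ((if odd (swap01 x) then G \<i> else 1\<^sub>m N) * (if odd x then G (- \<i>) else 1\<^sub>m N))))) =
        (if x = 1 then mat_diag N d else 1\<^sub>m N)"
      proof cases
        case 1
        then show ?thesis
          by (simp add: swap01_def G1 left_mult_one_mat[of _ N N] right_mult_one_mat[of _ N N])
      next
        case 2
        then show ?thesis
          using level1 by (simp add: swap01_def left_mult_one_mat[of _ N N])
      next
        case 3
        then have "swap01 x = x" by (simp add: swap01_def)
        then show ?thesis
          using 3 by (simp add: c G1 left_mult_one_mat[of _ N N] right_mult_one_mat[of _ N N])
      qed
    qed
    finally show ?thesis .
  qed
  ultimately show ?thesis by (simp add: eval_nat_numeral)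
qed

text \<open>With \<open>p\<close> the partial products of the normalised phases, the diagonal with entries
  \<open>p 0, cnj (p 0), p 2, cnj (p 2), \<dots>\<close> times the one with entries
  \<open>1, p 1, cnj (p 1), p 3, cnj (p 3), \<dots>\<close> is the given one. The second is a cyclic shift of an
  antisymmetric one because the last partial product is 1.\<close>

lemma realizable_diag:
  assumes d: "\<And>y. y < N \<Longrightarrow> cmod (d y) = 1"
  shows "realizable 12 (mat_blockdiag K N (\<lambda>x. if x = 1 then mat_diag N d else 1\<^sub>m N))"
proof -
  have N0: "N > 0" by simp
  \<comment> \<open>An \<open>N\<close>-th root of the product of all phases: after division by it
    the phases multiply to 1, which closes the cycle of partial products.\<close>
  define \<phi> where "\<phi> = cis (Arg (\<Prod>y<N. d y) / N)"
  have cmod\<phi>: "cmod \<phi> = 1" by (simp add: \<phi>_def)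
  have \<phi>1: "\<phi> * cnj \<phi> = 1" using cmod\<phi> by (simp add: complex_norm_square[symmetric])
  have \<phi>N: "\<phi> ^ N = (\<Prod>y<N. d y)"
  proof -
    have n1: "cmod (\<Prod>y<N. d y) = 1" by (simp add: prod_norm[symmetric] d)
    have "\<phi> ^ N = cis (Arg (\<Prod>y<N. d y))" unfolding \<phi>_def by (simp add: DeMoivre)
    also have "\<dots> = (\<Prod>y<N. d y)" using n1 cis_Arg[of "\<Prod>y<N. d y"]
      by (cases "(\<Prod>y<N. d y) = 0") (simp_all add: sgn_eq del: prod_zero_iff)
    finally show ?thesis .
  qed
  define p where "p y = (\<Prod>z\<le>y. d z * cnj \<phi>)" for y
  have cmodp: "cmod (p y) = 1" if "y < N" for y
    unfolding p_def prod_norm[symmetric] using that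
    by (intro prod.neutral) (auto simp: norm_mult d cmod\<phi>)
  have p1: "p y * cnj (p y) = 1" if "y < N" for y
    using cmodp[OF that] by (simp add: complex_norm_square[symmetric])
  have pSuc: "p (Suc y) = p y * (d (Suc y) * cnj \<phi>)" for y by (simp add: p_def)
  have pN: "p (N - 1) = 1"
  proof -
    have "{..N - 1} = {..<N}" using lessThan_Suc_atMost[of "N - 1"] N0 by simp
    then have "p (N - 1) = (\<Prod>y<N. d y) * cnj \<phi> ^ N" unfolding p_def by (simp add: prod.distrib)
    also have "\<dots> = (\<phi> * cnj \<phi>) ^ N" unfolding \<phi>N[symmetric] by (simp add: power_mult_distrib)
    finally show ?thesis by (simp add: \<phi>1)
  qed
  define \<beta> where "\<beta> y = (if even y then p y else cnj (p (y - 1)))" for y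
  define \<gamma> where "\<gamma> y = (if even y then p (y + 1) else cnj (p y))" for y
  have \<beta>: "cmod (\<beta> y) = 1" "\<beta> (flip_index y) = cnj (\<beta> y)" if "y < N" for y
    using that by (auto simp: \<beta>_def flip_index_def cmodp)
  have \<gamma>: "cmod (\<gamma> y) = 1" "\<gamma> (flip_index y) = cnj (\<gamma> y)" if "y < N" for y
    using that flip_index_less[OF even_N that] by (auto simp: \<gamma>_def flip_index_def cmodp)
  define succ where "succ y = (if y = N - 1 then 0 else y + 1)" for y
  define pred where "pred y = (if y = 0 then N - 1 else y - 1)" for y
  have ps: "pred (succ y) = y" "succ (pred y) = y" "succ y < N" "pred y < N" if "y < N" for y
    using that by (auto simp: succ_def pred_def)
  have bij: "bij_betw succ {..<N} {..<N}"
    by (rule bij_betw_byWitness[of _ pred]) (use ps in auto)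
  define S where "S = mat_perm N succ"
  have S: "S \<in> unitary_group N" unfolding S_def by (rule mat_perm_unitary[OF bij])
  have [simp]: "S \<in> carrier_mat N N" using S by simp
  have "S * mat_diag N \<gamma> = mat_diag N (\<lambda>y. \<gamma> (pred y)) * S"
    by (rule eq_matI)
      (auto simp: S_def mat_perm_def mat_diag_mult_left[of _ N N] mat_diag_mult_right[of _ N N] ps)
  then have conjS: "S * mat_diag N \<gamma> * mat_adjoint S = mat_diag N (\<lambda>y. \<gamma> (pred y))"
    using S by (simp add: assoc_mult_mat[of _ N N _ N _ N] right_mult_one_mat[of _ N N])
  have prod: "\<phi> * (\<beta> y * \<gamma> (pred y)) = d y" if y: "y < N" for y
  proof (cases y)
    case 0
    \<comment> \<open>Here the shift wraps around: \<open>N - 1\<close> is odd, so the partner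
      factor is the conjugate of the last partial product, which is 1.\<close>
    have "odd (N - 1)" using even_N N0 by simp
    then have "\<gamma> (pred 0) = cnj (p (N - 1))" by (simp only: \<gamma>_def pred_def if_True if_False refl)
    then have "\<gamma> (pred 0) = 1" unfolding pN by simp
    moreover have "\<beta> 0 = d 0 * cnj \<phi>" by (simp add: \<beta>_def p_def)
    ultimately show ?thesis using 0 \<phi>1 by (simp add: algebra_simps)
  next
    case (Suc z)
    then have "z < N" using y by simp
    \<comment> \<open>One of the two factors is \<open>p y\<close> and the other the conjugate of
      its predecessor; the parity of \<open>y\<close> decides which is which, and the product
      telescopes to a single normalised phase.\<close>
    have "\<beta> y * \<gamma> (pred y) = d y * cnj \<phi> * (p z * cnj (p z))"
    proof (cases "even y")
      case True
      then show ?thesis using Suc by (simp add: \<beta>_def \<gamma>_def pred_def pSuc)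
    next
      case False
      then show ?thesis using Suc by (simp add: \<beta>_def \<gamma>_def pred_def pSuc)
    qed
    then show ?thesis using p1[OF \<open>z < N\<close>] \<phi>1 by (simp add: algebra_simps)
  qed
  let ?M = "\<lambda>D. mat_blockdiag K N (\<lambda>x. if x = 1 then D else 1\<^sub>m N)"
  have r1: "realizable 6 (?M (mat_diag N \<beta>))" by (rule realizable_antisymmetric[of \<beta>]) (use \<beta> in auto)
  have r2: "realizable 6 (?M (mat_diag N (\<lambda>y. \<gamma> (pred y))))"
  proof -
    have "mat_blockdiag K N (\<lambda>x. S * (if x = 1 then mat_diag N \<gamma> else 1\<^sub>m N) * mat_adjoint S) =
        ?M (mat_diag N (\<lambda>y. \<gamma> (pred y)))"
      by (rule mat_blockdiag_cong) (use S conjS in auto)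
    moreover have "realizable 6 (?M (mat_diag N \<gamma>))"
      by (rule realizable_antisymmetric[of \<gamma>]) (use \<gamma> in auto)
    ultimately show ?thesis using realizable_conj_B[OF S, of "\<lambda>x. if x = 1 then mat_diag N \<gamma> else 1\<^sub>m N" 6] by simp
  qed
  \<comment> \<open>A scalar on one level is a diagonal unitary of \<open>A\<close> and needs no
    straddling gate.\<close>
  have r3: "realizable 0 (?M (mat_diag N (\<lambda>_. \<phi>)))"
  proof -
    have "mat_diag K (\<lambda>x. if x = 1 then \<phi> else 1) \<in> unitary_group K"
      by (rule mat_diag_unitary) (simp add: cmod\<phi>)
    from realizable_A[OF this] have "realizable 0
        (mat_blockdiag K N (\<lambda>x. mat_diag N (\<lambda>_. if x = 1 then \<phi> else 1)))"
      by (simp only: mat_kron_diag_one)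
    moreover have "mat_blockdiag K N (\<lambda>x. mat_diag N (\<lambda>_. if x = 1 then \<phi> else 1)) = ?M (mat_diag N (\<lambda>_. \<phi>))"
      by (rule mat_blockdiag_cong) simp
    ultimately show ?thesis by simp
  qed
  have "?M (mat_diag N (\<lambda>_. \<phi>)) * (?M (mat_diag N \<beta>) * ?M (mat_diag N (\<lambda>y. \<gamma> (pred y)))) = ?M (mat_diag N d)"
  proof -
    have "mat_diag N (\<lambda>y. \<phi> * (\<beta> y * \<gamma> (pred y))) = mat_diag N d" by (rule mat_diag_cong) (rule prod)
    then show ?thesis by (subst mat_blockdiag_mult, simp, simp, subst mat_blockdiag_mult)
      (auto intro!: mat_blockdiag_cong)
  qed
  moreover have "realizable (0 + (6 + 6))
      (?M (mat_diag N (\<lambda>_. \<phi>)) * (?M (mat_diag N \<beta>) * ?M (mat_diag N (\<lambda>y. \<gamma> (pred y)))))"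
    by (intro realizable_mult r1 r2 r3)
  ultimately show ?thesis by simp
qed

text \<open>Passing to an eigenbasis of \<open>V\<close> is conjugation by a unitary of
  \<open>B\<close>, which is free and has no effect on levels where the operator is the identity.
  What remains is a diagonal on one level, and a permutation of \<open>A\<close> makes this level 1.
  The cost 12 is that of two antisymmetric diagonals with 6 gates each.\<close>

lemma realizable_level:
  assumes V: "V \<in> unitary_group N" and a: "a < K"
  shows "realizable 12 (mat_blockdiag K N (\<lambda>x. if x = a then V else 1\<^sub>m N))"
proof -
  obtain W d where W: "W \<in> unitary_group N" and Vd: "V = W * mat_diag N d * mat_adjoint W"
    and d: "\<And>i. i < N \<Longrightarrow> cmod (d i) = 1" using unitary_diagonalizable[OF V] by blast
  have "realizable 12 (mat_blockdiag K N (\<lambda>x. W * (if x = 1 then mat_diag N d else 1\<^sub>m N) * mat_adjoint W))"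
    by (rule realizable_conj_B[OF W _ realizable_diag[of d]]) (use d in auto)
  moreover have "mat_blockdiag K N (\<lambda>x. W * (if x = 1 then mat_diag N d else 1\<^sub>m N) * mat_adjoint W) =
      mat_blockdiag K N (\<lambda>x. if Transposition.transpose a 1 x = a then V else 1\<^sub>m N)"
    by (rule mat_blockdiag_cong) (use W Vd in \<open>auto simp: Transposition.transpose_def\<close>)
  ultimately have "realizable 12 (mat_blockdiag K N (\<lambda>x. if Transposition.transpose a 1 x = a then V else 1\<^sub>m N))"
    by simp
  moreover have "bij_betw (Transposition.transpose a 1) {..<K} {..<K}"
    using K_ge_2 a by (intro bij_betw_transpose) auto
  ultimately show ?thesis
    using V by - (rule realizable_conj_perm[of "Transposition.transpose a 1"], auto)
qed

lemma realizable_levels: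
  assumes "finite S" "S \<subseteq> {..<K}" and F: "\<And>x. x \<in> S \<Longrightarrow> F x \<in> unitary_group N"
  shows "realizable (12 * card S) (mat_blockdiag K N (\<lambda>x. if x \<in> S then F x else 1\<^sub>m N))"
  using assms
proof (induction S rule: finite_induct)
  case empty
  then show ?case using realizable_one by (simp add: mat_blockdiag_one)
next
  case (insert a S)
  have "realizable (12 + 12 * card S) (mat_blockdiag K N (\<lambda>x. if x = a then F a else 1\<^sub>m N) *
      mat_blockdiag K N (\<lambda>x. if x \<in> S then F x else 1\<^sub>m N))"
    using insert by (intro realizable_mult[of 12] realizable_level) auto
  moreover have "mat_blockdiag K N (\<lambda>x. if x = a then F a else 1\<^sub>m N) *
      mat_blockdiag K N (\<lambda>x. if x \<in> S then F x else 1\<^sub>m N) =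
      mat_blockdiag K N (\<lambda>x. if x \<in> insert a S then F x else 1\<^sub>m N)"
    using insert.hyps insert.prems(2)
    by (subst mat_blockdiag_mult) (auto intro!: mat_blockdiag_cong
      simp: left_mult_one_mat[of _ N N] right_mult_one_mat[of _ N N])
  ultimately show ?case using insert.hyps by simp
qed

end

section \<open>Recursive synthesis from the cosine-sine decomposition\<close>

lemma mat_blocks_eqI:
  assumes M: "M \<in> carrier_mat (K * N) (K * N)"
    and eq: "\<And>x x' y y'. x < K \<Longrightarrow> x' < K \<Longrightarrow> y < N \<Longrightarrow> y' < N \<Longrightarrow>
      M $$ (x * N + y, x' * N + y') = f x x' y y'"
  shows "M = mat_blocks K N f"
proof (rule eq_matI)
  fix i j assume "i < dim_row (mat_blocks K N f)" "j < dim_col (mat_blocks K N f)"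
  then have "i < K * N" "j < K * N" by (auto simp: mat_blocks_def)
  then show "M $$ (i, j) = mat_blocks K N f $$ (i, j)"
    using eq[of "i div N" "j div N" "i mod N" "j mod N"]
    by (simp add: mat_blocks_def div_less_mod_less)
qed (use M in \<open>auto simp: mat_blocks_def\<close>)

lemma block_index_le_iff:
  assumes "y < (N :: nat)"
  shows "a * N \<le> x * N + y \<longleftrightarrow> a \<le> x"
  using less_eq_div_iff_mult_less_eq[of N a "x * N + y"] assms by simp

lemma block_index_less_iff:
  assumes "y < (N :: nat)"
  shows "x * N + y < a * N \<longleftrightarrow> x < a"
  using block_index_le_iff[OF assms, of a x] by linarith

lemma block_index_eq_iff:
  assumes "y < (N :: nat)" "y' < N"
  shows "x * N + y = x' * N + y' \<longleftrightarrow> x = x' \<and> y = y'"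
proof
  assume eq: "x * N + y = x' * N + y'"
  have "(x * N + y) div N = x" "(x * N + y) mod N = y" "(x' * N + y') div N = x'" "(x' * N + y') mod N = y'"
    using assms by auto
  then show "x = x' \<and> y = y'" using eq by metis
qed simp

lemma block_index_less:
  assumes "x < K" "y < (N :: nat)"
  shows "x * N + y < K * N"
  using block_index_less_iff[OF assms(2)] assms(1) by simp

lemma block_index_diff:
  assumes "a \<le> x"
  shows "x * N + y - a * N = (x - a) * N + (y :: nat)"
  using assms mult_le_mono1[of a x N] by (simp add: diff_mult_distrib)

lemma mat_embed_blocks_index:
  assumes "x < K" "x' < K" "y < N" "y' < N" "a + b \<le> K"
  shows "mat_embed (K * N) (a * N) (b * N) V $$ (x * N + y, x' * N + y') =
    (if a \<le> x \<and> x < a + b \<and> a \<le> x' \<and> x' < a + b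
     then V $$ ((x - a) * N + y, (x' - a) * N + y')
     else if x = x' \<and> y = y' then 1 else 0)"
  using assms block_index_less[OF assms(1,3)] block_index_less[OF assms(2,4)]
  by (simp add: mat_embed_def block_index_le_iff block_index_less_iff block_index_eq_iff
      block_index_diff flip: add_mult_distrib)

lemma mat_embed_level:
  assumes "V \<in> carrier_mat N N" "a < K"
  shows "mat_embed (K * N) (a * N) N V = mat_blockdiag K N (\<lambda>x. if x = a then V else 1\<^sub>m N)"
  unfolding mat_blockdiag_def
proof (rule mat_blocks_eqI)
  fix x x' y y' assume *: "x < K" "x' < K" "y < N" "y' < N"
  show "mat_embed (K * N) (a * N) N V $$ (x * N + y, x' * N + y') =
      (if x = x' then (if x = a then V else 1\<^sub>m N) $$ (y, y') else 0)"
    using mat_embed_blocks_index[OF *, of a 1 V] assms * by auto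
qed simp

lemma mat_embed_diag:
  assumes "a + b \<le> K"
  shows "mat_embed (K * N) (a * N) (b * N) (mat_diag (b * N) e) =
    mat_blockdiag K N (\<lambda>x. if x \<in> {a..<a + b} then mat_diag N (\<lambda>y. e ((x - a) * N + y)) else 1\<^sub>m N)"
  unfolding mat_blockdiag_def
proof (rule mat_blocks_eqI)
  fix x x' y y' assume *: "x < K" "x' < K" "y < N" "y' < N"
  have "mat_diag (b * N) e $$ ((x - a) * N + y, (x' - a) * N + y') =
      (if x - a = x' - a \<and> y = y' then e ((x - a) * N + y) else 0)"
    if "x < a + b" "x' < a + b" "a \<le> x" "a \<le> x'"
    using that * block_index_less[of "x - a" b y N] block_index_less[of "x' - a" b y' N]
    by (auto simp: mat_diag_def block_index_eq_iff)
  then show "mat_embed (K * N) (a * N) (b * N) (mat_diag (b * N) e) $$ (x * N + y, x' * N + y') =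
      (if x = x' then (if x \<in> {a..<a + b} then mat_diag N (\<lambda>y. e ((x - a) * N + y)) else 1\<^sub>m N) $$ (y, y') else 0)"
    using mat_embed_blocks_index[OF * assms, of "mat_diag (b * N) e"] *
    by (auto simp: mat_diag_def[of N])
qed simp

text \<open>The planes pair the level \<open>x\<close> with the level \<open>x + b\<close> at the
  same position inside the block, so the change of basis ignores \<open>B\<close>. This is what
  makes the conjugation of the rotations free.\<close>

lemma mat_embed_balance:
  assumes "a + (b + b) \<le> K"
  shows "mat_embed (K * N) (a * N) (b * N + b * N) (mat_balance (b * N)) =
    mat_kron K N (mat_embed K a (b + b) (mat_balance b)) (1\<^sub>m N)"
  unfolding mat_kron_def
proof (rule mat_blocks_eqI)
  fix x x' y y' assume *: "x < K" "x' < K" "y < N" "y' < N"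
  have s: "z * N + w + b * N = (z + b) * N + w" for z w by (simp add: algebra_simps)
  have "mat_balance (b * N) $$ ((x - a) * N + y, (x' - a) * N + y') =
      mat_balance b $$ (x - a, x' - a) * 1\<^sub>m N $$ (y, y')"
    if "x < a + (b + b)" "x' < a + (b + b)" "a \<le> x" "a \<le> x'"
    using that * block_index_less[of "x - a" "b + b" y N] block_index_less[of "x' - a" "b + b" y' N]
    by (auto simp: mat_balance_def s block_index_eq_iff add_mult_distrib[symmetric])
  moreover have "(b + b) * N = b * N + b * N" by (simp add: add_mult_distrib)
  ultimately show "mat_embed (K * N) (a * N) (b * N + b * N) (mat_balance (b * N)) $$ (x * N + y, x' * N + y') =
      mat_embed K a (b + b) (mat_balance b) $$ (x, x') * 1\<^sub>m N $$ (y, y')"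
    using mat_embed_blocks_index[OF * assms, of "mat_balance (b * N)"] *
    by (auto simp: mat_embed_def[of K])
qed simp

lemma mat_kron_adjoint_one:
  assumes "V \<in> carrier_mat K K"
  shows "mat_adjoint (mat_kron K N V (1\<^sub>m N)) = mat_kron K N (mat_adjoint V) (1\<^sub>m N)"
proof (rule eq_matI)
  fix i j assume "i < dim_row (mat_kron K N (mat_adjoint V) (1\<^sub>m N))"
    "j < dim_col (mat_kron K N (mat_adjoint V) (1\<^sub>m N))"
  then have "i < K * N" "j < K * N" by (auto simp: mat_kron_def mat_blocks_def)
  then show "mat_adjoint (mat_kron K N V (1\<^sub>m N)) $$ (i, j) = mat_kron K N (mat_adjoint V) (1\<^sub>m N) $$ (i, j)"
    using assms by (auto simp: mat_kron_def mat_blocks_def div_less_mod_less)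
qed (auto simp: mat_kron_def mat_blocks_def)

context bipartition
begin

text \<open>In the common eigenbasis, which is reached by a unitary of \<open>A\<close>, the
  rotation is diagonal and touches \<open>b + b\<close> levels, each at a cost of 12.\<close>

lemma realizable_rotation:
  assumes cs: "\<And>i. i < b * N \<Longrightarrow> (c i)\<^sup>2 + (s i)\<^sup>2 = 1" and b: "a + (b + b) \<le> K"
  shows "realizable (12 * (b + b)) (mat_embed (K * N) (a * N) (b * N + b * N) (mat_rotation (b * N) c s))"
proof -
  let ?m = "b * N"
  define e where "e i = (if i < ?m then Complex (c i) (- s i) else Complex (c (i - ?m)) (s (i - ?m)))" for i
  have e: "cmod (e i) = 1" if "i < (b + b) * N" for i
  proof -
    have "i - ?m < ?m" if "\<not> i < ?m" using that \<open>i < (b + b) * N\<close> by (simp add: add_mult_distrib)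
    then show ?thesis using cs[of i] cs[of "i - ?m"] by (auto simp: e_def cmod_def)
  qed
  let ?P = "mat_embed K a (b + b) (mat_balance b)"
  have P: "?P \<in> unitary_group K" by (rule mat_embed_unitary[OF mat_balance_unitary b])
  have le: "a * N + (?m + ?m) \<le> K * N" using mult_le_mono1[OF b, of N] by (simp add: add_mult_distrib)
  have "mat_embed (K * N) (a * N) (?m + ?m) (mat_rotation ?m c s) =
      mat_embed (K * N) (a * N) (?m + ?m) (mat_balance ?m) *
      mat_embed (K * N) (a * N) (?m + ?m) (mat_diag (?m + ?m) e) *
      mat_adjoint (mat_embed (K * N) (a * N) (?m + ?m) (mat_balance ?m))"
    unfolding mat_rotation_diagonalize e_def
    using le by (simp add: mat_embed_mult mat_embed_adjoint[of _ "?m + ?m", symmetric])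
  also have "mat_embed (K * N) (a * N) (?m + ?m) (mat_balance ?m) = mat_kron K N ?P (1\<^sub>m N)"
    by (rule mat_embed_balance[OF b])
  also have "mat_adjoint (mat_kron K N ?P (1\<^sub>m N)) = mat_kron K N (mat_adjoint ?P) (1\<^sub>m N)"
    by (rule mat_kron_adjoint_one) simp
  also have "mat_embed (K * N) (a * N) (?m + ?m) (mat_diag (?m + ?m) e) =
      mat_blockdiag K N (\<lambda>x. if x \<in> {a..<a + (b + b)} then mat_diag N (\<lambda>y. e ((x - a) * N + y)) else 1\<^sub>m N)"
    using mat_embed_diag[OF b, of N e] by (simp only: add_mult_distrib)
  finally have eq: "mat_embed (K * N) (a * N) (?m + ?m) (mat_rotation ?m c s) = mat_kron K N ?P (1\<^sub>m N) *
     mat_blockdiag K N (\<lambda>x. if x \<in> {a..<a + (b + b)} then mat_diag N (\<lambda>y. e ((x - a) * N + y)) else 1\<^sub>m N) *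
     mat_kron K N (mat_adjoint ?P) (1\<^sub>m N)" .
  have "realizable (12 * card {a..<a + (b + b)})
     (mat_blockdiag K N (\<lambda>x. if x \<in> {a..<a + (b + b)} then mat_diag N (\<lambda>y. e ((x - a) * N + y)) else 1\<^sub>m N))"
  proof (rule realizable_levels)
    fix x assume "x \<in> {a..<a + (b + b)}"
    then have "x - a < b + b" by auto
    then show "mat_diag N (\<lambda>y. e ((x - a) * N + y)) \<in> unitary_group N"
      by (intro mat_diag_unitary e block_index_less)
  qed (use b in auto)
  then show ?thesis unfolding eq using realizable_conj_A[OF P] by simp
qed

text \<open>A block of \<open>2 * b\<close> levels splits into four blocks of \<open>b\<close>
  levels and a rotation of cost \<open>24 * b\<close>. With cost 12 for one level, the recursion T(2
  b) = 4 T(b) + 24 b is solved by 24 b^2 - 12 b. The summand \<open>12 * 2 ^ k\<close> is this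
  lower-order term, without which the induction would not close.\<close>

lemma realizable_embed:
  assumes "V \<in> unitary_group (2 ^ k * N)" "a + 2 ^ k \<le> K"
  shows "\<exists>s. realizable s (mat_embed (K * N) (a * N) (2 ^ k * N) V) \<and> s + 12 * 2 ^ k \<le> 24 * 4 ^ k"
  using assms
proof (induction k arbitrary: a V)
  case 0
  then have "V \<in> unitary_group N" "a < K" by auto
  then have "realizable 12 (mat_embed (K * N) (a * N) N V)"
    using realizable_level mat_embed_level[of V N a K] by simp
  then show ?case by (intro exI[of _ 12]) simp
next
  case (Suc k)
  define b :: nat where "b = 2 ^ k"
  let ?m = "b * N"
  have V: "V \<in> unitary_group (?m + ?m)" using Suc.prems(1) by (simp add: b_def mult_2 add_mult_distrib)
  obtain W1 W2 R V' c s where W: "W1 \<in> unitary_group ?m" "W2 \<in> unitary_group ?m"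
      "R \<in> unitary_group ?m" "V' \<in> unitary_group ?m"
    and cs: "\<And>i. i < ?m \<Longrightarrow> (c i)\<^sup>2 + (s i)\<^sup>2 = (1 :: real)"
    and Veq: "V = mat_dsum W1 W2 * (mat_rotation ?m c s * mat_dsum R V')"
    using cosine_sine_decomposition[OF V] by blast
  have [simp]: "W1 \<in> carrier_mat ?m ?m" "W2 \<in> carrier_mat ?m ?m" "R \<in> carrier_mat ?m ?m" "V' \<in> carrier_mat ?m ?m"
    using W by auto
  have b: "a + (b + b) \<le> K" using Suc.prems(2) by (simp add: b_def)
  have le: "a * N + (?m + ?m) \<le> K * N" using mult_le_mono1[OF b, of N] by (simp add: add_mult_distrib)
  have off: "a * N + ?m = (a + b) * N" by (simp add: add_mult_distrib)
  let ?e = "\<lambda>a. mat_embed (K * N) (a * N) ?m"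
  have eq: "mat_embed (K * N) (a * N) (?m + ?m) V = (?e a W1 * ?e (a + b) W2) *
      (mat_embed (K * N) (a * N) (?m + ?m) (mat_rotation ?m c s) * (?e a R * ?e (a + b) V'))"
    unfolding Veq using le by (simp add: mat_embed_mult mat_embed_dsum off)
  have "\<exists>s. realizable s (?e x X) \<and> s + 12 * b \<le> 24 * 4 ^ k" if "X \<in> unitary_group ?m" "x + b \<le> K" for x X
    using Suc.IH[of X x] that by (simp add: b_def)
  note IH = this
  have "a + b \<le> K" "(a + b) + b \<le> K" using b by auto
  then obtain s1 s2 s3 s4 where r: "realizable s1 (?e a W1)" "realizable s2 (?e (a + b) W2)"
      "realizable s3 (?e a R)" "realizable s4 (?e (a + b) V')"
    and bound: "s1 + 12 * b \<le> 24 * 4 ^ k" "s2 + 12 * b \<le> 24 * 4 ^ k" "s3 + 12 * b \<le> 24 * 4 ^ k" "s4 + 12 * b \<le> 24 * 4 ^ k"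
    using IH W by metis
  have "2 ^ Suc k * N = ?m + ?m" by (simp add: b_def)
  moreover have "realizable ((s1 + s2) + (12 * (b + b) + (s3 + s4)))
      (mat_embed (K * N) (a * N) (?m + ?m) V)"
    unfolding eq by (intro realizable_mult r realizable_rotation[OF cs b])
  ultimately have "realizable ((s1 + s2) + (12 * (b + b) + (s3 + s4)))
      (mat_embed (K * N) (a * N) (2 ^ Suc k * N) V)"
    by (simp only:)
  moreover have "(s1 + s2) + (12 * (b + b) + (s3 + s4)) + 12 * 2 ^ Suc k \<le> 24 * 4 ^ Suc k"
    using bound by (simp add: b_def)
  ultimately show ?case by blast
qed

theorem binding_complexity_le:
  assumes U: "U \<in> unitary_group (2 ^ n)"
  shows "binding_complexity n A B U \<le> enat (24 * 4 ^ card A)"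
proof -
  obtain M where M: "M \<in> unitary_group (2 ^ n)" and MU: "reindex M = U"
    using mat_reindex_surj[OF joint_index_bij U] by blast
  obtain s where s: "realizable s (mat_embed (K * N) (0 * N) (K * N) M)" "s + 12 * K \<le> 24 * 4 ^ card A"
    using realizable_embed[of M "card A" 0] M by (auto simp: K_N)
  have "mat_embed (K * N) (0 * N) (K * N) M = M"
    using carrier_matD[OF unitary_carrier[OF M]] by (intro eq_matI) (auto simp: mat_embed_def K_N)
  then obtain gs where "implements n A B gs U" "straddling_count gs \<le> s"
    using s(1) MU unfolding realizable_def by auto
  then have "binding_complexity n A B U \<le> enat s"
    unfolding binding_complexity_def by (intro INF_lower2[of gs]) auto
  also have "enat s \<le> enat (24 * 4 ^ card A)" using s(2) by simp
  finally show ?thesis .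
qed

end

section \<open>Box dimension\<close>

text \<open>An upper bound on the box-counting dimension; \<open>near e x y\<close> stands for \<open>dist x y \<le> e\<close>.\<close>

definition box_dim_le :: "(real \<Rightarrow> 'a \<Rightarrow> 'a \<Rightarrow> bool) \<Rightarrow> 'a set \<Rightarrow> nat \<Rightarrow> bool" where
  "box_dim_le near X m \<longleftrightarrow> (\<exists>C::nat. \<forall>q::nat. 1 \<le> q \<longrightarrow> (\<exists>P. finite P \<and> card P \<le> C * q ^ m \<and>
     X \<subseteq> \<Union>P \<and> (\<forall>p\<in>P. \<forall>x\<in>p \<inter> X. \<forall>y\<in>p \<inter> X. near (1 / real q) x y)))"

lemma box_dim_leE:
  assumes "box_dim_le near X m"
  obtains C :: nat where "\<And>q. 1 \<le> q \<Longrightarrow> \<exists>P. finite P \<and> card P \<le> C * q ^ m \<and>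
     X \<subseteq> \<Union>P \<and> (\<forall>p\<in>P. \<forall>x\<in>p \<inter> X. \<forall>y\<in>p \<inter> X. near (1 / real q) x y)"
  using assms unfolding box_dim_le_def by blast

lemma box_dim_le_subset: "box_dim_le near X m \<Longrightarrow> Y \<subseteq> X \<Longrightarrow> box_dim_le near Y m"
  unfolding box_dim_le_def by (meson Int_mono order_refl subset_iff order_trans)

lemma box_dim_le_mono:
  assumes "box_dim_le near X m" "m \<le> m'"
  shows "box_dim_le near X m'"
proof -
  obtain C where C: "\<And>q. 1 \<le> q \<Longrightarrow> \<exists>P. finite P \<and> card P \<le> C * q ^ m \<and>
     X \<subseteq> \<Union>P \<and> (\<forall>p\<in>P. \<forall>x\<in>p \<inter> X. \<forall>y\<in>p \<inter> X. near (1 / real q) x y)"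
    using box_dim_leE[OF assms(1)] by blast
  have "C * q ^ m \<le> C * q ^ m'" if "1 \<le> q" for q
    using that assms(2) by (simp add: power_increasing)
  then show ?thesis
    unfolding box_dim_le_def using C by (meson order_trans)
qed

lemma box_dim_le_Un:
  assumes "box_dim_le near X m" "box_dim_le near Y m"
  shows "box_dim_le near (X \<union> Y) m"
proof -
  obtain C where C: "\<And>q. 1 \<le> q \<Longrightarrow> \<exists>P. finite P \<and> card P \<le> C * q ^ m \<and>
     X \<subseteq> \<Union>P \<and> (\<forall>p\<in>P. \<forall>x\<in>p \<inter> X. \<forall>y\<in>p \<inter> X. near (1 / real q) x y)"
    using box_dim_leE[OF assms(1)] by blast
  obtain C' where C': "\<And>q. 1 \<le> q \<Longrightarrow> \<exists>P. finite P \<and> card P \<le> C' * q ^ m \<and>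
     Y \<subseteq> \<Union>P \<and> (\<forall>p\<in>P. \<forall>x\<in>p \<inter> Y. \<forall>y\<in>p \<inter> Y. near (1 / real q) x y)"
    using box_dim_leE[OF assms(2)] by blast
  show ?thesis
    unfolding box_dim_le_def
  proof (intro exI[of _ "C + C'"] allI impI)
    fix q :: nat assume q: "1 \<le> q"
    obtain P where P: "finite P" "card P \<le> C * q ^ m" "X \<subseteq> \<Union>P"
      "\<forall>p\<in>P. \<forall>x\<in>p \<inter> X. \<forall>y\<in>p \<inter> X. near (1 / real q) x y" using C[OF q] by blast
    obtain P' where P': "finite P'" "card P' \<le> C' * q ^ m" "Y \<subseteq> \<Union>P'"
      "\<forall>p\<in>P'. \<forall>x\<in>p \<inter> Y. \<forall>y\<in>p \<inter> Y. near (1 / real q) x y" using C'[OF q] by blast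
    let ?P = "(\<lambda>p. p \<inter> X) ` P \<union> (\<lambda>p. p \<inter> Y) ` P'"
    have "card ?P \<le> card ((\<lambda>p. p \<inter> X) ` P) + card ((\<lambda>p. p \<inter> Y) ` P')" by (rule card_Un_le)
    also have "\<dots> \<le> card P + card P'" using P(1) P'(1) by (intro add_mono card_image_le)
    also have "\<dots> \<le> (C + C') * q ^ m" using P(2) P'(2) by (simp add: add_mult_distrib)
    finally have "card ?P \<le> (C + C') * q ^ m" .
    moreover have "X \<subseteq> \<Union>((\<lambda>p. p \<inter> X) ` P)" "Y \<subseteq> \<Union>((\<lambda>p. p \<inter> Y) ` P')"
      using P(3) P'(3) by auto
    then have XY: "X \<union> Y \<subseteq> \<Union>?P" unfolding Union_Un_distrib by (rule Un_mono)
    moreover have "\<forall>p\<in>?P. \<forall>x\<in>p \<inter> (X \<union> Y). \<forall>y\<in>p \<inter> (X \<union> Y). near (1 / real q) x y"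
      using P(4) P'(4) by auto
    ultimately show "\<exists>P. finite P \<and> card P \<le> (C + C') * q ^ m \<and> X \<union> Y \<subseteq> \<Union>P \<and>
        (\<forall>p\<in>P. \<forall>x\<in>p \<inter> (X \<union> Y). \<forall>y\<in>p \<inter> (X \<union> Y). near (1 / real q) x y)"
      using P(1) P'(1) XY by (intro exI[of _ ?P]) simp
  qed
qed

text \<open>A finite choice has dimension 0, even with equality as the nearness relation. It will
  account for the choice of a pair of qubits.\<close>

lemma box_dim_le_finite:
  assumes "finite X"
  shows "box_dim_le (\<lambda>_. (=)) X 0"
  unfolding box_dim_le_def
proof (intro exI[of _ "card X"] allI impI exI[of _ "(\<lambda>x. {x}) ` X"])
qed (use assms in \<open>auto intro: card_image_le\<close>)

text \<open>Both factors are covered at the scale \<open>1 / (L * q)\<close>, and the images of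
  products of cells cover \<open>Z\<close>. The numbers of cells multiply, so the exponents add, and
  \<open>L\<close> goes into the constant. With three nearness relations the parameters may differ
  in type and size from the result.\<close>

lemma box_dim_le_image2:
  assumes X: "box_dim_le near1 X m1" and Y: "box_dim_le near2 Y m2"
    and L: "1 \<le> (L :: nat)"
    and Z: "\<And>z. z \<in> Z \<Longrightarrow> \<exists>x\<in>X. \<exists>y\<in>Y. z = g x y"
    and lip: "\<And>e x x' y y'. 0 < e \<Longrightarrow> x \<in> X \<Longrightarrow> x' \<in> X \<Longrightarrow> y \<in> Y \<Longrightarrow> y' \<in> Y \<Longrightarrow>
      near1 e x x' \<Longrightarrow> near2 e y y' \<Longrightarrow> near3 (real L * e) (g x y) (g x' y')"
  shows "box_dim_le near3 Z (m1 + m2)"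
proof -
  obtain C where C: "\<And>q. 1 \<le> q \<Longrightarrow> \<exists>P. finite P \<and> card P \<le> C * q ^ m1 \<and>
     X \<subseteq> \<Union>P \<and> (\<forall>p\<in>P. \<forall>x\<in>p \<inter> X. \<forall>y\<in>p \<inter> X. near1 (1 / real q) x y)"
    using box_dim_leE[OF X] by blast
  obtain C' where C': "\<And>q. 1 \<le> q \<Longrightarrow> \<exists>P. finite P \<and> card P \<le> C' * q ^ m2 \<and>
     Y \<subseteq> \<Union>P \<and> (\<forall>p\<in>P. \<forall>x\<in>p \<inter> Y. \<forall>y\<in>p \<inter> Y. near2 (1 / real q) x y)"
    using box_dim_leE[OF Y] by blast
  show ?thesis
    unfolding box_dim_le_def
  proof (intro exI[of _ "C * C' * L ^ (m1 + m2)"] allI impI)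
    fix q :: nat assume q: "1 \<le> q"
    then have Lq: "1 \<le> L * q" using L by (simp add: Suc_le_eq)
    obtain P where P: "finite P" "card P \<le> C * (L * q) ^ m1" "X \<subseteq> \<Union>P"
      "\<And>p x y. p \<in> P \<Longrightarrow> x \<in> p \<inter> X \<Longrightarrow> y \<in> p \<inter> X \<Longrightarrow> near1 (1 / real (L * q)) x y"
      using C[OF Lq] by blast
    obtain P' where P': "finite P'" "card P' \<le> C' * (L * q) ^ m2" "Y \<subseteq> \<Union>P'"
      "\<And>p x y. p \<in> P' \<Longrightarrow> x \<in> p \<inter> Y \<Longrightarrow> y \<in> p \<inter> Y \<Longrightarrow> near2 (1 / real (L * q)) x y"
      using C'[OF Lq] by blast
    let ?h = "\<lambda>(p, p'). (\<lambda>(x, y). g x y) ` ((p \<inter> X) \<times> (p' \<inter> Y))"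
    let ?P = "?h ` (P \<times> P')"
    have "card ?P \<le> card P * card P'"
      using card_image_le[of "P \<times> P'" ?h] P(1) P'(1) by (simp add: card_cartesian_product)
    also have "\<dots> \<le> (C * (L * q) ^ m1) * (C' * (L * q) ^ m2)" by (rule mult_le_mono[OF P(2) P'(2)])
    also have "\<dots> = C * C' * L ^ (m1 + m2) * q ^ (m1 + m2)"
      by (simp add: power_add power_mult_distrib)
    finally have "card ?P \<le> C * C' * L ^ (m1 + m2) * q ^ (m1 + m2)" .
    moreover have "Z \<subseteq> \<Union>?P"
    proof
      fix z assume "z \<in> Z"
      then obtain x y where "x \<in> X" "y \<in> Y" "z = g x y" using Z by blast
      moreover from this obtain p p' where "p \<in> P" "x \<in> p" "p' \<in> P'" "y \<in> p'" using P(3) P'(3) by blast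
      ultimately have "z \<in> ?h (p, p')" "(p, p') \<in> P \<times> P'" by auto
      then show "z \<in> \<Union>?P" by blast
    qed
    moreover have "\<forall>p\<in>?P. \<forall>x\<in>p \<inter> Z. \<forall>y\<in>p \<inter> Z. near3 (1 / real q) x y"
    proof (intro ballI)
      fix r z z' assume "r \<in> ?P" "z \<in> r \<inter> Z" "z' \<in> r \<inter> Z"
      then obtain p p' x y x' y' where *: "p \<in> P" "p' \<in> P'" "z = g x y" "z' = g x' y'"
        "x \<in> p \<inter> X" "x' \<in> p \<inter> X" "y \<in> p' \<inter> Y" "y' \<in> p' \<inter> Y" by auto
      have "near3 (real L * (1 / real (L * q))) z z'"
        unfolding *(3,4) using * P(4) P'(4) Lq by (intro lip) auto
      moreover have "real L * (1 / real (L * q)) = 1 / real q" using L by simp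
      ultimately show "near3 (1 / real q) z z'" by simp
    qed
    ultimately show "\<exists>P. finite P \<and> card P \<le> C * C' * L ^ (m1 + m2) * q ^ (m1 + m2) \<and> Z \<subseteq> \<Union>P \<and>
        (\<forall>p\<in>P. \<forall>x\<in>p \<inter> Z. \<forall>y\<in>p \<inter> Z. near3 (1 / real q) x y)"
      using P(1) P'(1) by (intro exI[of _ ?P]) simp
  qed
qed

text \<open>Separated points lie in different cells, so M^D is at most C (L M)^m for every positive
  M. For D > m this fails as soon as M exceeds C L^m.\<close>

lemma box_dim_le_separated:
  assumes X: "box_dim_le near X m" and L: "1 \<le> (L :: nat)"
    and sep: "\<And>M::nat. 1 \<le> M \<Longrightarrow> \<exists>(S :: 'b set) f. finite S \<and> M ^ D \<le> card S \<and> f ` S \<subseteq> X \<and>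
      (\<forall>v\<in>S. \<forall>w\<in>S. near (1 / real (L * M)) (f v) (f w) \<longrightarrow> v = w)"
  shows "D \<le> m"
proof (rule ccontr)
  assume "\<not> D \<le> m"
  then have Dm: "Suc m \<le> D" by simp
  obtain C where C: "\<And>q. 1 \<le> q \<Longrightarrow> \<exists>P. finite P \<and> card P \<le> C * q ^ m \<and>
     X \<subseteq> \<Union>P \<and> (\<forall>p\<in>P. \<forall>x\<in>p \<inter> X. \<forall>y\<in>p \<inter> X. near (1 / real q) x y)"
    using box_dim_leE[OF X] by blast
  define M where "M = C * L ^ m + 1"
  have M: "1 \<le> M" by (simp add: M_def)
  then have LM: "1 \<le> L * M" using L by (simp add: Suc_le_eq)
  obtain S :: "'b set" and f where Sf: "finite S \<and> M ^ D \<le> card S \<and> f ` S \<subseteq> X \<and>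
      (\<forall>v\<in>S. \<forall>w\<in>S. near (1 / real (L * M)) (f v) (f w) \<longrightarrow> v = w)"
    by atomize_elim (rule sep[OF M])
  then have S: "finite S" "M ^ D \<le> card S" "f ` S \<subseteq> X"
    "\<And>v w. v \<in> S \<Longrightarrow> w \<in> S \<Longrightarrow> near (1 / real (L * M)) (f v) (f w) \<Longrightarrow> v = w"
    by simp_all
  obtain P where P: "finite P" "card P \<le> C * (L * M) ^ m" "X \<subseteq> \<Union>P"
      "\<And>p x y. p \<in> P \<Longrightarrow> x \<in> p \<inter> X \<Longrightarrow> y \<in> p \<inter> X \<Longrightarrow> near (1 / real (L * M)) x y"
    using C[OF LM] by blast
  have "\<forall>v\<in>S. \<exists>p\<in>P. f v \<in> p" using S(3) P(3) by blast
  then obtain c where c: "\<And>v. v \<in> S \<Longrightarrow> c v \<in> P \<and> f v \<in> c v" by metis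
  have "inj_on c S"
  proof (rule inj_onI)
    fix v w assume "v \<in> S" "w \<in> S" "c v = c w"
    then have "near (1 / real (L * M)) (f v) (f w)"
      using c[of v] c[of w] S(3) by (intro P(4)[of "c v"]) auto
    then show "v = w" using S(4) \<open>v \<in> S\<close> \<open>w \<in> S\<close> by blast
  qed
  then have "card S \<le> card P" using c P(1) by (intro card_inj_on_le[of c]) auto
  have "M * M ^ m = M ^ Suc m" by simp
  also have "\<dots> \<le> M ^ D" using M Dm by (intro power_increasing) auto
  also have "\<dots> \<le> C * (L * M) ^ m" using S(2) \<open>card S \<le> card P\<close> P(2) by linarith
  also have "\<dots> = C * L ^ m * M ^ m" by (simp add: power_mult_distrib)
  finally have "M \<le> C * L ^ m" using M by simp
  then show False by (simp add: M_def)
qed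

section \<open>Box dimension of sets of matrices\<close>

definition mat_near :: "nat \<Rightarrow> real \<Rightarrow> complex mat \<Rightarrow> complex mat \<Rightarrow> bool" where
  "mat_near d e X Y \<longleftrightarrow> (\<forall>i<d. \<forall>j<d. cmod (X $$ (i, j) - Y $$ (i, j)) \<le> e)"

lemma floor_eq_imp_near:
  fixes x y :: real
  assumes "\<lfloor>r * x\<rfloor> = \<lfloor>r * y\<rfloor>" "0 < r"
  shows "\<bar>x - y\<bar> \<le> 1 / r"
proof -
  have "\<bar>r * x - r * y\<bar> < 1" using assms(1) by linarith
  then have "r * \<bar>x - y\<bar> < 1" using assms(2) by (simp add: abs_mult right_diff_distrib[symmetric])
  then show ?thesis using assms(2) by (simp add: field_simps)
qed

text \<open>Entries of a unitary have modulus at most 1, so rounding their real and imaginary parts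
  to a grid gives finitely many cells. The exponent counts the real parameters of an arbitrary
  complex matrix. This is twice the dimension of the unitary group, a factor that affects only the
  constant of the final bound.\<close>

lemma box_dim_le_unitary: "box_dim_le (mat_near d) (unitary_group d) (2 * d\<^sup>2)"
  unfolding box_dim_le_def
proof (intro exI[of _ "25 ^ d\<^sup>2"] allI impI)
  fix q :: nat assume q: "1 \<le> q"
  \<comment> \<open>The mesh is half of the target scale, since the errors of the real and the
    imaginary part add up.\<close>
  define r where "r = 2 * real q"
  have r: "0 < r" using q by (simp add: r_def)
  let ?I = "{..<d} \<times> {..<d}" and ?R = "{- (2 * int q)..2 * int q}"
  define code where "code X = restrict (\<lambda>(i, j). (\<lfloor>r * Re (X $$ (i, j))\<rfloor>, \<lfloor>r * Im (X $$ (i, j))\<rfloor>)) ?I"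
    for X :: "complex mat"
  define S where "S = (?I \<rightarrow>\<^sub>E ?R \<times> ?R)"
  let ?P = "(\<lambda>v. {X. code X = v}) ` S"
  have S: "finite S" unfolding S_def by (intro finite_PiE) auto
  have "card ?P \<le> card S" by (rule card_image_le[OF S])
  \<comment> \<open>Each real coordinate takes \<open>4 * q + 1\<close> values, at most
    \<open>5 * q\<close>; two coordinates per entry give the 25.\<close>
  also have "card S = ((4 * q + 1) * (4 * q + 1)) ^ d\<^sup>2"
    unfolding S_def by (simp add: card_PiE card_cartesian_product power2_eq_square nat_add_distrib nat_mult_distrib)
  also have "\<dots> \<le> ((5 * q) * (5 * q)) ^ d\<^sup>2"
    using q by (intro power_mono mult_le_mono) auto
  also have "\<dots> = 25 ^ d\<^sup>2 * q ^ (2 * d\<^sup>2)"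
    by (simp add: power_mult_distrib power_mult power2_eq_square)
  finally have "card ?P \<le> 25 ^ d\<^sup>2 * q ^ (2 * d\<^sup>2)" .
  moreover have "unitary_group d \<subseteq> \<Union>?P"
  proof
    fix U assume U: "U \<in> unitary_group d"
    have fl: "\<lfloor>r * x\<rfloor> \<in> ?R" if "\<bar>x\<bar> \<le> 1" for x
    proof -
      have "\<bar>r * x\<bar> \<le> r" using that r by (simp add: abs_mult mult_left_le)
      then have "- r \<le> r * x" "r * x \<le> r" by linarith+
      then show ?thesis unfolding r_def
        by (auto simp: le_floor_iff floor_le_iff)
    qed
    have "code U \<in> S"
      unfolding S_def code_def
    proof (rule restrict_PiE_iff[THEN iffD2], intro ballI)
      fix ij assume "ij \<in> ?I"
      then obtain i j where ij: "ij = (i, j)" "i < d" "j < d" by auto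
      have "\<bar>Re (U $$ (i, j))\<bar> \<le> 1" "\<bar>Im (U $$ (i, j))\<bar> \<le> 1"
        using unitary_entry_le_1[OF U ij(2,3)] abs_Re_le_cmod[of "U $$ (i, j)"] abs_Im_le_cmod[of "U $$ (i, j)"]
        by linarith+
      then show "(case ij of (i, j) \<Rightarrow> (\<lfloor>r * Re (U $$ (i, j))\<rfloor>, \<lfloor>r * Im (U $$ (i, j))\<rfloor>)) \<in> ?R \<times> ?R"
        unfolding ij by (simp only: prod.case mem_Times_iff fst_conv snd_conv fl simp_thms)
    qed
    then show "U \<in> \<Union>?P" by blast
  qed
  moreover have "mat_near d (1 / real q) X Y" if "code X = code Y" for X Y
    unfolding mat_near_def
  proof (intro allI impI)
    fix i j assume "i < d" "j < d"
    then have "\<lfloor>r * Re (X $$ (i, j))\<rfloor> = \<lfloor>r * Re (Y $$ (i, j))\<rfloor>" "\<lfloor>r * Im (X $$ (i, j))\<rfloor> = \<lfloor>r * Im (Y $$ (i, j))\<rfloor>"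
      using fun_cong[OF that, of "(i, j)"] by (auto simp: code_def)
    then have "\<bar>Re (X $$ (i, j) - Y $$ (i, j))\<bar> \<le> 1 / r" "\<bar>Im (X $$ (i, j) - Y $$ (i, j))\<bar> \<le> 1 / r"
      using floor_eq_imp_near[OF _ r] by auto
    then have "cmod (X $$ (i, j) - Y $$ (i, j)) \<le> 1 / r + 1 / r"
      using cmod_le[of "X $$ (i, j) - Y $$ (i, j)"] by linarith
    then show "cmod (X $$ (i, j) - Y $$ (i, j)) \<le> 1 / real q" by (simp add: r_def)
  qed
  ultimately show "\<exists>P. finite P \<and> card P \<le> 25 ^ d\<^sup>2 * q ^ (2 * d\<^sup>2) \<and> unitary_group d \<subseteq> \<Union>P \<and>
      (\<forall>p\<in>P. \<forall>x\<in>p \<inter> unitary_group d. \<forall>y\<in>p \<inter> unitary_group d. mat_near d (1 / real q) x y)"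
    using S by (intro exI[of _ ?P]) auto
qed

lemma cmod_mult_diff_le:
  assumes "cmod (a - a') \<le> e" "cmod (b - b') \<le> e" "cmod a' \<le> s" "cmod b \<le> t"
  shows "cmod (a * b - a' * b') \<le> (s + t) * e"
proof -
  have e: "0 \<le> e" using assms(1) norm_ge_zero order_trans by blast
  have "a * b - a' * b' = (a - a') * b + a' * (b - b')" by (simp add: algebra_simps)
  then have "cmod (a * b - a' * b') \<le> cmod (a - a') * cmod b + cmod a' * cmod (b - b')"
    by (metis norm_mult norm_triangle_ineq)
  also have "\<dots> \<le> e * t + s * e"
    using assms e order_trans[OF norm_ge_zero assms(3)] by (intro add_mono mult_mono) auto
  finally show ?thesis by (simp add: algebra_simps)
qed

text \<open>Multiplication is Lipschitz only on bounded sets, so an entry bound has to travel with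
  the dimension through the products of gates.\<close>

definition bounded_box_dim_le :: "nat \<Rightarrow> complex mat set \<Rightarrow> nat \<Rightarrow> bool" where
  "bounded_box_dim_le d X m \<longleftrightarrow> X \<subseteq> carrier_mat d d \<and>
     (\<exists>b::nat. \<forall>x\<in>X. \<forall>i<d. \<forall>j<d. cmod (x $$ (i, j)) \<le> real b) \<and> box_dim_le (mat_near d) X m"

lemma bounded_box_dim_le_Un:
  assumes "bounded_box_dim_le d X m" "bounded_box_dim_le d Y m"
  shows "bounded_box_dim_le d (X \<union> Y) m"
proof -
  obtain b c :: nat where bc: "\<forall>x\<in>X. \<forall>i<d. \<forall>j<d. cmod (x $$ (i, j)) \<le> real b"
    "\<forall>x\<in>Y. \<forall>i<d. \<forall>j<d. cmod (x $$ (i, j)) \<le> real c"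
    using assms unfolding bounded_box_dim_le_def by blast
  have "\<forall>x\<in>X \<union> Y. \<forall>i<d. \<forall>j<d. cmod (x $$ (i, j)) \<le> real (b + c)"
  proof (intro ballI allI impI)
    fix x i j assume "x \<in> X \<union> Y" "i < d" "j < d"
    then have "cmod (x $$ (i, j)) \<le> real b \<or> cmod (x $$ (i, j)) \<le> real c" using bc by blast
    then show "cmod (x $$ (i, j)) \<le> real (b + c)" by auto
  qed
  then show ?thesis
    using assms box_dim_le_Un[of "mat_near d" X m Y] unfolding bounded_box_dim_le_def by blast
qed

lemma bounded_box_dim_le_mono:
  "bounded_box_dim_le d X m \<Longrightarrow> m \<le> m' \<Longrightarrow> bounded_box_dim_le d X m'"
  unfolding bounded_box_dim_le_def using box_dim_le_mono by blast

lemma bounded_box_dim_le_mult: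
  assumes X: "bounded_box_dim_le d X m1" and Y: "bounded_box_dim_le d Y m2"
  shows "bounded_box_dim_le d {x * y | x y. x \<in> X \<and> y \<in> Y} (m1 + m2)"
proof -
  obtain b c :: nat where b: "\<And>x i j. x \<in> X \<Longrightarrow> i < d \<Longrightarrow> j < d \<Longrightarrow> cmod (x $$ (i, j)) \<le> real b"
    and c: "\<And>x i j. x \<in> Y \<Longrightarrow> i < d \<Longrightarrow> j < d \<Longrightarrow> cmod (x $$ (i, j)) \<le> real c"
    using X Y unfolding bounded_box_dim_le_def by metis
  have Xc: "x \<in> carrier_mat d d" if "x \<in> X" for x using that X unfolding bounded_box_dim_le_def by blast
  have Yc: "x \<in> carrier_mat d d" if "x \<in> Y" for x using that Y unfolding bounded_box_dim_le_def by blast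
  have "box_dim_le (mat_near d) {x * y | x y. x \<in> X \<and> y \<in> Y} (m1 + m2)"
  \<comment> \<open>An entry of a product is a sum of \<open>d\<close> terms whose factors are
    bounded by \<open>b\<close> and \<open>c\<close>; the added 1 keeps the constant positive also
    when \<open>d * (b + c)\<close> is 0.\<close>
  proof (rule box_dim_le_image2[where g = "(*)" and L = "d * (b + c) + 1"])
    show "box_dim_le (mat_near d) X m1" "box_dim_le (mat_near d) Y m2"
      using X Y unfolding bounded_box_dim_le_def by blast+
    fix e x x' y y' assume *: "0 < (e :: real)" "x \<in> X" "x' \<in> X" "y \<in> Y" "y' \<in> Y"
      "mat_near d e x x'" "mat_near d e y y'"
    show "mat_near d (real (d * (b + c) + 1) * e) (x * y) (x' * y')"
      unfolding mat_near_def
    proof (intro allI impI)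
      fix i j assume ij: "i < d" "j < d"
      have "(x * y) $$ (i, j) - (x' * y') $$ (i, j) =
          (\<Sum>l<d. x $$ (i, l) * y $$ (l, j) - x' $$ (i, l) * y' $$ (l, j))"
        using ij * Xc Yc by (simp add: mult_mat_index[of _ d d _ d] sum_subtractf del: index_mult_mat)
      also have "cmod \<dots> \<le> (\<Sum>l<d. (real b + real c) * e)"
        using * ij b c by (intro sum_norm_le cmod_mult_diff_le) (auto simp: mat_near_def)
      also have "\<dots> \<le> real (d * (b + c) + 1) * e" using * by (simp add: algebra_simps)
      finally show "cmod ((x * y) $$ (i, j) - (x' * y') $$ (i, j)) \<le> real (d * (b + c) + 1) * e" .
    qed
  qed auto
  moreover have "\<forall>z\<in>{x * y | x y. x \<in> X \<and> y \<in> Y}. \<forall>i<d. \<forall>j<d. cmod (z $$ (i, j)) \<le> real (d * (b * c))"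
  proof (intro ballI allI impI)
    fix z i j assume "z \<in> {x * y | x y. x \<in> X \<and> y \<in> Y}" and ij: "i < d" "j < d"
    then obtain x y where xy: "x \<in> X" "y \<in> Y" "z = x * y" by blast
    have "z $$ (i, j) = (\<Sum>l<d. x $$ (i, l) * y $$ (l, j))"
      unfolding xy(3) using ij xy Xc Yc by (intro mult_mat_index) auto
    also have "cmod \<dots> \<le> (\<Sum>l<d. real b * real c)"
      using ij b c xy by (intro sum_norm_le) (auto simp: norm_mult intro!: mult_mono)
    finally show "cmod (z $$ (i, j)) \<le> real (d * (b * c))" by simp
  qed
  moreover have "{x * y | x y. x \<in> X \<and> y \<in> Y} \<subseteq> carrier_mat d d" using Xc Yc by auto
  ultimately show ?thesis unfolding bounded_box_dim_le_def by blast
qed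

section \<open>The lower bound\<close>

text \<open>For a kernel vector \<open>v\<close> of 1 + S, the form of \<open>S\<close> at
  \<open>v\<close> is minus the squared norm of \<open>v\<close>, hence real. Skewness makes the
  same value purely imaginary, so \<open>v\<close> vanishes.\<close>

lemma skew_one_plus_invertible:
  fixes S :: "complex mat"
  assumes S: "S \<in> carrier_mat d d" and skew: "\<And>i j. i < d \<Longrightarrow> j < d \<Longrightarrow> S $$ (j, i) = - cnj (S $$ (i, j))"
  obtains W where "W \<in> carrier_mat d d" "(1\<^sub>m d + S) * W = 1\<^sub>m d" "W * (1\<^sub>m d + S) = 1\<^sub>m d"
proof -
  have P: "1\<^sub>m d + S \<in> carrier_mat d d" using S by simp
  have "det (1\<^sub>m d + S) \<noteq> 0"
  proof
    assume "det (1\<^sub>m d + S) = 0"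
    then obtain v where v: "v \<in> carrier_vec d" "v \<noteq> 0\<^sub>v d" "(1\<^sub>m d + S) *\<^sub>v v = 0\<^sub>v d"
      using det_0_iff_vec_prod_zero[OF P] by blast
    have Sv: "(\<Sum>j<d. S $$ (i, j) * v $ j) = - (v $ i)" if "i < d" for i
    proof -
      have "0 = ((1\<^sub>m d + S) *\<^sub>v v) $ i" using v that by simp
      also have "\<dots> = (\<Sum>j<d. (1\<^sub>m d + S) $$ (i, j) * v $ j)"
        using S v(1) that by (auto simp: scalar_prod_def lessThan_atLeast0 intro!: sum.cong)
      also have "\<dots> = (\<Sum>j<d. (if j = i then v $ j else 0) + S $$ (i, j) * v $ j)"
        using S that by (intro sum.cong) (auto simp: algebra_simps)
      also have "\<dots> = v $ i + (\<Sum>j<d. S $$ (i, j) * v $ j)" using that by (simp add: sum.distrib)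
      finally show ?thesis by (metis add.commute add_eq_0_iff)
    qed
    define q where "q = (\<Sum>i<d. \<Sum>j<d. cnj (v $ i) * S $$ (i, j) * v $ j)"
    have "q = (\<Sum>i<d. cnj (v $ i) * (\<Sum>j<d. S $$ (i, j) * v $ j))"
      unfolding q_def by (simp add: sum_distrib_left mult.assoc)
    also have "\<dots> = (\<Sum>i<d. - of_real ((cmod (v $ i))\<^sup>2))"
      by (intro sum.cong) (simp_all add: Sv complex_norm_square del: of_real_power)
    also have "\<dots> = - of_real (\<Sum>i<d. (cmod (v $ i))\<^sup>2)" by (simp add: sum_negf)
    finally have q: "q = - of_real (\<Sum>i<d. (cmod (v $ i))\<^sup>2)" .
    have "cnj q = (\<Sum>i<d. \<Sum>j<d. v $ i * cnj (S $$ (i, j)) * cnj (v $ j))" by (simp add: q_def)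
    also have "\<dots> = (\<Sum>i<d. \<Sum>j<d. - (cnj (v $ j) * S $$ (j, i) * v $ i))"
    proof (intro sum.cong refl)
      fix i j assume "i \<in> {..<d}" "j \<in> {..<d}"
      then show "v $ i * cnj (S $$ (i, j)) * cnj (v $ j) = - (cnj (v $ j) * S $$ (j, i) * v $ i)"
        using skew[of i j] by simp
    qed
    also have "\<dots> = - (\<Sum>i<d. \<Sum>j<d. cnj (v $ j) * S $$ (j, i) * v $ i)" by (simp add: sum_negf)
    also have "(\<Sum>i<d. \<Sum>j<d. cnj (v $ j) * S $$ (j, i) * v $ i) = q"
      unfolding q_def by (rule sum.swap)
    finally have "cnj q = - q" .
    then have "of_real (\<Sum>i<d. (cmod (v $ i))\<^sup>2) = (0 :: complex)" unfolding q by simp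
    then have "(\<Sum>i<d. (cmod (v $ i))\<^sup>2) = 0" by (simp only: of_real_eq_0_iff)
    then have "v $ i = 0" if "i < d" for i
      using that by (subst (asm) sum_nonneg_eq_0_iff) auto
    then have "v = 0\<^sub>v d" using v(1) by (intro eq_vecI) auto
    then show False using v(2) by simp
  qed
  from det_non_zero_imp_unit[OF P this, of "()"] show ?thesis
    using that by (auto simp: Units_def ring_mat_def)
qed

text \<open>The Cayley transform: the inverse of 1 + S times 1 - S. It is characterised by equations
  without inverses, on both sides, because the separation estimate multiplies one unitary from the
  left and the other from the right.\<close>

lemma cayley_exists:
  fixes S :: "complex mat"
  assumes S: "S \<in> carrier_mat d d" and skew: "\<And>i j. i < d \<Longrightarrow> j < d \<Longrightarrow> S $$ (j, i) = - cnj (S $$ (i, j))"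
  obtains U where "U \<in> unitary_group d" "(1\<^sub>m d + S) * U = 1\<^sub>m d - S" "U * (1\<^sub>m d + S) = 1\<^sub>m d - S"
proof -
  define P where "P = 1\<^sub>m d + S"
  define Q where "Q = 1\<^sub>m d - S"
  have c [simp]: "P \<in> carrier_mat d d" "Q \<in> carrier_mat d d" using S by (auto simp: P_def Q_def)
  obtain W where W [simp]: "W \<in> carrier_mat d d" and PW: "P * W = 1\<^sub>m d" "W * P = 1\<^sub>m d"
    unfolding P_def using skew_one_plus_invertible[OF S skew] by blast
  have Padj: "mat_adjoint P = Q"
  proof (rule eq_matI)
    fix i j assume "i < dim_row Q" "j < dim_col Q"
    then have "i < d" "j < d" using carrier_matD[OF c(2)] by auto
    then show "mat_adjoint P $$ (i, j) = Q $$ (i, j)"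
      using carrier_matD[OF S] skew[of i j] by (auto simp: P_def Q_def)
  qed (use carrier_matD[OF S] in \<open>simp_all add: P_def Q_def\<close>)
  then have Qadj: "mat_adjoint Q = P" by (metis mat_adjoint_adjoint)
  have PQ: "P * Q = Q * P"
  proof -
    have "P * Q = P * 1\<^sub>m d - P * S" unfolding Q_def by (rule mult_minus_distrib_mat[OF c(1) _ S]) simp
    also have "P * S = 1\<^sub>m d * S + S * S" unfolding P_def by (rule add_mult_distrib_mat[OF _ S S]) simp
    finally have 1: "P * Q = P - (S + S * S)" using S by simp
    have "Q * P = 1\<^sub>m d * P - S * P" unfolding Q_def by (rule minus_mult_distrib_mat[OF _ S c(1)]) simp
    also have "S * P = S * 1\<^sub>m d + S * S" unfolding P_def by (rule mult_add_distrib_mat[OF S _ S]) simp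
    finally have "Q * P = P - (S + S * S)" using S by simp
    with 1 show ?thesis by simp
  qed
  have QW: "Q * W = W * Q"
  proof -
    have "Q * W = W * P * (Q * W)" using PW by simp
    also have "\<dots> = W * (P * Q) * W" by (simp add: assoc_mult_mat[of _ d d _ d _ d])
    also have "\<dots> = W * Q * (P * W)" unfolding PQ by (simp add: assoc_mult_mat[of _ d d _ d _ d])
    finally show ?thesis using PW by simp
  qed
  have Wadj: "mat_adjoint W * Q = 1\<^sub>m d"
    using arg_cong[OF PW(1), of mat_adjoint] by (simp add: mat_adjoint_mult[of _ d d _ d] Padj)
  have "mat_adjoint (W * Q) * (W * Q) = P * mat_adjoint W * (Q * W)"
    by (simp add: mat_adjoint_mult[of _ d d _ d] Qadj QW)
  also have "\<dots> = P * (mat_adjoint W * Q) * W" by (simp add: assoc_mult_mat[of _ d d _ d _ d])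
  also have "\<dots> = 1\<^sub>m d" using PW by (simp add: Wadj)
  finally have "W * Q \<in> unitary_group d" by (intro unitary_groupI) simp_all
  moreover have "P * (W * Q) = Q" by (rule mult_cancel_inverse_mid[OF _ _ _ PW(1)]) simp_all
  moreover have "W * Q * P = Q"
  proof -
    have "W * Q * P = W * P * Q" by (simp add: assoc_mult_mat[of _ d d _ d _ d] PQ)
    then show ?thesis using PW by simp
  qed
  ultimately show ?thesis using that unfolding P_def Q_def by blast
qed

text \<open>Multiplying the difference of \<open>U\<close> and \<open>U'\<close> by 1 + S from the
  left and by 1 + S' from the right gives exactly twice the difference of \<open>S'\<close> and
  \<open>S\<close>, because the products \<open>S * S'\<close> cancel. So the inverse of the Cayley
  transform is Lipschitz on this bounded set, and no norm of an inverse matrix has to be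
  estimated.\<close>

lemma cayley_separated:
  assumes S: "S \<in> carrier_mat d d" "\<And>i j. i < d \<Longrightarrow> j < d \<Longrightarrow> cmod ((1\<^sub>m d + S) $$ (i, j)) \<le> 1"
    and S': "S' \<in> carrier_mat d d" "\<And>i j. i < d \<Longrightarrow> j < d \<Longrightarrow> cmod ((1\<^sub>m d + S') $$ (i, j)) \<le> 1"
    and U: "U \<in> carrier_mat d d" "(1\<^sub>m d + S) * U = 1\<^sub>m d - S"
    and U': "U' \<in> carrier_mat d d" "U' * (1\<^sub>m d + S') = 1\<^sub>m d - S'"
    and near: "mat_near d e U U'" and ij: "i < d" "j < d"
  shows "2 * cmod (S $$ (i, j) - S' $$ (i, j)) \<le> (real d)\<^sup>2 * e"
proof -
  define P where "P = 1\<^sub>m d + S"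
  define P' where "P' = 1\<^sub>m d + S'"
  have c [simp]: "P \<in> carrier_mat d d" "P' \<in> carrier_mat d d" "U \<in> carrier_mat d d" "U' \<in> carrier_mat d d"
    using S S' U U' by (auto simp: P_def P'_def)
  have "P * U * P' = (1\<^sub>m d - S) * P'" using U by (simp add: P_def)
  also have "\<dots> = P' - S * P'"
    using minus_mult_distrib_mat[OF one_carrier_mat S(1) c(2)] by simp
  also have "S * P' = S + S * S'"
    unfolding P'_def using mult_add_distrib_mat[OF S(1) one_carrier_mat S'(1)] S(1) by simp
  finally have 1: "P * U * P' = P' - (S + S * S')" .
  have "P * (U' * P') = P * (1\<^sub>m d - S')" using U' by (simp add: P'_def)
  also have "\<dots> = P - P * S'"
    using mult_minus_distrib_mat[OF c(1) one_carrier_mat S'(1)] by simp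
  also have "P * S' = S' + S * S'"
    unfolding P_def using add_mult_distrib_mat[OF one_carrier_mat S(1) S'(1)] S'(1) by simp
  finally have 2: "P * U' * P' = P - (S' + S * S')"
    by (simp add: assoc_mult_mat[of _ d d _ d _ d])
  have SS: "S * S' \<in> carrier_mat d d" using S(1) S'(1) by simp
  have prod: "(P * X * P') $$ (i, j) = (\<Sum>l<d. \<Sum>k<d. P $$ (i, k) * X $$ (k, l) * P' $$ (l, j))"
    if X: "X \<in> carrier_mat d d" for X
    using ij X by (simp add: mult_mat_index[of _ d d _ d] sum_distrib_right del: index_mult_mat)
  have "2 * (S' $$ (i, j) - S $$ (i, j)) = (P * U * P') $$ (i, j) - (P * U' * P') $$ (i, j)"
    unfolding 1 2 using ij S(1) S'(1) carrier_matD[OF SS]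
    by (simp add: P_def P'_def algebra_simps del: index_mult_mat)
  also have "\<dots> = (\<Sum>l<d. \<Sum>k<d. P $$ (i, k) * (U $$ (k, l) - U' $$ (k, l)) * P' $$ (l, j))"
    by (simp add: prod sum_subtractf[symmetric] algebra_simps)
  also have "cmod \<dots> \<le> (\<Sum>l<d. \<Sum>k<d. e)"
  proof (intro sum_norm_le)
    fix k l assume kl: "l \<in> {..<d}" "k \<in> {..<d}"
    then have n: "cmod (U $$ (k, l) - U' $$ (k, l)) \<le> e" using near by (simp add: mat_near_def)
    have "cmod (P $$ (i, k)) * cmod (U $$ (k, l) - U' $$ (k, l)) * cmod (P' $$ (l, j)) \<le> 1 * e * 1"
      using kl ij S(2)[of i k] S'(2)[of l j] n order_trans[OF norm_ge_zero n]
      unfolding P_def P'_def by (intro mult_mono) auto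
    then show "cmod (P $$ (i, k) * (U $$ (k, l) - U' $$ (k, l)) * P' $$ (l, j)) \<le> e"
      by (simp add: norm_mult)
  qed
  also have "\<dots> = (real d)\<^sup>2 * e" by (simp add: power2_eq_square)
  finally show ?thesis
    using norm_minus_commute[of "S $$ (i, j)" "S' $$ (i, j)"] by (simp only: norm_mult norm_numeral)
qed

text \<open>The parameters are real skew-symmetric matrices whose entries above the diagonal range
  over 0, 1 / M, ..., (M - 1) / M. Their Cayley transforms stay apart on the scale 1 / M, up to a
  factor depending on \<open>d\<close> only. Real entries give about half of the dimension d^2 of
  the unitary group, which is enough for the order of growth.\<close>

lemma box_dim_unitary_ge:
  assumes "box_dim_le (mat_near d) (unitary_group d) m"
  shows "d * (d - 1) div 2 \<le> m"
proof (rule box_dim_le_separated[OF assms, of "d\<^sup>2 + 1"])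
  fix M :: nat assume M: "1 \<le> M"
  define I where "I = (SIGMA j:{..<d}. {..<j})"
  have I: "finite I" "card I = d * (d - 1) div 2"
  proof -
    show "finite I" by (simp add: I_def)
    have "card I = (\<Sum>j<d. j)" by (simp add: I_def)
    also have "\<dots> = d * (d - 1) div 2"
      by (cases d) (simp_all add: lessThan_Suc_atMost atMost_atLeast0 gauss_sum_nat mult.commute)
    finally show "card I = d * (d - 1) div 2" .
  qed
  define V where "V = (I \<rightarrow>\<^sub>E {..<M})"
  define sk where "sk v = mat d d (\<lambda>(i, j). if i < j then complex_of_real (real (v (j, i)) / real M)
    else if j < i then - complex_of_real (real (v (i, j)) / real M) else 0)" for v :: "nat \<times> nat \<Rightarrow> nat"
  have sk: "sk v \<in> carrier_mat d d" "\<And>i j. i < d \<Longrightarrow> j < d \<Longrightarrow> sk v $$ (j, i) = - cnj (sk v $$ (i, j))" for v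
    by (auto simp: sk_def)
  have le1: "cmod ((1\<^sub>m d + sk v) $$ (i, j)) \<le> 1" if "v \<in> V" "i < d" "j < d" for v i j
  proof -
    have "real (v (a, b)) / real M \<le> 1" if "a < d" "b < a" for a b
    proof -
      have "(a, b) \<in> I" using that by (simp add: I_def)
      then have "v (a, b) < M" using \<open>v \<in> V\<close> unfolding V_def by (meson PiE_mem lessThan_iff)
      then show ?thesis by simp
    qed
    then show ?thesis using that by (auto simp: sk_def norm_divide)
  qed
  have "\<forall>v. \<exists>U. U \<in> unitary_group d \<and> (1\<^sub>m d + sk v) * U = 1\<^sub>m d - sk v \<and> U * (1\<^sub>m d + sk v) = 1\<^sub>m d - sk v"
  proof
    fix v
    obtain U where "U \<in> unitary_group d" "(1\<^sub>m d + sk v) * U = 1\<^sub>m d - sk v" "U * (1\<^sub>m d + sk v) = 1\<^sub>m d - sk v"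
      by (rule cayley_exists[OF sk(1)[of v] sk(2)[of _ _ v]])
    then show "\<exists>U. U \<in> unitary_group d \<and> (1\<^sub>m d + sk v) * U = 1\<^sub>m d - sk v \<and> U * (1\<^sub>m d + sk v) = 1\<^sub>m d - sk v"
      by blast
  qed
  then obtain f where f: "\<And>v. f v \<in> unitary_group d" "\<And>v. (1\<^sub>m d + sk v) * f v = 1\<^sub>m d - sk v"
    "\<And>v. f v * (1\<^sub>m d + sk v) = 1\<^sub>m d - sk v" by metis
  have inj: "v = w" if v: "v \<in> V" and w: "w \<in> V"
    and near: "mat_near d (1 / real ((d\<^sup>2 + 1) * M)) (f v) (f w)" for v w
  proof (rule PiE_ext[OF v[unfolded V_def] w[unfolded V_def]])
    fix x assume "x \<in> I"
    then obtain i j where x: "x = (i, j)" "j < i" "i < d" by (auto simp: I_def)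
    have "2 * cmod (sk v $$ (j, i) - sk w $$ (j, i)) \<le> (real d)\<^sup>2 * (1 / real ((d\<^sup>2 + 1) * M))"
      using x by (intro cayley_separated[OF sk(1) le1[OF v] sk(1) le1[OF w] _ f(2) _ f(3) near]) (auto simp: f)
    \<comment> \<open>The scale \<open>1 / ((d\<^sup>2 + 1) * M)\<close> absorbs the
      \<open>d\<^sup>2\<close> of the separation estimate, so that twice the distance of two
      integers drops below 1; the added 1 also covers d = 0.\<close>
    also have "\<dots> < 1 / real M"
    proof -
      have "(real d)\<^sup>2 / real (d\<^sup>2 + 1) < 1" by (simp add: divide_less_eq_1 add_pos_nonneg)
      then have "(real d)\<^sup>2 / real (d\<^sup>2 + 1) * (1 / real M) < 1 * (1 / real M)"
        by (rule mult_strict_right_mono) (use M in simp)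
      moreover have "a * (1 / real (b * M)) = a / real b * (1 / real M)" for a b by simp
      ultimately show ?thesis by (simp only: mult_1)
    qed
    also have "cmod (sk v $$ (j, i) - sk w $$ (j, i)) = \<bar>real (v x) - real (w x)\<bar> / real M"
    proof -
      have "sk v $$ (j, i) - sk w $$ (j, i) = of_real ((real (v x) - real (w x)) / real M)"
        using x by (simp add: sk_def diff_divide_distrib)
      then show ?thesis by (simp only: norm_of_real) (simp add: abs_divide)
    qed
    finally have "2 * \<bar>real (v x) - real (w x)\<bar> < 1" using M by (simp add: field_simps)
    moreover have "1 \<le> \<bar>real a - real b\<bar>" if "a \<noteq> b" for a b
      using that by (cases "a < b") (auto simp: abs_if)
    ultimately show "v x = w x" by force
  qed
  have "finite V" unfolding V_def using I(1) by (intro finite_PiE) auto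
  moreover have "card V = M ^ (d * (d - 1) div 2)"
    unfolding V_def using I by (simp add: card_PiE)
  moreover have "f ` V \<subseteq> unitary_group d" using f(1) by blast
  ultimately show "\<exists>(S :: (nat \<times> nat \<Rightarrow> nat) set) f. finite S \<and> M ^ (d * (d - 1) div 2) \<le> card S \<and> f ` S \<subseteq> unitary_group d \<and>
      (\<forall>v\<in>S. \<forall>w\<in>S. mat_near d (1 / real ((d\<^sup>2 + 1) * M)) (f v) (f w) \<longrightarrow> v = w)"
    using inj by (intro exI[of _ V] exI[of _ f]) simp
qed simp

section \<open>Normal form of circuits and the count of parameters\<close>

context bipartition
begin

definition local_unitaries :: "complex mat set" where
  "local_unitaries = {reindex (mat_kron K N V W) | V W. V \<in> unitary_group K \<and> W \<in> unitary_group N}"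

definition straddling_unitaries :: "complex mat set" where
  "straddling_unitaries =
     {apply_on n [p, q] G | p q G. p \<in> A \<and> q \<in> B \<and> G \<in> special_unitary_group 4}"

text \<open>A normal form of the circuits with at most \<open>s\<close> straddling gates: before and
  after each straddling gate stands one tensor product of local unitaries. The union makes the
  family increasing in \<open>s\<close>, as circuits with fewer gates have to be covered
  too.\<close>

primrec layered :: "nat \<Rightarrow> complex mat set" where
  "layered 0 = local_unitaries"
| "layered (Suc s) =
     {x * y | x y. x \<in> local_unitaries \<and> y \<in> {g * t | g t. g \<in> straddling_unitaries \<and> t \<in> layered s}}
     \<union> layered s"

lemma local_unitaries_carrier: "x \<in> local_unitaries \<Longrightarrow> x \<in> carrier_mat (2 ^ n) (2 ^ n)"
  by (auto simp: local_unitaries_def)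

lemma straddling_unitaries_carrier: "x \<in> straddling_unitaries \<Longrightarrow> x \<in> carrier_mat (2 ^ n) (2 ^ n)"
  by (auto simp: straddling_unitaries_def apply_on_def)

lemma layered_carrier: "x \<in> layered s \<Longrightarrow> x \<in> carrier_mat (2 ^ n) (2 ^ n)"
  by (induction s arbitrary: x)
    (auto intro: mult_carrier_mat_square dest: local_unitaries_carrier straddling_unitaries_carrier)

lemma local_mult_local:
  assumes "l \<in> local_unitaries" "l' \<in> local_unitaries"
  shows "l * l' \<in> local_unitaries"
proof -
  obtain V W V' W' where *: "V \<in> unitary_group K" "W \<in> unitary_group N" "V' \<in> unitary_group K" "W' \<in> unitary_group N"
    "l = reindex (mat_kron K N V W)" "l' = reindex (mat_kron K N V' W')"
    using assms unfolding local_unitaries_def by blast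
  have "l * l' = reindex (mat_kron K N V W * mat_kron K N V' W')"
    unfolding * by (rule reindex_mult[symmetric]) (simp_all only: K_N[symmetric] mat_kron_carrier)
  also have "\<dots> = reindex (mat_kron K N (V * V') (W * W'))" using * by (simp add: mat_kron_mult)
  finally show ?thesis unfolding local_unitaries_def using * unitary_mult by blast
qed

lemma local_mult_layered:
  assumes l: "l \<in> local_unitaries" and y: "y \<in> layered s"
  shows "l * y \<in> layered s"
  using y
proof (induction s)
  case 0
  then show ?case using local_mult_local[OF l] by simp
next
  case (Suc s)
  then consider "y \<in> layered s" | x g t where "x \<in> local_unitaries" "g \<in> straddling_unitaries"
    "t \<in> layered s" "y = x * (g * t)" by auto
  then show ?case
  proof cases
    case 1
    then show ?thesis using Suc.IH by simp
  next
    case 2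
    then have "l * y = (l * x) * (g * t)"
      using l local_unitaries_carrier straddling_unitaries_carrier layered_carrier
      by (simp add: assoc_mult_mat[of _ "2 ^ n" "2 ^ n" _ "2 ^ n" _ "2 ^ n"])
    then show ?thesis using 2 local_mult_local[OF l 2(1)] by auto
  qed
qed

lemma apply_on_A_local: "V \<in> unitary_group K \<Longrightarrow> apply_on n (sorted_list_of_set A) V \<in> local_unitaries"
  unfolding local_unitaries_def apply_on_A using unitary_one by blast

lemma apply_on_B_local: "W \<in> unitary_group N \<Longrightarrow> apply_on n (sorted_list_of_set B) W \<in> local_unitaries"
  unfolding local_unitaries_def apply_on_B using unitary_one by blast

lemma one_local: "1\<^sub>m (2 ^ n) \<in> local_unitaries"
proof -
  have "1\<^sub>m (2 ^ n) = reindex (mat_kron K N (1\<^sub>m K) (1\<^sub>m N))"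
    unfolding mat_kron_one_one K_N by (rule mat_reindex_one[OF joint_index_bij, symmetric])
  then show ?thesis unfolding local_unitaries_def using unitary_one by blast
qed

lemma circuit_layered:
  assumes "\<forall>g\<in>set gs. valid_gate A B g"
  shows "circuit_operator n A B gs \<in> layered (straddling_count gs)"
  using assms
proof (induction gs)
  case Nil
  then show ?case using one_local by (simp add: straddling_count_def)
next
  case (Cons g gs)
  then have IH: "circuit_operator n A B gs \<in> layered (straddling_count gs)" by simp
  show ?case
  proof (cases g)
    case (Local_A V)
    then show ?thesis
      using Cons.prems local_mult_layered[OF apply_on_A_local IH] by (simp add: straddling_count_def)
  next
    case (Local_B W)
    then show ?thesis
      using Cons.prems local_mult_layered[OF apply_on_B_local IH] by (simp add: straddling_count_def)
  next
    case (Straddling p q G)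
    then have "apply_on n [p, q] G \<in> straddling_unitaries"
      using Cons.prems unfolding straddling_unitaries_def by auto
    \<comment> \<open>An identity is inserted as the local layer on the left, because the normal
      form begins with one.\<close>
    moreover have "circuit_operator n A B (g # gs) =
        1\<^sub>m (2 ^ n) * (apply_on n [p, q] G * circuit_operator n A B gs)"
      using Straddling circuit_operator_carrier[of "g # gs"] by simp
    moreover have "straddling_count (g # gs) = Suc (straddling_count gs)"
      using Straddling by (simp add: straddling_count_def)
    ultimately show ?thesis using IH one_local by auto
  qed
qed

lemma layered_mono: "s \<le> t \<Longrightarrow> layered s \<subseteq> layered t"
  by (induction t rule: dec_induct) auto

text \<open>A local unitary is determined by its two tensor factors, so the parameter counts of the
  two sides add, where those of a general unitary multiply. This gap is the source of the lower
  bound.\<close>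

lemma bounded_box_dim_local:
  "bounded_box_dim_le (2 ^ n) local_unitaries (2 * K\<^sup>2 + 2 * N\<^sup>2)"
proof -
  have e: "reindex (mat_kron K N V W) $$ (i, j) = V $$ (regA i, regA j) * W $$ (regB i, regB j)"
    if "i < 2 ^ n" "j < 2 ^ n" for V W i j
    using that joint_index_less by (simp add: mat_reindex_def mat_kron_def mat_blocks_def K_N)
  have "box_dim_le (mat_near (2 ^ n)) local_unitaries (2 * K\<^sup>2 + 2 * N\<^sup>2)"
  proof (rule box_dim_le_image2[where g = "\<lambda>V W. reindex (mat_kron K N V W)" and L = 2])
    show "box_dim_le (mat_near K) (unitary_group K) (2 * K\<^sup>2)"
      "box_dim_le (mat_near N) (unitary_group N) (2 * N\<^sup>2)" by (rule box_dim_le_unitary)+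
    fix e V V' W W' assume *: "0 < (e :: real)" "V \<in> unitary_group K" "V' \<in> unitary_group K"
      "W \<in> unitary_group N" "W' \<in> unitary_group N" "mat_near K e V V'" "mat_near N e W W'"
    show "mat_near (2 ^ n) (real 2 * e) (reindex (mat_kron K N V W)) (reindex (mat_kron K N V' W'))"
      unfolding mat_near_def
    proof (intro allI impI)
      fix i j :: nat assume ij: "i < 2 ^ n" "j < 2 ^ n"
      have "cmod (V $$ (regA i, regA j) * W $$ (regB i, regB j) - V' $$ (regA i, regA j) * W' $$ (regB i, regB j))
          \<le> (1 + 1) * e"
        using * regA_less regB_less
        by (intro cmod_mult_diff_le unitary_entry_le_1[of V' K] unitary_entry_le_1[of W N])
          (auto simp: mat_near_def)
      then show "cmod (reindex (mat_kron K N V W) $$ (i, j) - reindex (mat_kron K N V' W') $$ (i, j)) \<le> real 2 * e"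
        using ij by (simp add: e)
    qed
  qed (auto simp: local_unitaries_def)
  moreover have "\<forall>x\<in>local_unitaries. \<forall>i<2 ^ n. \<forall>j<2 ^ n. cmod (x $$ (i, j)) \<le> real 1"
  proof (intro ballI allI impI)
    fix x and i j :: nat assume "x \<in> local_unitaries" and ij: "i < 2 ^ n" "j < 2 ^ n"
    then obtain V W where VW: "V \<in> unitary_group K" "W \<in> unitary_group N" "x = reindex (mat_kron K N V W)"
      unfolding local_unitaries_def by blast
    have "cmod (V $$ (regA i, regA j)) * cmod (W $$ (regB i, regB j)) \<le> 1 * 1"
      using VW regA_less regB_less by (intro mult_mono unitary_entry_le_1) auto
    then show "cmod (x $$ (i, j)) \<le> real 1" unfolding VW(3) using ij by (simp add: e norm_mult)
  qed
  ultimately show ?thesis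
    unfolding bounded_box_dim_le_def using local_unitaries_carrier by blast
qed

text \<open>The pair of qubits is a finite choice and adds no dimension; the 32 are the
  \<open>2 * 4\<^sup>2\<close> real parameters of a complex matrix of size 4.\<close>

lemma bounded_box_dim_straddling: "bounded_box_dim_le (2 ^ n) straddling_unitaries 32"
proof -
  have sub: "subregister [p, q] i < 4" for p q i using subregister_less[of "[p, q]" i] by simp
  have S: "special_unitary_group 4 \<subseteq> unitary_group 4" by (auto simp: special_unitary_group_def)
  have "box_dim_le (mat_near (2 ^ n)) straddling_unitaries (0 + 2 * 4\<^sup>2)"
  proof (rule box_dim_le_image2[where g = "\<lambda>(p, q) G. apply_on n [p, q] G" and L = 1])
    show "box_dim_le (\<lambda>_. (=)) (A \<times> B) 0" using finite_AB by (intro box_dim_le_finite) auto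
    show "box_dim_le (mat_near 4) (special_unitary_group 4) (2 * 4\<^sup>2)"
      by (rule box_dim_le_subset[OF box_dim_le_unitary S])
    fix e and pq pq' :: "nat \<times> nat" and G G'
    assume "0 < (e :: real)" "pq = pq'" "mat_near 4 e G G'"
    then show "mat_near (2 ^ n) (real 1 * e) ((\<lambda>(p, q) G. apply_on n [p, q] G) pq G)
        ((\<lambda>(p, q) G. apply_on n [p, q] G) pq' G')"
      using sub by (auto simp: mat_near_def apply_on_def split: prod.split)
  next
    fix z assume "z \<in> straddling_unitaries"
    then show "\<exists>x\<in>A \<times> B. \<exists>y\<in>special_unitary_group 4. z = (case x of (p, q) \<Rightarrow> \<lambda>G. apply_on n [p, q] G) y"
      unfolding straddling_unitaries_def by fastforce
  qed simp
  moreover have "\<forall>x\<in>straddling_unitaries. \<forall>i<2 ^ n. \<forall>j<2 ^ n. cmod (x $$ (i, j)) \<le> real 1"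
    using S sub unitary_entry_le_1[of _ 4] by (auto simp: straddling_unitaries_def apply_on_def)
  ultimately show ?thesis
    unfolding bounded_box_dim_le_def using straddling_unitaries_carrier by (auto intro!: exI[of _ 1])
qed

lemma bounded_box_dim_layered:
  "bounded_box_dim_le (2 ^ n) (layered s) ((s + 1) * (2 * K\<^sup>2 + 2 * N\<^sup>2) + 32 * s)"
proof (induction s)
  case 0
  then show ?case using bounded_box_dim_local by simp
next
  case (Suc s)
  let ?m = "\<lambda>s. (s + 1) * (2 * K\<^sup>2 + 2 * N\<^sup>2) + 32 * s"
  have "bounded_box_dim_le (2 ^ n)
      {x * y | x y. x \<in> local_unitaries \<and> y \<in> {g * t | g t. g \<in> straddling_unitaries \<and> t \<in> layered s}}
      ((2 * K\<^sup>2 + 2 * N\<^sup>2) + (32 + ?m s))"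
    by (intro bounded_box_dim_le_mult bounded_box_dim_local bounded_box_dim_straddling Suc.IH)
  moreover have "(2 * K\<^sup>2 + 2 * N\<^sup>2) + (32 + ?m s) = ?m (Suc s)" by simp
  ultimately have "bounded_box_dim_le (2 ^ n)
      {x * y | x y. x \<in> local_unitaries \<and> y \<in> {g * t | g t. g \<in> straddling_unitaries \<and> t \<in> layered s}}
      (?m (Suc s))" by (simp only:)
  moreover have "bounded_box_dim_le (2 ^ n) (layered s) (?m (Suc s))"
    by (rule bounded_box_dim_le_mono[OF Suc.IH]) simp
  ultimately show ?case unfolding layered.simps by (rule bounded_box_dim_le_Un)
qed

text \<open>The index \<open>N + 1\<close> is position 1 on level 1. The diagonal entries at levels
  0, 1 and positions 0, 1 thus form a 2 by 2 array with a single -1, of rank 2, whereas a tensor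
  product would give an array of rank at most 1.\<close>

lemma nonlocal_unitary: "\<exists>U\<in>unitary_group (2 ^ n). U \<notin> local_unitaries"
proof -
  define D where "D = mat_diag (2 ^ n) (\<lambda>i. if i = N + 1 then - 1 else 1 :: complex)"
  have D: "D \<in> unitary_group (2 ^ n)" unfolding D_def by (rule mat_diag_unitary) auto
  have "reindex D \<notin> local_unitaries"
  proof
    assume "reindex D \<in> local_unitaries"
    then obtain V W where eq: "reindex D = reindex (mat_kron K N V W)" unfolding local_unitaries_def by blast
    have eq': "D $$ (i, i) = mat_kron K N V W $$ (i, i)" if "i < 2 ^ n" for i
    proof -
      have "i \<in> joint_index ` {..<2 ^ n}"
        using that bij_betw_imp_surj_on[OF joint_index_bij] by simp
      then obtain j where "j < 2 ^ n" "joint_index j = i" by auto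
      then show ?thesis using arg_cong[OF eq, of "\<lambda>M. M $$ (j, j)"] by (simp add: mat_reindex_def)
    qed
    have entry: "(if x = 1 \<and> y = 1 then - 1 else 1) = V $$ (x, x) * W $$ (y, y)" if "x < 2" "y < 2" for x y
    proof -
      have xy: "x < K" "y < N" "1 < N" using that K_ge_2 N_ge_2 by auto
      then have lt: "x * N + y < K * N" by (intro block_index_less)
      have "x * N + y = N + 1 \<longleftrightarrow> x = 1 \<and> y = 1" using block_index_eq_iff[OF xy(2,3), of x 1] by simp
      then have "D $$ (x * N + y, x * N + y) = (if x = 1 \<and> y = 1 then - 1 else 1)"
        using lt by (simp add: D_def mat_diag_def K_N)
      moreover have "mat_kron K N V W $$ (x * N + y, x * N + y) = V $$ (x, x) * W $$ (y, y)"
        using lt xy by (simp add: mat_kron_def mat_blocks_def)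
      ultimately show ?thesis using eq'[of "x * N + y"] lt by (simp add: K_N)
    qed
    have e: "V $$ (0, 0) * W $$ (0, 0) = 1" "V $$ (0, 0) * W $$ (1, 1) = 1"
      "V $$ (1, 1) * W $$ (0, 0) = 1" "V $$ (1, 1) * W $$ (1, 1) = - 1"
      using entry[of 0 0] entry[of 0 1] entry[of 1 0] entry[of 1 1] by simp_all
    have "(V $$ (0, 0) * W $$ (0, 0)) * (V $$ (1, 1) * W $$ (1, 1)) =
        (V $$ (0, 0) * W $$ (1, 1)) * (V $$ (1, 1) * W $$ (0, 0))" by (simp add: mult_ac)
    then show False unfolding e by simp
  qed
  then show ?thesis using mat_reindex_unitary[OF joint_index_bij D] by blast
qed

theorem max_binding_complexity_ge:
  assumes AB: "card A \<le> card B" and s: "max_binding_complexity n A B \<le> enat s"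
  shows "4 ^ card A \<le> 64 * s"
proof -
  have sub: "unitary_group (2 ^ n) \<subseteq> layered s"
  proof
    fix U assume U: "U \<in> unitary_group (2 ^ n)"
    have "binding_complexity n A B U \<le> max_binding_complexity n A B"
      unfolding max_binding_complexity_def using U by (rule SUP_upper)
    then have "binding_complexity n A B U < enat (Suc s)"
      using s by (meson enat_ord_simps(2) lessI order_le_less_trans order_trans)
    then obtain gs where gs: "implements n A B gs U" "straddling_count gs < Suc s"
      unfolding binding_complexity_def by (auto simp: INF_less_iff)
    then have "U \<in> layered (straddling_count gs)" using circuit_layered by (auto simp: implements_def)
    then show "U \<in> layered s" using gs(2) layered_mono[of "straddling_count gs" s] by auto
  qed
  \<comment> \<open>Layer 0 consists of local unitaries, so a nonlocal one excludes
    \<open>s = 0\<close>. Only then may \<open>s + 1\<close> be bounded by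
    \<open>2 * s\<close>.\<close>
  have s1: "1 \<le> s"
    using nonlocal_unitary sub by (cases s) auto
  have "box_dim_le (mat_near (2 ^ n)) (unitary_group (2 ^ n)) ((s + 1) * (2 * K\<^sup>2 + 2 * N\<^sup>2) + 32 * s)"
    using bounded_box_dim_layered[of s] box_dim_le_subset[OF _ sub] unfolding bounded_box_dim_le_def by blast
  then have dim: "2 ^ n * (2 ^ n - 1) div 2 \<le> (s + 1) * (2 * K\<^sup>2 + 2 * N\<^sup>2) + 32 * s"
    by (rule box_dim_unitary_ge)
  have KN: "K \<le> N" using AB by (intro power_increasing) auto
  have K2: "K\<^sup>2 \<le> N\<^sup>2" using KN by (intro power_mono) auto
  have N2: "4 \<le> N\<^sup>2" using power_mono[OF N_ge_2, of 2] by simp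
  let ?d = "K * N"
  have d4: "4 \<le> ?d" using mult_le_mono[OF K_ge_2 N_ge_2] by simp
  have "?d * ?d \<le> 4 * (?d * (?d - 1) div 2)"
  proof -
    have "even (?d * (?d - 1))" by auto
    then have "4 * (?d * (?d - 1) div 2) = 2 * (?d * (?d - 1))" by (elim evenE) simp
    also have "\<dots> = ?d * (2 * (?d - 1))" by simp
    also have "\<dots> \<ge> ?d * ?d" using d4 by (intro mult_le_mono2) linarith
    finally show ?thesis by simp
  qed
  also have "\<dots> \<le> 4 * ((s + 1) * (2 * K\<^sup>2 + 2 * N\<^sup>2) + 32 * s)"
    using dim unfolding K_N by (intro mult_le_mono2)
  \<comment> \<open>K \<le> N leaves only N^2 in the local term, and 4 \<le> N^2 absorbs the 32
    parameters of each gate. The two terms are 8 s N^2 each, and the leading 4 comes from comparing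
    d^2 with half of d (d - 1); this makes 64.\<close>
  also have "\<dots> \<le> 4 * ((2 * s) * (4 * N\<^sup>2) + 8 * s * N\<^sup>2)"
  proof (rule mult_le_mono2, rule add_mono, rule mult_le_mono)
    show "s + 1 \<le> 2 * s" using s1 by simp
    show "2 * K\<^sup>2 + 2 * N\<^sup>2 \<le> 4 * N\<^sup>2" using K2 by simp
    show "32 * s \<le> 8 * s * N\<^sup>2" using mult_le_mono2[OF N2, of "8 * s"] by simp
  qed
  also have "\<dots> = 64 * s * N\<^sup>2" by simp
  also have "?d * ?d = K\<^sup>2 * N\<^sup>2" by (simp only: power2_eq_square mult_ac)
  finally have "K\<^sup>2 \<le> 64 * s" by (rule mult_right_le_imp_le) simp
  moreover have "K\<^sup>2 = 4 ^ card A" unfolding power_mult[symmetric] mult.commute[of "card A"]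
    by (simp add: power_mult)
  ultimately show ?thesis by (simp only:)
qed

end

theorem mainTheorem4:
  shows "\<exists>c C :: real. 0 < c \<and> 0 < C \<and>
    (\<forall>(k1::nat) (k2::nat) (n::nat) (A::nat set) (B::nat set).
       1 \<le> k1 \<longrightarrow> k1 \<le> k2 \<longrightarrow> n = k1 + k2 \<longrightarrow>
       A \<union> B = {..<n} \<longrightarrow> A \<inter> B = {} \<longrightarrow> card A = k1 \<longrightarrow> card B = k2 \<longrightarrow>
       ereal (c * 4 ^ k1) \<le> ereal_of_enat (max_binding_complexity n A B) \<and>
       ereal_of_enat (max_binding_complexity n A B) \<le> ereal (C * 4 ^ k1))"
proof (rule exI[of _ "1 / 64"], rule exI[of _ 24], intro conjI allI impI)
  fix k1 k2 n :: nat and A B :: "nat set"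
  assume *: "1 \<le> k1" "k1 \<le> k2" "n = k1 + k2" "A \<union> B = {..<n}" "A \<inter> B = {}" "card A = k1" "card B = k2"
  interpret bipartition n A B by unfold_locales (use * in auto)
  have "max_binding_complexity n A B \<le> enat (24 * 4 ^ k1)"
    unfolding max_binding_complexity_def using binding_complexity_le *(6) by (auto intro: SUP_least)
  \<comment> \<open>The upper bound makes the maximum finite, so the lower bound can be applied with
    the maximum itself as \<open>s\<close>.\<close>
  then obtain s where s: "max_binding_complexity n A B = enat s" "s \<le> 24 * 4 ^ k1"
    by (cases "max_binding_complexity n A B") auto
  have "4 ^ k1 \<le> 64 * s"
    using max_binding_complexity_ge[of s] s(1) * by simp
  then have "real (4 ^ k1) \<le> real (64 * s)" by (rule of_nat_mono)
  then show "ereal (1 / 64 * 4 ^ k1) \<le> ereal_of_enat (max_binding_complexity n A B)"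
    by (simp add: s(1))
  have "real s \<le> real (24 * 4 ^ k1)" using s(2) by (rule of_nat_mono)
  then show "ereal_of_enat (max_binding_complexity n A B) \<le> ereal (24 * 4 ^ k1)"
    by (simp add: s(1))
qed auto

end
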